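(* Let $X$ be a $d$-dimensional random vector on a superlinear expectation space $(\Omega,\mathcal{H},\mathbb{E}_* )$, and let $G_*(A)=\frac12\mathbb{E}_*[\langle AX,X\rangle]=\frac12\inf_{\gamma\in\Gamma}\mathrm{tr}\{\gamma\gamma^TA\}$ for symmetric $d\times d$ matrices $A$, where $\Gamma$ is a bounded and closed subset of $\mathbb{R}^{d\times d}$. Then $X$ is $G_*$-normal distributed if and only if, for every $\varphi\in C_{l.Lip}(\mathbb{R}^d)$, the function $$u(t,x)=\mathbb{E}_*[\varphi(x+\sqrt t\,X)],\qquad(t,x)\in[0,\infty)\times\mathbb{R}^d,$$ is the viscosity solution of $$\partial_tu-G_*(D^2u)=0,\qquad u(0,x)=\varphi(x).$$
   Context: $C_{l.Lip}(\mathbb{R}^m)$: functions $\varphi$ with $|\varphi(x)-\varphi(y)|\le C(1+|x|^k+|y|^k)|x-y|$ for some $C>0$, $k\in\mathbb{N}$ depending on $\varphi$. $\Omega$ is a set and $\mathcal{H}$ a linear space of real functions on $\Omega$ such that $\varphi(X_1,\dots,X_m)\in\mathcal{H}$ whenever $X_i\in\mathcal{H}$ and $\varphi\in C_{l.Lip}(\mathbb{R}^m)$; a $d$-dimensional random vector is an element of $\mathcal{H}^d$. A superlinear expectation $\mathbb{E}_*:\mathcal{H}\to\mathbb{R}$ is monotone ($X\ge Y\Rightarrow\mathbb{E}_*[X]\ge\mathbb{E}_*[Y]$), constant preserving ($\mathbb{E}_*[c]=c$), superadditive ($\mathbb{E}_*[X+Y]\ge\mathbb{E}_*[X]+\mathbb{E}_*[Y]$)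 and positively homogeneous ($\mathbb{E}_*[\lambda X]=\lambda\mathbb{E}_*[X]$, $\lambda\ge0$). $X_1\overset d=X_2$ means $\mathbb{E}_*[\varphi(X_1)]=\mathbb{E}_*[\varphi(X_2)]$ for all $\varphi\in C_{l.Lip}$. $Y$ is independent of $X$ if $\mathbb{E}_*[\varphi(X,Y)]=\mathbb{E}_*[\mathbb{E}_*[\varphi(x,Y)]_{x=X}]$ for all $\varphi\in C_{l.Lip}$. $X$ is $G_*$-normal distributed (with zero mean) if $aX+b\overline X\overset d=\sqrt{a^2+b^2}\,X$ for all $a,b\ge0$, where $\overline X$ is an independent copy of $X$ (i.e. $\overline X\overset d=X$ and $\overline X$ is independent of $X$). Viscosity solution of $\partial_tu-F(t,x,u,Du,D^2u)=0$, $u(0,\cdot)=\varphi$: a continuous $u$ with this initial value such that for every test function $\psi\in C_b^{1,3}$ with $u=\psi$ at the point $(t,x)$: $\partial_t\psi-F(t,x,\psi,D\psi,D^2\psi)\le0$ if $u-\psi$ has a local maximum at $(t,x)$ and $\ge0$ if $u-\psi$ has a local minimum at $(t,x)$. *)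

theory Defs
  imports "HOL-Analysis.Analysis"
begin

definition cl_Lip :: "('a::euclidean_space \<Rightarrow> real) \<Rightarrow> bool" where
  "cl_Lip \<phi> \<longleftrightarrow> (\<exists>C>0. \<exists>k::nat. \<forall>x y.
     \<bar>\<phi> x - \<phi> y\<bar> \<le> C * (1 + norm x ^ k + norm y ^ k) * norm (x - y))"

text \<open>
  The same class on the space of dimension \<open>m\<close>, for a dimension that is a number and not a type:
  a vector is the restriction of a sequence to \<open>{..<m}\<close>. The inequality forces \<open>\<phi>\<close> to depend
  on the first \<open>m\<close> coordinates only.
\<close>

definition cl_Lip_dim :: "nat \<Rightarrow> ((nat \<Rightarrow> real) \<Rightarrow> real) \<Rightarrow> bool" where
  "cl_Lip_dim m \<phi> \<longleftrightarrow> (\<exists>C>0. \<exists>k::nat. \<forall>x y.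
     \<bar>\<phi> x - \<phi> y\<bar> \<le>
       C * (1 + L2_set x {..<m} ^ k + L2_set y {..<m} ^ k) * L2_set (\<lambda>i. x i - y i) {..<m})"

text \<open>
  The sample space is the type \<open>'w\<close>. The functional \<open>E\<close> is only meaningful on \<open>H\<close>.
\<close>

locale superlinear_expectation_space =
  fixes H :: "('w \<Rightarrow> real) set" and E :: "('w \<Rightarrow> real) \<Rightarrow> real"
  assumes zero_in: "(\<lambda>_. 0) \<in> H"
    and add_in: "\<And>X Y. X \<in> H \<Longrightarrow> Y \<in> H \<Longrightarrow> (\<lambda>\<omega>. X \<omega> + Y \<omega>) \<in> H"
    and scale_in: "\<And>c X. X \<in> H \<Longrightarrow> (\<lambda>\<omega>. c * X \<omega>) \<in> H"
    and comp_in: "\<And>m \<phi> X. cl_Lip_dim m \<phi> \<Longrightarrow> (\<And>i. i < m \<Longrightarrow> X i \<in> H) \<Longrightarrow>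
                    (\<lambda>\<omega>. \<phi> (\<lambda>i. X i \<omega>)) \<in> H"
    and mono: "\<And>X Y. X \<in> H \<Longrightarrow> Y \<in> H \<Longrightarrow> (\<And>\<omega>. Y \<omega> \<le> X \<omega>) \<Longrightarrow> E Y \<le> E X"
    and const: "\<And>c. E (\<lambda>_. c) = c"
    and superadd: "\<And>X Y. X \<in> H \<Longrightarrow> Y \<in> H \<Longrightarrow> E X + E Y \<le> E (\<lambda>\<omega>. X \<omega> + Y \<omega>)"
    and pos_homogeneous: "\<And>c X. 0 \<le> c \<Longrightarrow> X \<in> H \<Longrightarrow> E (\<lambda>\<omega>. c * X \<omega>) = c * E X"

definition random_vector :: "('w \<Rightarrow> real) set \<Rightarrow> ('w \<Rightarrow> real ^ 'd) \<Rightarrow> bool" where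
  "random_vector H X \<longleftrightarrow> (\<forall>i. (\<lambda>\<omega>. X \<omega> $ i) \<in> H)"

definition eq_dist ::
  "(('w \<Rightarrow> real) \<Rightarrow> real) \<Rightarrow> ('w \<Rightarrow> 'a::euclidean_space) \<Rightarrow> ('w \<Rightarrow> 'a) \<Rightarrow> bool" where
  "eq_dist E X Y \<longleftrightarrow> (\<forall>\<phi>. cl_Lip \<phi> \<longrightarrow> E (\<lambda>\<omega>. \<phi> (X \<omega>)) = E (\<lambda>\<omega>. \<phi> (Y \<omega>)))"

text \<open>
  \<open>independent_of E Y X\<close>: \<open>Y\<close> is independent of \<open>X\<close>. The relation is not symmetric.
\<close>

definition independent_of ::
  "(('w \<Rightarrow> real) \<Rightarrow> real) \<Rightarrow> ('w \<Rightarrow> 'b::euclidean_space) \<Rightarrow> ('w \<Rightarrow> 'a::euclidean_space) \<Rightarrow> bool"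
  where
  "independent_of E Y X \<longleftrightarrow> (\<forall>\<phi> :: 'a \<times> 'b \<Rightarrow> real. cl_Lip \<phi> \<longrightarrow>
     E (\<lambda>\<omega>. \<phi> (X \<omega>, Y \<omega>)) = E (\<lambda>\<omega>. E (\<lambda>\<omega>'. \<phi> (X \<omega>, Y \<omega>'))))"

definition independent_copy ::
  "(('w \<Rightarrow> real) \<Rightarrow> real) \<Rightarrow> ('w \<Rightarrow> 'a::euclidean_space) \<Rightarrow> ('w \<Rightarrow> 'a) \<Rightarrow> bool" where
  "independent_copy E Y X \<longleftrightarrow> eq_dist E Y X \<and> independent_of E Y X"

definition extends_space ::
  "('w \<times> 'w \<Rightarrow> real) set \<Rightarrow> (('w \<times> 'w \<Rightarrow> real) \<Rightarrow> real) \<Rightarrow>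
   ('w \<Rightarrow> real) set \<Rightarrow> (('w \<Rightarrow> real) \<Rightarrow> real) \<Rightarrow> bool" where
  "extends_space H' E' H E \<longleftrightarrow> superlinear_expectation_space H' E' \<and>
     (\<forall>Z\<in>H. (\<lambda>\<omega>. Z (fst \<omega>)) \<in> H' \<and> E' (\<lambda>\<omega>. Z (fst \<omega>)) = E Z)"

text \<open>
  The given space need not carry an independent copy of \<open>X\<close> (for instance if \<open>H\<close> consists of
  functions of \<open>X\<close> only), so, as usual in this theory, the copy lives on an extension of it over
  the product of the sample space with itself, where \<open>X\<close> is identified with \<open>X \<circ> fst\<close>. A copy
  that already exists on the given space is covered: lift all of \<open>H\<close> along \<open>fst\<close>. The
  law of \<open>a X + b X'\<close> does not depend on the choice of the extension and the copy \<open>X'\<close>.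
\<close>

definition G_star_normal ::
  "('w \<Rightarrow> real) set \<Rightarrow> (('w \<Rightarrow> real) \<Rightarrow> real) \<Rightarrow> ('w \<Rightarrow> real ^ 'd) \<Rightarrow> bool" where
  "G_star_normal H E X \<longleftrightarrow> (\<exists>H' E' X'.
     extends_space H' E' H E \<and> random_vector H' X' \<and>
     independent_copy E' X' (\<lambda>\<omega>. X (fst \<omega>)) \<and>
     (\<forall>a\<ge>0. \<forall>b\<ge>0. eq_dist E' (\<lambda>\<omega>. a *\<^sub>R X (fst \<omega>) + b *\<^sub>R X' \<omega>)
                                (\<lambda>\<omega>. sqrt (a\<^sup>2 + b\<^sup>2) *\<^sub>R X (fst \<omega>))))"

definition G_star :: "(('w \<Rightarrow> real) \<Rightarrow> real) \<Rightarrow> ('w \<Rightarrow> real ^ 'd) \<Rightarrow> real ^ 'd ^ 'd \<Rightarrow> real" where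
  "G_star E X A = 1 / 2 * E (\<lambda>\<omega>. (A *v X \<omega>) \<bullet> X \<omega>)"

definition bounded_continuous :: "(real \<Rightarrow> real ^ 'd \<Rightarrow> 'b::real_normed_vector) \<Rightarrow> bool" where
  "bounded_continuous f \<longleftrightarrow>
     continuous_on ({0<..} \<times> UNIV) (\<lambda>(t, x). f t x) \<and>
     bounded ((\<lambda>(t, x). f t x) ` ({0<..} \<times> UNIV))"

text \<open>
  \<open>\<psi>\<close> is of class \<open>C\<^sub>b\<close> with exponents (1,3) on \<open>t > 0\<close>, with time derivative \<open>q\<close>, spatial gradient \<open>p\<close>,
  spatial Hessian \<open>S\<close> and third spatial derivative \<open>T\<close>.
\<close>

definition Cb_1_3 ::
  "(real \<Rightarrow> real ^ 'd \<Rightarrow> real) \<Rightarrow> (real \<Rightarrow> real ^ 'd \<Rightarrow> real) \<Rightarrow> (real \<Rightarrow> real ^ 'd \<Rightarrow> real ^ 'd) \<Rightarrow>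
   (real \<Rightarrow> real ^ 'd \<Rightarrow> real ^ 'd ^ 'd) \<Rightarrow>
   (real \<Rightarrow> real ^ 'd \<Rightarrow> (real ^ 'd) \<Rightarrow>\<^sub>L (real ^ 'd ^ 'd)) \<Rightarrow> bool" where
  "Cb_1_3 \<psi> q p S T \<longleftrightarrow>
     (\<forall>t>0. \<forall>x.
        ((\<lambda>s. \<psi> s x) has_real_derivative q t x) (at t) \<and>
        (\<psi> t has_derivative (\<lambda>h. p t x \<bullet> h)) (at x) \<and>
        (p t has_derivative (\<lambda>h. S t x *v h)) (at x) \<and>
        (S t has_derivative blinfun_apply (T t x)) (at x)) \<and>
     bounded_continuous \<psi> \<and> bounded_continuous q \<and> bounded_continuous p \<and>
     bounded_continuous S \<and> bounded_continuous T"

text \<open>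
  The equation is imposed at interior points \<open>t > 0\<close>.
\<close>

definition viscosity_solution ::
  "(real \<Rightarrow> real ^ 'd \<Rightarrow> real \<Rightarrow> real ^ 'd \<Rightarrow> real ^ 'd ^ 'd \<Rightarrow> real) \<Rightarrow>
   (real ^ 'd \<Rightarrow> real) \<Rightarrow> (real \<Rightarrow> real ^ 'd \<Rightarrow> real) \<Rightarrow> bool" where
  "viscosity_solution F \<phi> u \<longleftrightarrow>
     continuous_on ({0..} \<times> UNIV) (\<lambda>(t, x). u t x) \<and>
     (\<forall>x. u 0 x = \<phi> x) \<and>
     (\<forall>\<psi> q p S T. Cb_1_3 \<psi> q p S T \<longrightarrow> (\<forall>t>0. \<forall>x. u t x = \<psi> t x \<longrightarrow>
        ((\<forall>\<^sub>F (s, y) in nhds (t, x). u s y - \<psi> s y \<le> u t x - \<psi> t x) \<longrightarrow>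
           q t x - F t x (\<psi> t x) (p t x) (S t x) \<le> 0) \<and>
        ((\<forall>\<^sub>F (s, y) in nhds (t, x). u t x - \<psi> t x \<le> u s y - \<psi> s y) \<longrightarrow>
           q t x - F t x (\<psi> t x) (p t x) (S t x) \<ge> 0)))"

end

theory Submission
  imports Defs
begin

text \<open>
  Write \<open>P\<^sub>t \<phi>(x) = E[\<phi>(x + sqrt t X)]\<close>. Normality of \<open>X\<close> amounts to the semigroup law \<open>P\<^sub>s\<^sub>+\<^sub>t = P\<^sub>s P\<^sub>t\<close>.
  If it holds, then \<open>E[p \<bullet> X] = 0\<close> for all \<open>p\<close>, and expanding a test function at \<open>(t - h, x + sqrt h X)\<close>
  in \<open>P\<^sub>t \<phi>(x) = E[P\<^sub>t\<^sub>-\<^sub>h \<phi>(x + sqrt h X)]\<close> gives both viscosity inequalities.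

  Conversely, \<open>t \<mapsto> P\<^sub>t\<^sub>+\<^sub>s \<phi>\<close> and \<open>t \<mapsto> P\<^sub>t P\<^sub>s \<phi>\<close> solve the same Cauchy problem, so uniqueness is needed. As \<open>G\<close>
  is an infimum of linear operators, a subsolution lies below every heat evolution, with one of these
  operators, of a smooth majorant. This property survives convolution, so the mollified subsolution is a
  classical one up to small errors and can be compared with the supersolution directly; the
  theorem on sums is avoided. For periodic data, mollification by Fejer kernels gives trigonometric
  polynomials, whose heat evolution is explicit; general data are approximated by
  \<open>\<phi>(N sin(x\<^sub>1/N), \<dots>, N sin(x\<^sub>d/N))\<close>. The independent copy of \<open>X\<close> is built on the
  product of the sample space with itself.
\<close>

section \<open>Second-order jets and comparison\<close>

text \<open>Comparing two merely continuous solutions would require jets at a common maximum point,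
  which is what the theorem on sums supplies. Mollifying one of them avoids this, but that
  convolution keeps the subsolution property is not visible in the pointwise definition by jets.
  Lying below a heat evolution, in contrast, is an inequality between functions; it passes to
  positive averages of translates because an evolution with constant coefficients commutes with
  translations. Time is cut into slabs of length \<open>h\<close>. On a slab the interpolated mean
  is smooth, and correcting it costs O(h sqrt h), since solutions are Hoelder continuous in time
  with exponent 1/2; the T/h slabs cost O(sqrt h) together. The degree \<open>N\<close> of the mean
  is fixed before \<open>h\<close>, and the degree \<open>D\<close> of the smooth majorant is chosen
  last, which is possible because \<open>D\<close> does not enter the constants. All means are
  finite sums over grids, so that no integrals occur.\<close>

definition outer :: "real ^ 'd \<Rightarrow> real ^ 'd ^ 'd" where
  "outer a = (\<chi> i j. a $ i * a $ j)"

lemma outer_mult_vec: "outer a *v z = (a \<bullet> z) *\<^sub>R a"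
  by (simp add: vec_eq_iff outer_def matrix_vector_mult_def inner_vec_def sum_distrib_left mult_ac)

lemma outer_quadratic: "(outer a *v z) \<bullet> z = (a \<bullet> z)\<^sup>2"
  by (simp add: outer_mult_vec power2_eq_square inner_commute)

text \<open>The term \<open>\<delta> |y - x|\<^sup>2\<close> with arbitrary \<open>\<delta>\<close>, together with \<open>K (s - t)\<^sup>2\<close>, absorbs mixed terms
  \<open>(s - t) |y - x|\<close> and third-order terms in \<open>y - x\<close>.\<close>

definition upper_jet ::
  "(real \<Rightarrow> real ^ 'd \<Rightarrow> real) \<Rightarrow> real \<Rightarrow> real ^ 'd \<Rightarrow> real \<Rightarrow> real ^ 'd \<Rightarrow> real ^ 'd ^ 'd \<Rightarrow> bool"
  where
  "upper_jet f t x q p S \<longleftrightarrow> (\<forall>\<delta>>0. \<exists>K. \<exists>r>0. \<forall>s y. \<bar>s - t\<bar> < r \<longrightarrow> norm (y - x) < r \<longrightarrow>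
     f s y \<le> f t x + q * (s - t) + p \<bullet> (y - x) + (S *v (y - x)) \<bullet> (y - x) / 2
             + \<delta> * (norm (y - x))\<^sup>2 + K * (s - t)\<^sup>2)"

text \<open>The subsolution inequality for u_t = F(D^2 u); only the Hessian enters \<open>F\<close>,
  so \<open>p\<close> is free. A supersolution \<open>u\<close> is expressed by the same predicate,
  as \<open>jet_sub (\<lambda>A. - F (- A))\<close> for \<open>- u\<close>, so that one comparison
  lemma serves both signs.\<close>

definition jet_sub ::
  "(real ^ 'd ^ 'd \<Rightarrow> real) \<Rightarrow> (real \<Rightarrow> real ^ 'd \<Rightarrow> real) \<Rightarrow> bool" where
  "jet_sub F u \<longleftrightarrow> (\<forall>t>0. \<forall>x q p S. upper_jet u t x q p S \<longrightarrow> q \<le> F S)"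

text \<open>Used at a maximum point of \<open>u - f\<close>, where it turns the known derivatives of
  a smooth \<open>f\<close> into a jet of the merely continuous \<open>u\<close>.\<close>

lemma upper_jetI_near:
  assumes "upper_jet f t x q p S" and "r0 > 0"
    and "\<And>s y. \<bar>s - t\<bar> < r0 \<Longrightarrow> norm (y - x) < r0 \<Longrightarrow> u s y - f s y \<le> u t x - f t x"
  shows "upper_jet u t x q p S"
  unfolding upper_jet_def
proof (intro allI impI)
  fix \<delta> :: real assume "\<delta> > 0"
  then obtain K r where r: "r > 0" and K: "\<And>s y. \<bar>s - t\<bar> < r \<Longrightarrow> norm (y - x) < r \<Longrightarrow>
     f s y \<le> f t x + q * (s - t) + p \<bullet> (y - x) + (S *v (y - x)) \<bullet> (y - x) / 2
             + \<delta> * (norm (y - x))\<^sup>2 + K * (s - t)\<^sup>2"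
    using assms(1) unfolding upper_jet_def by meson
  show "\<exists>K. \<exists>r>0. \<forall>s y. \<bar>s - t\<bar> < r \<longrightarrow> norm (y - x) < r \<longrightarrow>
     u s y \<le> u t x + q * (s - t) + p \<bullet> (y - x) + (S *v (y - x)) \<bullet> (y - x) / 2
             + \<delta> * (norm (y - x))\<^sup>2 + K * (s - t)\<^sup>2"
  proof (rule exI[of _ K], rule exI[of _ "min r r0"], intro conjI allI impI)
    fix s y assume "\<bar>s - t\<bar> < min r r0" "norm (y - x) < min r r0"
    then show "u s y \<le> u t x + q * (s - t) + p \<bullet> (y - x) + (S *v (y - x)) \<bullet> (y - x) / 2
             + \<delta> * (norm (y - x))\<^sup>2 + K * (s - t)\<^sup>2"
      using K[of s y] assms(3)[of s y] by simp
  qed (use r assms(2) in auto)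
qed

lemma upper_jet_add:
  assumes "upper_jet f t x q p S" and "upper_jet g t x q' p' S'"
  shows "upper_jet (\<lambda>s y. f s y + g s y) t x (q + q') (p + p') (S + S')"
  unfolding upper_jet_def
proof (intro allI impI)
  fix \<delta> :: real assume "\<delta> > 0"
  then have d2: "\<delta>/2 > 0" by simp
  obtain K r where r: "r > 0" and K: "\<And>s y. \<bar>s - t\<bar> < r \<Longrightarrow> norm (y - x) < r \<Longrightarrow>
     f s y \<le> f t x + q * (s - t) + p \<bullet> (y - x) + (S *v (y - x)) \<bullet> (y - x) / 2
             + \<delta>/2 * (norm (y - x))\<^sup>2 + K * (s - t)\<^sup>2"
    using assms(1) d2 unfolding upper_jet_def by meson
  obtain K' r' where r': "r' > 0" and K': "\<And>s y. \<bar>s - t\<bar> < r' \<Longrightarrow> norm (y - x) < r' \<Longrightarrow>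
     g s y \<le> g t x + q' * (s - t) + p' \<bullet> (y - x) + (S' *v (y - x)) \<bullet> (y - x) / 2
             + \<delta>/2 * (norm (y - x))\<^sup>2 + K' * (s - t)\<^sup>2"
    using assms(2) d2 unfolding upper_jet_def by meson
  show "\<exists>K. \<exists>r>0. \<forall>s y. \<bar>s - t\<bar> < r \<longrightarrow> norm (y - x) < r \<longrightarrow>
     f s y + g s y \<le> f t x + g t x + (q + q') * (s - t) + (p + p') \<bullet> (y - x)
        + ((S + S') *v (y - x)) \<bullet> (y - x) / 2 + \<delta> * (norm (y - x))\<^sup>2 + K * (s - t)\<^sup>2"
  proof (rule exI[of _ "K + K'"], rule exI[of _ "min r r'"], intro conjI allI impI)
    fix s y assume "\<bar>s - t\<bar> < min r r'" "norm (y - x) < min r r'"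
    then show "f s y + g s y \<le> f t x + g t x + (q + q') * (s - t) + (p + p') \<bullet> (y - x)
        + ((S + S') *v (y - x)) \<bullet> (y - x) / 2 + \<delta> * (norm (y - x))\<^sup>2 + (K + K') * (s - t)\<^sup>2"
      using K[of s y] K'[of s y]
      by (simp add: matrix_vector_mult_add_rdistrib inner_add_left inner_add_right field_simps)
  qed (use r r' in auto)
qed

lemma upper_jet_sum:
  assumes "finite J" and "\<And>j. j \<in> J \<Longrightarrow> upper_jet (f j) t x (q j) (p j) (S j)"
  shows "upper_jet (\<lambda>s y. \<Sum>j\<in>J. f j s y) t x (\<Sum>j\<in>J. q j) (\<Sum>j\<in>J. p j) (\<Sum>j\<in>J. S j)"
  using assms
proof (induction J rule: finite_induct)
  case empty
  show ?case unfolding upper_jet_def by (auto intro!: exI[of _ 0] exI[of _ 1])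
next
  case (insert j J)
  then show ?case by (simp add: upper_jet_add)
qed

section \<open>Upper jets of cosines and of the penalty term\<close>

lemma cos_second_order: "\<bar>cos (b + w) - cos b + sin b * w + cos b * w\<^sup>2 / 2\<bar> \<le> \<bar>w :: real\<bar> ^ 3"
proof -
  have s: "\<bar>sin w - w\<bar> \<le> \<bar>w\<bar>^3 / 6"
  proof -
    obtain c where "sin w = (\<Sum>m<3. sin_coeff m * w ^ m) + (sin (c + 1/2 * real 3 * pi) / fact 3) * w ^ 3"
      using Maclaurin_sin_expansion[of w 3] by blast
    then have "sin w - w = sin (c + 1/2 * real 3 * pi) / 6 * w ^ 3"
      by (simp add: numeral_3_eq_3 sin_coeff_def fact_numeral eval_nat_numeral)
    then have "\<bar>sin w - w\<bar> = \<bar>sin (c + 1/2 * real 3 * pi) / 6 * w ^ 3\<bar>"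
      by (rule arg_cong)
    also have "\<dots> = \<bar>sin (c + 1/2 * real 3 * pi)\<bar> / 6 * \<bar>w\<bar> ^ 3"
      by (simp add: abs_mult power_abs)
    finally have "\<bar>sin w - w\<bar> = \<bar>sin (c + 1/2 * real 3 * pi)\<bar> / 6 * \<bar>w\<bar> ^ 3" .
    then show ?thesis
      using abs_sin_le_one[of "c + 1/2 * real 3 * pi"] mult_right_mono[of "\<bar>sin (c + 1/2 * real 3 * pi)\<bar>" 1 "\<bar>w\<bar>^3"]
      by simp
  qed
  have c: "\<bar>cos w - 1 + w\<^sup>2/2\<bar> \<le> \<bar>w\<bar>^3 / 6"
  proof -
    obtain c where "cos w = (\<Sum>m<3. cos_coeff m * w ^ m) + (cos (c + 1/2 * real 3 * pi) / fact 3) * w ^ 3"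
      using Maclaurin_cos_expansion[of w 3] by blast
    then have "cos w - 1 + w\<^sup>2/2 = cos (c + 1/2 * real 3 * pi) / 6 * w ^ 3"
      by (simp add: numeral_3_eq_3 cos_coeff_def fact_numeral eval_nat_numeral)
    then have "\<bar>cos w - 1 + w\<^sup>2/2\<bar> = \<bar>cos (c + 1/2 * real 3 * pi) / 6 * w ^ 3\<bar>"
      by (rule arg_cong)
    also have "\<dots> = \<bar>cos (c + 1/2 * real 3 * pi)\<bar> / 6 * \<bar>w\<bar> ^ 3"
      by (simp add: abs_mult power_abs)
    finally have "\<bar>cos w - 1 + w\<^sup>2/2\<bar> = \<bar>cos (c + 1/2 * real 3 * pi)\<bar> / 6 * \<bar>w\<bar> ^ 3" .
    then show ?thesis
      using abs_cos_le_one[of "c + 1/2 * real 3 * pi"] mult_right_mono[of "\<bar>cos (c + 1/2 * real 3 * pi)\<bar>" 1 "\<bar>w\<bar>^3"]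
      by simp
  qed
  \<comment> \<open>The addition formula reduces the claim to expansions at 0; their two remainders
    |w|^3/6 stay below |w|^3.\<close>
  have "cos (b + w) - cos b + sin b * w + cos b * w\<^sup>2 / 2 = cos b * (cos w - 1 + w\<^sup>2/2) - sin b * (sin w - w)"
    by (simp add: cos_add algebra_simps)
  also have "\<bar>\<dots>\<bar> \<le> \<bar>cos b\<bar> * \<bar>cos w - 1 + w\<^sup>2/2\<bar> + \<bar>sin b\<bar> * \<bar>sin w - w\<bar>"
    by (metis abs_mult abs_triangle_ineq4)
  also have "\<dots> \<le> 1 * (\<bar>w\<bar>^3/6) + 1 * (\<bar>w\<bar>^3/6)"
    by (intro add_mono mult_mono s c) auto
  also have "\<dots> \<le> \<bar>w\<bar>^3" by simp
  finally show ?thesis .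
qed

lemma cos_Lipschitz: "\<bar>cos x - cos y\<bar> \<le> \<bar>x - y :: real\<bar>"
proof -
  have "cos x - cos y = 2 * sin ((x + y)/2) * sin ((y - x)/2)"
    by (rule cos_diff_cos)
  then have "\<bar>cos x - cos y\<bar> = 2 * (\<bar>sin ((x + y)/2)\<bar> * \<bar>sin ((y - x)/2)\<bar>)"
    by (simp add: abs_mult)
  also have "\<dots> \<le> 2 * (1 * \<bar>(y - x)/2\<bar>)"
    by (intro mult_left_mono mult_mono abs_sin_x_le_abs_x) auto
  finally show ?thesis by simp
qed

text \<open>Three errors arise: the time remainder of \<open>g\<close>, absorbed by the term in (s -
  t)^2; the mixed term of order |s - t| |y - x|, split by Young's inequality with half of
  \<open>\<delta>\<close>; and the cubic remainder of the cosine, which takes the other half once |y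
  - x| is small.\<close>

lemma upper_jet_cos:
  fixes a :: "real ^ 'd"
  assumes r: "r > 0" and g: "\<And>s. \<bar>s - t\<bar> < r \<Longrightarrow> \<bar>g s - g t - g' * (s - t)\<bar> \<le> K * (s - t)\<^sup>2"
  shows "upper_jet (\<lambda>s y. g s * cos (a \<bullet> y - \<theta>)) t x (g' * cos (a \<bullet> x - \<theta>))
           ((- (g t * sin (a \<bullet> x - \<theta>))) *\<^sub>R a) ((- (g t * cos (a \<bullet> x - \<theta>))) *\<^sub>R outer a)"
  unfolding upper_jet_def
proof (intro allI impI)
  fix \<delta> :: real assume \<delta>: "\<delta> > 0"
  define c where "c = norm a"
  have c0: "c \<ge> 0" by (simp add: c_def)
  \<comment> \<open>The second bound on the radius makes the factor |g t| |a|^3 |y - x| of the cubic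
    remainder at most \<delta>/2.\<close>
  define r' where "r' = min r (\<delta> / (2 * (\<bar>g t\<bar> * c^3 + 1)))"
  have den: "\<bar>g t\<bar> * c^3 + 1 > 0" using c0 by (smt (verit) abs_ge_zero mult_nonneg_nonneg zero_le_power)
  have r'0: "r' > 0" using r \<delta> den by (simp add: r'_def)
  define K' where "K' = \<bar>K\<bar> + (\<bar>g'\<bar> * c)\<^sup>2 / (2 * \<delta>)"
  show "\<exists>K. \<exists>r>0. \<forall>s y. \<bar>s - t\<bar> < r \<longrightarrow> norm (y - x) < r \<longrightarrow> g s * cos (a \<bullet> y - \<theta>)
     \<le> g t * cos (a \<bullet> x - \<theta>) + g' * cos (a \<bullet> x - \<theta>) * (s - t) + ((- (g t * sin (a \<bullet> x - \<theta>))) *\<^sub>R a) \<bullet> (y - x)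
        + (((- (g t * cos (a \<bullet> x - \<theta>))) *\<^sub>R outer a) *v (y - x)) \<bullet> (y - x) / 2
        + \<delta> * (norm (y - x))\<^sup>2 + K * (s - t)\<^sup>2"
  proof (rule exI[of _ K'], rule exI[of _ r'], intro conjI allI impI r'0)
    fix s y assume s: "\<bar>s - t\<bar> < r'" and y: "norm (y - x) < r'"
    define w where "w = a \<bullet> (y - x)"
    define b where "b = a \<bullet> x - \<theta>"
    define n where "n = norm (y - x)"
    have n0: "n \<ge> 0" by (simp add: n_def)
    have w: "\<bar>w\<bar> \<le> c * n" unfolding w_def c_def n_def by (rule Cauchy_Schwarz_ineq2)
    have yb: "a \<bullet> y - \<theta> = b + w" by (simp add: b_def w_def inner_diff_right)
    have quad: "((c' *\<^sub>R outer a) *v (y - x)) \<bullet> (y - x) = c' * w\<^sup>2" for c'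
      by (simp add: scaleR_matrix_vector_assoc[symmetric] outer_quadratic w_def)
    have e1: "(g s - g t - g' * (s - t)) * cos (b + w) \<le> \<bar>K\<bar> * (s - t)\<^sup>2"
    proof -
      have "(g s - g t - g' * (s - t)) * cos (b + w) \<le> \<bar>g s - g t - g' * (s - t)\<bar> * \<bar>cos (b + w)\<bar>"
        by (metis abs_ge_self abs_mult)
      also have "\<dots> \<le> (K * (s - t)\<^sup>2) * 1"
        using g[of s] s by (intro mult_mono) (auto simp: r'_def)
      also have "\<dots> \<le> \<bar>K\<bar> * (s - t)\<^sup>2" by (simp add: mult_right_mono)
      finally show ?thesis .
    qed
    have e2: "g' * (s - t) * (cos (b + w) - cos b) \<le> \<delta>/2 * n\<^sup>2 + (\<bar>g'\<bar> * c)\<^sup>2 / (2 * \<delta>) * (s - t)\<^sup>2"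
    proof -
      have "g' * (s - t) * (cos (b + w) - cos b) \<le> (\<bar>g'\<bar> * \<bar>s - t\<bar>) * \<bar>cos (b + w) - cos b\<bar>"
        by (metis abs_ge_self abs_mult)
      also have "\<dots> \<le> (\<bar>g'\<bar> * \<bar>s - t\<bar>) * (c * n)"
        using cos_Lipschitz[of "b + w" b] w by (intro mult_left_mono) auto
      also have "\<dots> = n * (\<bar>g'\<bar> * c * \<bar>s - t\<bar>)" by simp
      also have "\<dots> \<le> \<delta>/2 * n\<^sup>2 + (\<bar>g'\<bar> * c * \<bar>s - t\<bar>)\<^sup>2 / (2 * \<delta>)"
      proof -
        define v where "v = \<bar>g'\<bar> * c * \<bar>s - t\<bar>"
        have "0 \<le> (\<delta> * n - v)\<^sup>2" by simp
        then have "2 * \<delta> * (n * v) \<le> \<delta>\<^sup>2 * n\<^sup>2 + v\<^sup>2" by (simp add: power2_eq_square algebra_simps)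
        then have "n * v \<le> (\<delta>\<^sup>2 * n\<^sup>2 + v\<^sup>2) / (2 * \<delta>)"
          using \<delta> by (simp add: field_simps)
        also have "\<dots> = \<delta>/2 * n\<^sup>2 + v\<^sup>2 / (2 * \<delta>)" using \<delta> by (simp add: field_simps power2_eq_square)
        finally show ?thesis by (simp add: v_def)
      qed
      also have "(\<bar>g'\<bar> * c * \<bar>s - t\<bar>)\<^sup>2 / (2 * \<delta>) = (\<bar>g'\<bar> * c)\<^sup>2 / (2 * \<delta>) * (s - t)\<^sup>2"
        by (simp add: power_mult_distrib)
      finally show ?thesis .
    qed
    have e3: "g t * (cos (b + w) - cos b + sin b * w + cos b * w\<^sup>2 / 2) \<le> \<delta>/2 * n\<^sup>2"
    proof -
      have "g t * (cos (b + w) - cos b + sin b * w + cos b * w\<^sup>2 / 2) \<le> \<bar>g t\<bar> * \<bar>cos (b + w) - cos b + sin b * w + cos b * w\<^sup>2 / 2\<bar>"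
        by (metis abs_ge_self abs_mult)
      also have "\<dots> \<le> \<bar>g t\<bar> * \<bar>w\<bar>^3" by (intro mult_left_mono cos_second_order) auto
      also have "\<dots> \<le> \<bar>g t\<bar> * (c * n)^3" using w by (intro mult_left_mono power_mono) auto
      also have "\<dots> = (\<bar>g t\<bar> * c^3 * n) * n\<^sup>2" by (simp add: power_mult_distrib eval_nat_numeral)
      also have "\<dots> \<le> (\<delta>/2) * n\<^sup>2"
      proof (intro mult_right_mono)
        have "n \<le> \<delta> / (2 * (\<bar>g t\<bar> * c^3 + 1))" using y by (simp add: n_def r'_def)
        then have "(\<bar>g t\<bar> * c^3 + 1) * n \<le> \<delta>/2" using den by (simp add: field_simps)
        then show "\<bar>g t\<bar> * c^3 * n \<le> \<delta>/2" using n0 by (simp add: algebra_simps)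
      qed simp
      finally show ?thesis .
    qed
    have "g s * cos (b + w) = g t * cos b + g' * cos b * (s - t) - g t * sin b * w - g t * cos b * w\<^sup>2 / 2
       + (g s - g t - g' * (s - t)) * cos (b + w) + g' * (s - t) * (cos (b + w) - cos b)
       + g t * (cos (b + w) - cos b + sin b * w + cos b * w\<^sup>2 / 2)"
      by (simp add: algebra_simps)
    also have "\<dots> \<le> g t * cos b + g' * cos b * (s - t) - g t * sin b * w - g t * cos b * w\<^sup>2 / 2
       + \<bar>K\<bar> * (s - t)\<^sup>2 + (\<delta>/2 * n\<^sup>2 + (\<bar>g'\<bar> * c)\<^sup>2 / (2 * \<delta>) * (s - t)\<^sup>2) + \<delta>/2 * n\<^sup>2"
      by (intro add_mono e1 e2 e3 order_refl)
    also have "\<dots> = g t * cos b + g' * cos b * (s - t) - g t * sin b * w - g t * cos b * w\<^sup>2 / 2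
       + \<delta> * n\<^sup>2 + K' * (s - t)\<^sup>2" by (simp add: K'_def algebra_simps)
    finally show "g s * cos (a \<bullet> y - \<theta>)
     \<le> g t * cos (a \<bullet> x - \<theta>) + g' * cos (a \<bullet> x - \<theta>) * (s - t) + ((- (g t * sin (a \<bullet> x - \<theta>))) *\<^sub>R a) \<bullet> (y - x)
        + (((- (g t * cos (a \<bullet> x - \<theta>))) *\<^sub>R outer a) *v (y - x)) \<bullet> (y - x) / 2
        + \<delta> * (norm (y - x))\<^sup>2 + K' * (s - t)\<^sup>2"
      unfolding yb
      by (simp add: quad[of "- (g t * cos b)", simplified] w_def[symmetric] b_def[symmetric] n_def[symmetric])
  qed
qed

text \<open>The penalty of the comparison argument. Its time part blows up at \<open>b\<close> and
  its spatial part at infinity, so that maxima are attained; for positive \<open>\<eta>\<close> the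
  time derivative \<open>\<eta> / (b - t)\<^sup>2\<close> is the strict gain that yields the
  contradiction.\<close>

lemma upper_jet_penalty:
  fixes x :: "real ^ 'd"
  assumes "t < b" and "\<eta> \<ge> 0"
  shows "upper_jet (\<lambda>s y. \<eta> / (b - s) + \<beta> * (norm y)\<^sup>2) t x (\<eta> / (b - t)\<^sup>2) ((2 * \<beta>) *\<^sub>R x) ((2 * \<beta>) *\<^sub>R mat 1)"
  unfolding upper_jet_def
proof (intro allI impI)
  fix \<delta> :: real assume \<delta>: "\<delta> > 0"
  define c where "c = b - t"
  have c: "c > 0" using assms by (simp add: c_def)
  show "\<exists>K. \<exists>r>0. \<forall>s y. \<bar>s - t\<bar> < r \<longrightarrow> norm (y - x) < r \<longrightarrow>
     \<eta> / (b - s) + \<beta> * (norm y)\<^sup>2 \<le> \<eta> / (b - t) + \<beta> * (norm x)\<^sup>2 + \<eta> / (b - t)\<^sup>2 * (s - t)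
       + ((2 * \<beta>) *\<^sub>R x) \<bullet> (y - x) + (((2 * \<beta>) *\<^sub>R mat 1) *v (y - x)) \<bullet> (y - x) / 2
             + \<delta> * (norm (y - x))\<^sup>2 + K * (s - t)\<^sup>2"
  \<comment> \<open>The remainder of 1/(c - h) after its linear part is h^2/(c^2 (c - h)), and c - h
    \<ge> c/2 within the radius c/2.\<close>
  proof (rule exI[of _ "2 * \<eta> / c^3"], rule exI[of _ "c / 2"], intro conjI allI impI)
    fix s y assume s: "\<bar>s - t\<bar> < c / 2"
    define h where "h = s - t"
    have h: "\<bar>h\<bar> < c / 2" using s by (simp add: h_def)
    have bs: "b - s = c - h" by (simp add: c_def h_def)
    have ch: "c - h \<ge> c / 2" using h by linarith
    have id: "1 / (c - h) = 1 / c + h / c\<^sup>2 + h\<^sup>2 / (c\<^sup>2 * (c - h))"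
      using c ch by (simp add: field_simps power2_eq_square)
    have "h\<^sup>2 / (c\<^sup>2 * (c - h)) \<le> h\<^sup>2 / (c\<^sup>2 * (c / 2))"
      using c ch by (intro divide_left_mono mult_left_mono) auto
    also have "\<dots> = 2 / c^3 * h\<^sup>2" by (simp add: power2_eq_square power3_eq_cube)
    finally have "1 / (c - h) \<le> 1 / c + h / c\<^sup>2 + 2 / c^3 * h\<^sup>2" using id by simp
    then have "\<eta> * (1 / (c - h)) \<le> \<eta> * (1 / c + h / c\<^sup>2 + 2 / c^3 * h\<^sup>2)"
      by (rule mult_left_mono) fact
    then have 1: "\<eta> / (b - s) \<le> \<eta> / (b - t) + \<eta> / (b - t)\<^sup>2 * (s - t) + 2 * \<eta> / c^3 * (s - t)\<^sup>2"
      by (simp add: bs c_def[symmetric] h_def[symmetric] algebra_simps)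
    have 2: "(norm y)\<^sup>2 = (norm x)\<^sup>2 + 2 * (x \<bullet> (y - x)) + (norm (y - x))\<^sup>2"
      by (simp add: power2_norm_eq_inner inner_diff_left inner_diff_right inner_commute)
    have 3: "(((2 * \<beta>) *\<^sub>R mat 1) *v (y - x)) \<bullet> (y - x) / 2 = \<beta> * (norm (y - x))\<^sup>2"
      by (simp add: scaleR_matrix_vector_assoc[symmetric] matrix_vector_mul_lid power2_norm_eq_inner)
    have 4: "\<delta> * (norm (y - x))\<^sup>2 \<ge> 0" using \<delta> by simp
    show "\<eta> / (b - s) + \<beta> * (norm y)\<^sup>2 \<le> \<eta> / (b - t) + \<beta> * (norm x)\<^sup>2 + \<eta> / (b - t)\<^sup>2 * (s - t)
       + ((2 * \<beta>) *\<^sub>R x) \<bullet> (y - x) + (((2 * \<beta>) *\<^sub>R mat 1) *v (y - x)) \<bullet> (y - x) / 2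
             + \<delta> * (norm (y - x))\<^sup>2 + 2 * \<eta> / c^3 * (s - t)\<^sup>2"
      unfolding 3 using 1 4 unfolding 2 by (simp add: algebra_simps)
  qed (use c in auto)
qed

text \<open>Because \<open>f\<close> has a jet with the supersolution inequality at every interior
  time, \<open>u - f\<close> minus the penalty can be maximized directly, without doubling
  variables. At a maximum \<open>u\<close> inherits the sum of both jets; the gain
  \<open>\<eta> / (b - s0)\<^sup>2\<close> exceeds the loss \<open>2 * C * \<beta>\<close> in
  \<open>F\<close>, contrary to \<open>jet_sub F u\<close>. The time \<open>t\<close> stays strictly
  below \<open>b\<close> as the penalty blows up there.\<close>

lemma comparison:
  fixes u f :: "real \<Rightarrow> real ^ 'd \<Rightarrow> real"
  assumes sub: "jet_sub F u"
    and F: "\<And>S \<beta>. \<beta> \<ge> 0 \<Longrightarrow> F (S + \<beta> *\<^sub>R mat 1) \<le> F S + C * \<beta>"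
    and a0: "0 \<le> a"
    and cu: "continuous_on ({a..b} \<times> UNIV) (\<lambda>(s, y). u s y)"
    and cf: "continuous_on ({a..b} \<times> UNIV) (\<lambda>(s, y). f s y)"
    and bu: "\<And>s y. a \<le> s \<Longrightarrow> s \<le> b \<Longrightarrow> \<bar>u s y\<bar> \<le> B"
    and bf: "\<And>s y. a \<le> s \<Longrightarrow> s \<le> b \<Longrightarrow> \<bar>f s y\<bar> \<le> B"
    and jet: "\<And>s y. a < s \<Longrightarrow> s < b \<Longrightarrow> \<exists>q p S. upper_jet f s y q p S \<and> F S \<le> q"
    and init: "\<And>y. u a y \<le> f a y"
    and t: "a \<le> t" "t < b"
  shows "u t x \<le> f t x"
proof (rule ccontr)
  assume neg: "\<not> u t x \<le> f t x"
  define m where "m = u t x - f t x"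
  have m: "m > 0" using neg by (simp add: m_def)
  have B: "B \<ge> 0" using bu[of t x] t by linarith
  \<comment> \<open>This makes the time penalty at \<open>t\<close> equal to
    \<open>m / 4\<close>.\<close>
  define \<eta> where "\<eta> = m / 4 * (b - t)"
  have \<eta>: "\<eta> > 0" using m t by (simp add: \<eta>_def)
  have ba: "b - a > 0" using t by simp
  \<comment> \<open>The first entry keeps the spatial penalty at \<open>x\<close> at most
    \<open>m / 4\<close>; the second makes the loss \<open>2 * C * \<beta>\<close> smaller than the
    least possible gain \<open>\<eta> / (b - a)\<^sup>2\<close>.\<close>
  define \<beta> where "\<beta> = min (m / (4 * (1 + (norm x)\<^sup>2))) (\<eta> / ((b - a)\<^sup>2 * (2 * \<bar>C\<bar> + 1)))"
  have den: "1 + (norm x)\<^sup>2 > 0" by (smt (verit) zero_le_power2)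
  have \<beta>: "\<beta> > 0" using m \<eta> ba den by (simp add: \<beta>_def)
  have \<beta>x: "\<beta> * (norm x)\<^sup>2 \<le> m / 4"
  proof -
    have "\<beta> * (norm x)\<^sup>2 \<le> \<beta> * (1 + (norm x)\<^sup>2)" using \<beta> by simp
    also have "\<dots> \<le> m / (4 * (1 + (norm x)\<^sup>2)) * (1 + (norm x)\<^sup>2)"
      using den by (intro mult_right_mono) (auto simp: \<beta>_def)
    also have "\<dots> = m / 4" using den by (simp add: field_simps)
    finally show ?thesis .
  qed
  have \<beta>C: "2 * C * \<beta> < \<eta> / (b - a)\<^sup>2"
  proof -
    have "\<beta> * (2 * \<bar>C\<bar> + 1) \<le> \<eta> / ((b - a)\<^sup>2 * (2 * \<bar>C\<bar> + 1)) * (2 * \<bar>C\<bar> + 1)"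
      by (intro mult_right_mono) (auto simp: \<beta>_def)
    also have "\<dots> = \<eta> / (b - a)\<^sup>2"
    proof -
      have "2 * \<bar>C\<bar> + 1 \<noteq> 0" by simp
      then show ?thesis by simp
    qed
    finally have "\<beta> * (2 * \<bar>C\<bar> + 1) \<le> \<eta> / (b - a)\<^sup>2" .
    moreover have "2 * C * \<beta> < \<beta> * (2 * \<bar>C\<bar> + 1)"
    proof -
      have "C * \<beta> \<le> \<bar>C\<bar> * \<beta>" using \<beta> by (intro mult_right_mono) auto
      moreover have "\<beta> * (2 * \<bar>C\<bar> + 1) = 2 * (\<bar>C\<bar> * \<beta>) + \<beta>" by (simp add: algebra_simps)
      ultimately show ?thesis using \<beta> by linarith
    qed
    ultimately show ?thesis by linarith
  qed
  define v where "v s y = u s y - f s y - (\<eta> / (b - s) + \<beta> * (norm y)\<^sup>2)" for s y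
  have vt: "v t x > 0"
  proof -
    have "b - t \<noteq> 0" using t by simp
    then have "\<eta> / (b - t) = m / 4" unfolding \<eta>_def by (rule nonzero_mult_div_cancel_right)
    then show ?thesis using \<beta>x m by (simp add: v_def m_def[symmetric])
  qed
  \<comment> \<open>\<open>u - f\<close> is at most \<open>2 * B\<close>. After \<open>b'\<close>
    the time penalty exceeds this, and outside radius \<open>R\<close> the spatial one does, so
    positive values of \<open>v\<close> occur only in a compact set.\<close>
  define b' where "b' = max t (b - \<eta> / (2 * B + 1))"
  define R where "R = norm x + sqrt ((2 * B + 1) / \<beta>)"
  have b': "b' < b" "t \<le> b'" using \<eta> B t by (auto simp: b'_def)
  have uf: "u s y - f s y \<le> 2 * B" if "a \<le> s" "s \<le> b" for s y
    using bu[OF that, of y] bf[OF that, of y] by linarith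
  have v_late: "v s y \<le> 0" if "b' < s" "s < b" for s y
  proof -
    have "b - s < \<eta> / (2 * B + 1)" using that by (simp add: b'_def)
    then have "(2 * B + 1) * (b - s) < \<eta>" using B by (simp add: field_simps)
    then have "2 * B + 1 < \<eta> / (b - s)" using that by (simp add: field_simps)
    moreover have "\<beta> * (norm y)\<^sup>2 \<ge> 0" using \<beta> by simp
    ultimately show ?thesis using uf[of s y] that b' t by (simp add: v_def)
  qed
  have v_far: "v s y \<le> 0" if "a \<le> s" "s < b" "norm y > R" for s y
  proof -
    have "sqrt ((2 * B + 1) / \<beta>) < norm y" using that norm_ge_zero[of x] unfolding R_def by linarith
    then have "sqrt ((2 * B + 1) / \<beta>) < sqrt ((norm y)\<^sup>2)" by simp
    then have "(2 * B + 1) / \<beta> < (norm y)\<^sup>2" by (simp only: real_sqrt_less_iff)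
    then have "2 * B + 1 < \<beta> * (norm y)\<^sup>2" using \<beta> by (simp add: field_simps)
    moreover have "\<eta> / (b - s) \<ge> 0" using \<eta> that by simp
    ultimately show ?thesis using uf[of s y] that by (simp add: v_def)
  qed
  have xR: "norm x \<le> R" using B \<beta> by (simp add: R_def)
  have "compact ({a..b'} \<times> cball (0 :: real ^ 'd) R)" by (intro compact_Times) auto
  moreover have "{a..b'} \<times> cball (0 :: real ^ 'd) R \<noteq> {}"
  proof -
    have "(t, x) \<in> {a..b'} \<times> cball 0 R" using t b' xR by simp
    then show ?thesis by blast
  qed
  moreover have "continuous_on ({a..b'} \<times> cball 0 R) (\<lambda>(s, y). v s y)"
  proof -
    have sub: "{a..b'} \<times> cball (0 :: real ^ 'd) R \<subseteq> {a..b} \<times> UNIV" using b' by auto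
    show ?thesis
      unfolding v_def case_prod_unfold
      using continuous_on_subset[OF cu sub] continuous_on_subset[OF cf sub] b'
      by (intro continuous_intros) (auto simp: case_prod_unfold)
  qed
  ultimately obtain z where z: "z \<in> {a..b'} \<times> cball 0 R"
    "\<And>z'. z' \<in> {a..b'} \<times> cball 0 R \<Longrightarrow> (\<lambda>(s, y). v s y) z' \<le> (\<lambda>(s, y). v s y) z"
    using continuous_attains_sup by (metis (no_types, lifting))
  obtain s0 y0 where z0: "z = (s0, y0)" by (cases z)
  have mx0: "v s y \<le> v s0 y0" if "a \<le> s" "s \<le> b'" "norm y \<le> R" for s y
    using z(2)[of "(s, y)"] that by (simp add: z0)
  have s0: "a \<le> s0" "s0 \<le> b'" using z(1) by (auto simp: z0)
  have v0: "v s0 y0 > 0" using mx0[of t x] vt t b' xR by linarith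
  have mx: "v s y \<le> v s0 y0" if "a \<le> s" "s < b" for s y
    using mx0[of s y] v_late[of s y] v_far[of s y] v0 that by (meson less_le_not_le linorder_le_less_linear order.trans)
  have "s0 \<noteq> a"
  proof
    assume "s0 = a"
    moreover have "\<eta> / (b - a) \<ge> 0" "\<beta> * (norm y0)\<^sup>2 \<ge> 0" using \<eta> ba \<beta> by auto
    ultimately show False using v0 init[of y0] by (simp add: v_def)
  qed
  then have as: "a < s0" and sb: "s0 < b" using s0 b' by auto
  obtain q p S where J: "upper_jet f s0 y0 q p S" and q: "F S \<le> q" using jet[OF as sb] by blast
  have "upper_jet u s0 y0 (q + \<eta> / (b - s0)\<^sup>2) (p + (2 * \<beta>) *\<^sub>R y0) (S + (2 * \<beta>) *\<^sub>R mat 1)"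
  proof (rule upper_jetI_near[OF upper_jet_add[OF J upper_jet_penalty[OF sb less_imp_le[OF \<eta>], of \<beta> y0]], of "min (s0 - a) (b - s0)"])
    fix s y assume "\<bar>s - s0\<bar> < min (s0 - a) (b - s0)"
    then have "v s y \<le> v s0 y0" by (intro mx) auto
    then show "u s y - (f s y + (\<eta> / (b - s) + \<beta> * (norm y)\<^sup>2))
      \<le> u s0 y0 - (f s0 y0 + (\<eta> / (b - s0) + \<beta> * (norm y0)\<^sup>2))" by (simp add: v_def)
  qed (use as sb in auto)
  then have "q + \<eta> / (b - s0)\<^sup>2 \<le> F (S + (2 * \<beta>) *\<^sub>R mat 1)"
    using sub as a0 unfolding jet_sub_def by (meson le_less_trans)
  also have "\<dots> \<le> F S + C * (2 * \<beta>)" using \<beta> by (intro F) simp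
  finally have "\<eta> / (b - s0)\<^sup>2 \<le> 2 * C * \<beta>" using q by simp
  moreover have "\<eta> / (b - a)\<^sup>2 \<le> \<eta> / (b - s0)\<^sup>2"
    using \<eta> as sb by (intro divide_left_mono power_mono) auto
  ultimately show False using \<beta>C by linarith
qed

section \<open>Viscosity solutions and jets\<close>

definition outer_deriv :: "real ^ 'd \<Rightarrow> (real ^ 'd) \<Rightarrow>\<^sub>L (real ^ 'd ^ 'd)" where
  "outer_deriv a = Blinfun (\<lambda>h. (a \<bullet> h) *\<^sub>R outer a)"

lemma outer_deriv_apply: "blinfun_apply (outer_deriv a) h = (a \<bullet> h) *\<^sub>R outer a"
proof -
  have "bounded_linear (\<lambda>h. (a \<bullet> h) *\<^sub>R outer a)"
    by (intro bounded_linear_scaleR_const bounded_linear_inner_right)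
  then show ?thesis by (simp add: outer_deriv_def bounded_linear_Blinfun_apply)
qed

text \<open>The spatial part of a test function. The upper jet of \<open>- V\<close> bounds
  \<open>V\<close> from below by its second-order expansion; it is carried along because touching
  needs an inequality near the point, not only derivatives at it.\<close>

definition smooth_test ::
  "(real ^ 'd \<Rightarrow> real) \<Rightarrow> (real ^ 'd \<Rightarrow> real ^ 'd) \<Rightarrow> (real ^ 'd \<Rightarrow> real ^ 'd ^ 'd) \<Rightarrow>
   (real ^ 'd \<Rightarrow> (real ^ 'd) \<Rightarrow>\<^sub>L (real ^ 'd ^ 'd)) \<Rightarrow> bool" where
  "smooth_test V p S T \<longleftrightarrow>
     (\<forall>x. (V has_derivative (\<lambda>h. p x \<bullet> h)) (at x) \<and>
          (p has_derivative (\<lambda>h. S x *v h)) (at x) \<and>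
          (S has_derivative blinfun_apply (T x)) (at x) \<and>
          (\<forall>t. upper_jet (\<lambda>s y. - V y) t x 0 (- p x) (- S x))) \<and>
     continuous_on UNIV T \<and>
     bounded (range V) \<and> bounded (range p) \<and> bounded (range S) \<and> bounded (range T)"

lemma smooth_test_cos:
  fixes a :: "real ^ 'd"
  shows "smooth_test (\<lambda>y. c * cos (a \<bullet> y - \<theta>)) (\<lambda>y. (- (c * sin (a \<bullet> y - \<theta>))) *\<^sub>R a)
    (\<lambda>y. (- (c * cos (a \<bullet> y - \<theta>))) *\<^sub>R outer a) (\<lambda>y. (c * sin (a \<bullet> y - \<theta>)) *\<^sub>R outer_deriv a)"
  unfolding smooth_test_def
proof (intro conjI allI)
  fix x t
  show "((\<lambda>y. c * cos (a \<bullet> y - \<theta>)) has_derivative (\<lambda>h. ((- (c * sin (a \<bullet> x - \<theta>))) *\<^sub>R a) \<bullet> h)) (at x)"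
    by (auto intro!: derivative_eq_intros simp: fun_eq_iff)
  show "((\<lambda>y. (- (c * sin (a \<bullet> y - \<theta>))) *\<^sub>R a) has_derivative
    (\<lambda>h. ((- (c * cos (a \<bullet> x - \<theta>))) *\<^sub>R outer a) *v h)) (at x)"
    unfolding scaleR_matrix_vector_assoc[symmetric] outer_mult_vec
    by (auto intro!: derivative_eq_intros simp: fun_eq_iff)
  show "((\<lambda>y. (- (c * cos (a \<bullet> y - \<theta>))) *\<^sub>R outer a) has_derivative
    blinfun_apply ((c * sin (a \<bullet> x - \<theta>)) *\<^sub>R outer_deriv a)) (at x)"
    by (auto intro!: derivative_eq_intros simp: fun_eq_iff scaleR_blinfun.rep_eq outer_deriv_apply)
  show "upper_jet (\<lambda>s y. - (c * cos (a \<bullet> y - \<theta>))) t x 0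
    (- ((- (c * sin (a \<bullet> x - \<theta>))) *\<^sub>R a)) (- ((- (c * cos (a \<bullet> x - \<theta>))) *\<^sub>R outer a))"
    using upper_jet_cos[of 1 t "\<lambda>_. - c" 0 0 a \<theta> x] by simp
next
  have bd: "bounded (range (\<lambda>y. (g y) *\<^sub>R v))" if "\<And>y. \<bar>g y\<bar> \<le> \<bar>c\<bar>" for g :: "real ^ 'd \<Rightarrow> real" and v :: "'v::real_normed_vector"
    unfolding bounded_iff using that
    by (auto intro!: exI[of _ "\<bar>c\<bar> * norm v"] mult_right_mono)
  have sn: "\<bar>c * sin z\<bar> \<le> \<bar>c\<bar>" "\<bar>c * cos z\<bar> \<le> \<bar>c\<bar>" for z
    using mult_left_mono[OF abs_sin_le_one[of z], of "\<bar>c\<bar>"] mult_left_mono[OF abs_cos_le_one[of z], of "\<bar>c\<bar>"]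
    by (auto simp: abs_mult)
  show "continuous_on UNIV (\<lambda>y. (c * sin (a \<bullet> y - \<theta>)) *\<^sub>R outer_deriv a)"
    by (intro continuous_intros)
  show "bounded (range (\<lambda>y. c * cos (a \<bullet> y - \<theta>)))"
    using bd[of "\<lambda>y. c * cos (a \<bullet> y - \<theta>)" "1::real"] sn by simp
  show "bounded (range (\<lambda>y. (- (c * sin (a \<bullet> y - \<theta>))) *\<^sub>R a))"
    by (rule bd) (use sn in auto)
  show "bounded (range (\<lambda>y. (- (c * cos (a \<bullet> y - \<theta>))) *\<^sub>R outer a))"
    by (rule bd) (use sn in auto)
  show "bounded (range (\<lambda>y. (c * sin (a \<bullet> y - \<theta>)) *\<^sub>R outer_deriv a))"
    by (rule bd) (use sn in auto)
qed

lemma bounded_range_add: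
  fixes f g :: "'a \<Rightarrow> 'b::real_normed_vector"
  assumes "bounded (range f)" and "bounded (range g)"
  shows "bounded (range (\<lambda>x. f x + g x))"
  using bounded_plus[OF assms] by (rule bounded_subset) auto

lemma smooth_test_add:
  assumes "smooth_test V p S T" and "smooth_test V' p' S' T'"
  shows "smooth_test (\<lambda>y. V y + V' y) (\<lambda>y. p y + p' y) (\<lambda>y. S y + S' y) (\<lambda>y. T y + T' y)"
  using assms unfolding smooth_test_def
proof (intro conjI allI, goal_cases)
  case (1 x)
  then show ?case by (auto intro!: derivative_eq_intros simp: fun_eq_iff inner_add_left)
next
  case (2 x)
  then show ?case by (auto intro!: derivative_eq_intros simp: fun_eq_iff matrix_vector_mult_add_rdistrib)
next
  case (3 x)
  then have "((\<lambda>y. S y + S' y) has_derivative (\<lambda>h. blinfun_apply (T x) h + blinfun_apply (T' x) h)) (at x)"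
    by (auto intro!: has_derivative_add)
  then show ?case by (simp add: plus_blinfun.rep_eq)
next
  case (4 x t)
  then have "upper_jet (\<lambda>s y. - V y) t x 0 (- p x) (- S x)" "upper_jet (\<lambda>s y. - V' y) t x 0 (- p' x) (- S' x)"
    by auto
  from upper_jet_add[OF this] show ?case by (simp add: algebra_simps)
qed (auto intro!: continuous_intros bounded_range_add)

lemma smooth_test_zero: "smooth_test (\<lambda>y. 0) (\<lambda>y. 0) (\<lambda>y. 0) (\<lambda>y. 0)"
  using smooth_test_cos[of 0 0 0] by simp

lemma smooth_test_sum:
  assumes "finite J" and "\<And>j. j \<in> J \<Longrightarrow> smooth_test (V j) (p j) (S j) (T j)"
  shows "smooth_test (\<lambda>y. \<Sum>j\<in>J. V j y) (\<lambda>y. \<Sum>j\<in>J. p j y) (\<lambda>y. \<Sum>j\<in>J. S j y) (\<lambda>y. \<Sum>j\<in>J. T j y)"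
  using assms by (induction J rule: finite_induct) (auto intro: smooth_test_zero smooth_test_add)

lemma uminus_mult_vec: "(- B) *v z = - (B *v z)" for B :: "real ^ 'd ^ 'e"
  using scaleR_matrix_vector_assoc[of "-1" B z] by simp

lemma matrix_vector_mult_sum_left:
  "(\<Sum>j\<in>J. S j) *v z = (\<Sum>j\<in>J. (S j :: real ^ 'd ^ 'e) *v z)"
  by (induction J rule: infinite_finite_induct) (auto simp: matrix_vector_mult_add_rdistrib)

text \<open>Globally bounded test functions with a prescribed second-order jet at a point: the monomials
  \<open>z\<^sub>i\<close> and \<open>z\<^sub>i z\<^sub>j\<close> are replaced by \<open>sin z\<^sub>i\<close> and \<open>sin z\<^sub>i sin z\<^sub>j\<close>.\<close>

lemma smooth_test_with_jet:
  fixes x v :: "real ^ 'd" and A :: "real ^ 'd ^ 'd"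
  obtains V p S T where "smooth_test V p S T" and "V x = 0" and "p x = v"
    and "\<And>z. (S x *v z) \<bullet> z = (A *v z) \<bullet> z"
proof -
  define e :: "'d \<Rightarrow> real ^ 'd" where "e i = axis i 1" for i
  have ez: "e i \<bullet> z = z $ i" for i z by (simp add: e_def inner_axis')
  \<comment> \<open>The shift by \<open>pi/2\<close> turns the cosine into the sine of
    \<open>y $ i - x $ i\<close>, with value 0 and slope 1 at \<open>x\<close>.\<close>
  define \<theta>1 where "\<theta>1 i = e i \<bullet> x + pi/2" for i
  define em where "em = (\<lambda>(i, j). e i - e j)"
  define ep where "ep = (\<lambda>(i, j). e i + e j)"
  \<comment> \<open>Since 2 sin a sin b = cos (a - b) - cos (a + b), the cosines with weights
    \<open>c\<close> and \<open>- c\<close> add up to \<open>A $ i $ j / 2\<close> times the product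
    of the sines.\<close>
  define c where "c = (\<lambda>(i, j). A $ i $ j / 4)"
  note s1 = smooth_test_sum[where J = UNIV and V = "\<lambda>i y. v $ i * cos (e i \<bullet> y - \<theta>1 i)", OF finite_class.finite_UNIV smooth_test_cos]
  note s2 = smooth_test_sum[where J = UNIV and V = "\<lambda>k y. c k * cos (em k \<bullet> y - em k \<bullet> x)", OF finite_class.finite_UNIV smooth_test_cos]
  note s3 = smooth_test_sum[where J = UNIV and V = "\<lambda>k y. - c k * cos (ep k \<bullet> y - ep k \<bullet> x)", OF finite_class.finite_UNIV smooth_test_cos]
  show ?thesis
  proof (rule that[OF smooth_test_add[OF s1 smooth_test_add[OF s2 s3]]], goal_cases)
    case 1
    show ?case by (simp add: sum_negf \<theta>1_def)
  next
    case 2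
    show ?case
      by (simp add: e_def \<theta>1_def vec_eq_iff axis_def if_distrib[of "\<lambda>t. _ * t"] cong: if_cong)
  next
    case (3 z)
    have "(A *v z) \<bullet> z = (\<Sum>i\<in>UNIV. \<Sum>j\<in>UNIV. A $ i $ j * z $ i * z $ j)"
      by (simp add: inner_vec_def matrix_vector_mult_def sum_distrib_left sum_distrib_right mult_ac)
    also have "\<dots> = (\<Sum>k\<in>UNIV. 4 * c k * z $ fst k * z $ snd k)"
      by (simp add: sum.cartesian_product c_def case_prod_unfold)
    also have "\<dots> = (\<Sum>k\<in>UNIV. - c k * (em k \<bullet> z)\<^sup>2) + (\<Sum>k\<in>UNIV. c k * (ep k \<bullet> z)\<^sup>2)"
      unfolding sum.distrib[symmetric]
      by (rule sum.cong) (auto simp: em_def ep_def inner_diff_left inner_add_left ez power2_eq_square algebra_simps)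
    finally show ?case
      by (simp add: matrix_vector_mult_add_rdistrib matrix_vector_mult_diff_rdistrib matrix_vector_mult_sum_left inner_diff_left inner_add_left inner_sum_left
        scaleR_matrix_vector_assoc[symmetric] outer_quadratic \<theta>1_def uminus_mult_vec sum_negf)
  qed
qed

text \<open>Test functions are bounded together with their derivatives, so linear and quadratic
  dependence on time is replaced by \<open>sin\<close> and \<open>1 - cos\<close>: \<open>q\<close>
  is the time derivative at \<open>t\<close> and \<open>k\<close> the second one, free to be
  large.\<close>

lemma smooth_test_Cb_1_3:
  fixes V :: "real ^ 'd \<Rightarrow> real"
  assumes "smooth_test V p S T"
  shows "Cb_1_3 (\<lambda>s y. c + (q * sin (s - t) + k * (1 - cos (s - t))) + V y)
           (\<lambda>s y. q * cos (s - t) + k * sin (s - t)) (\<lambda>s. p) (\<lambda>s. S) (\<lambda>s. T)"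
proof -
  have der: "(V has_derivative (\<lambda>h. p x \<bullet> h)) (at x)" "(p has_derivative (\<lambda>h. S x *v h)) (at x)"
    "(S has_derivative blinfun_apply (T x)) (at x)" for x
    using assms by (auto simp: smooth_test_def)
  have cont: "continuous_on UNIV V" "continuous_on UNIV p" "continuous_on UNIV S" "continuous_on UNIV T"
    using assms der by (auto simp: smooth_test_def intro!: has_derivative_continuous continuous_at_imp_continuous_on)
  have bdd: "bounded (range V)" "bounded (range p)" "bounded (range S)" "bounded (range T)"
    using assms by (auto simp: smooth_test_def)
  have lift: "bounded_continuous (\<lambda>s. g)" if "continuous_on UNIV g" "bounded (range g)" for g :: "real ^ 'd \<Rightarrow> 'v::real_normed_vector"
    unfolding bounded_continuous_def case_prod_unfold
    using that by (auto intro!: continuous_on_compose2[OF that(1)] continuous_intros elim!: bounded_subset)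
  have time: "bounded_continuous (\<lambda>s (y :: real ^ 'd). c + (q * sin (s - t) + k * (1 - cos (s - t))))" for c q k :: real
  proof -
    have "\<bar>c + (q * sin (s - t) + k * (1 - cos (s - t)))\<bar> \<le> \<bar>c\<bar> + (\<bar>q\<bar> * 1 + \<bar>k\<bar> * 2)" for s
    proof -
      have "\<bar>c + (q * sin (s - t) + k * (1 - cos (s - t)))\<bar> \<le> \<bar>c\<bar> + (\<bar>q * sin (s - t)\<bar> + \<bar>k * (1 - cos (s - t))\<bar>)"
        by linarith
      also have "\<dots> \<le> \<bar>c\<bar> + (\<bar>q\<bar> * 1 + \<bar>k\<bar> * 2)"
      proof -
        have "\<bar>1 - cos (s - t)\<bar> \<le> 2" using cos_ge_minus_one[of "s - t"] cos_le_one[of "s - t"] by linarith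
        then show ?thesis
          unfolding abs_mult by (intro add_mono mult_left_mono order_refl abs_sin_le_one) auto
      qed
      finally show ?thesis .
    qed
    then show ?thesis
      unfolding bounded_continuous_def case_prod_unfold bounded_iff
      by (auto intro!: continuous_intros exI[of _ "\<bar>c\<bar> + (\<bar>q\<bar> * 1 + \<bar>k\<bar> * 2)"])
  qed
  have add: "bounded_continuous (\<lambda>s y. f s y + g s y)" if "bounded_continuous f" "bounded_continuous g"
    for f g :: "real \<Rightarrow> real ^ 'd \<Rightarrow> real"
    using that unfolding bounded_continuous_def case_prod_unfold
    by (auto intro!: continuous_intros bounded_plus_comp)
  \<comment> \<open>The time derivative has the same shape, with constant term \<open>q\<close> and
    coefficients \<open>k\<close> and \<open>- q\<close>.\<close>
  have bc: "bounded_continuous (\<lambda>s (y :: real ^ 'd). q * cos (s - t) + k * sin (s - t))"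
    using time[of q k "- q"] by (simp add: algebra_simps)
  show ?thesis
    unfolding Cb_1_3_def
  proof (intro conjI allI impI)
    fix s :: real and y :: "real ^ 'd"
    show "((\<lambda>s. c + (q * sin (s - t) + k * (1 - cos (s - t))) + V y) has_real_derivative
      q * cos (s - t) + k * sin (s - t)) (at s)"
      by (auto intro!: derivative_eq_intros)
    show "((\<lambda>y. c + (q * sin (s - t) + k * (1 - cos (s - t))) + V y) has_derivative (\<lambda>h. p y \<bullet> h)) (at y)"
      by (auto intro!: derivative_eq_intros der)
  qed (rule der bc add[OF time lift] lift cont bdd)+
qed

lemma bounded_continuous_minus: "bounded_continuous f \<Longrightarrow> bounded_continuous (\<lambda>s y. - f s y)"
  unfolding bounded_continuous_def case_prod_unfold
  by (auto intro!: continuous_intros simp: bounded_iff)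

lemma Cb_1_3_minus:
  assumes "Cb_1_3 \<psi> q p S T"
  shows "Cb_1_3 (\<lambda>s y. - \<psi> s y) (\<lambda>s y. - q s y) (\<lambda>s y. - p s y) (\<lambda>s y. - S s y) (\<lambda>s y. - T s y)"
  using assms unfolding Cb_1_3_def
proof (intro conjI allI impI, goal_cases)
  case (1 t x)
  then show ?case by (auto intro!: derivative_eq_intros)
next
  case (2 t x)
  then have "(\<psi> t has_derivative (\<lambda>h. p t x \<bullet> h)) (at x)" by blast
  moreover have "(\<lambda>h. (- p t x) \<bullet> h) = (\<lambda>h. - (p t x \<bullet> h))" by (simp add: fun_eq_iff)
  ultimately show ?case by (simp only: has_derivative_minus)
next
  case (3 t x)
  then have "(p t has_derivative (\<lambda>h. S t x *v h)) (at x)" by blast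
  moreover have "(\<lambda>h. (- S t x) *v h) = (\<lambda>h. - (S t x *v h))" by (simp add: fun_eq_iff uminus_mult_vec)
  ultimately show ?case by (simp only: has_derivative_minus)
next
  case (4 t x)
  then have "(S t has_derivative blinfun_apply (T t x)) (at x)" by blast
  moreover have "blinfun_apply (- T t x) = (\<lambda>h. - blinfun_apply (T t x) h)" by (simp add: fun_eq_iff uminus_blinfun.rep_eq)
  ultimately show ?case by (simp only: has_derivative_minus)
qed (auto intro: bounded_continuous_minus)

section \<open>From touching test functions to jets\<close>

lemma trig_dominates_quadratic:
  fixes w :: real
  assumes "\<bar>w\<bar> \<le> 1/4" and "k \<ge> 4 * (\<bar>q\<bar> + \<bar>K\<bar>)"
  shows "q * w + K * w\<^sup>2 \<le> q * sin w + k * (1 - cos w)"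
proof -
  have w3: "\<bar>w\<bar>^3 \<le> w\<^sup>2 / 4"
  proof -
    have "\<bar>w\<bar>^3 = w\<^sup>2 * \<bar>w\<bar>" by (simp add: eval_nat_numeral abs_mult)
    also have "\<dots> \<le> w\<^sup>2 * (1/4)" using assms by (intro mult_left_mono) auto
    finally show ?thesis by simp
  qed
  \<comment> \<open>At \<open>pi/2\<close> the expansion of the cosine becomes that of the
    sine.\<close>
  have "\<bar>w - sin w\<bar> \<le> \<bar>w\<bar>^3"
    using cos_second_order[of "pi/2" w] by (simp add: cos_add)
  then have s: "\<bar>w - sin w\<bar> \<le> w\<^sup>2" using w3 zero_le_power2[of w] by linarith
  have c: "w\<^sup>2 / 4 \<le> 1 - cos w"
  proof -
    have "\<bar>cos w - 1 + w\<^sup>2 / 2\<bar> \<le> \<bar>w\<bar>^3" using cos_second_order[of 0 w] by simp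
    then show ?thesis using w3 by linarith
  qed
  have "q * (w - sin w) \<le> \<bar>q\<bar> * w\<^sup>2"
  proof -
    have "q * (w - sin w) \<le> \<bar>q\<bar> * \<bar>w - sin w\<bar>" by (metis abs_ge_self abs_mult)
    also have "\<dots> \<le> \<bar>q\<bar> * w\<^sup>2" using s by (rule mult_left_mono) simp
    finally show ?thesis .
  qed
  moreover have "K * w\<^sup>2 \<le> \<bar>K\<bar> * w\<^sup>2" by (intro mult_right_mono) auto
  moreover have "(\<bar>q\<bar> + \<bar>K\<bar>) * w\<^sup>2 \<le> k * (1 - cos w)"
  proof -
    have "(\<bar>q\<bar> + \<bar>K\<bar>) * w\<^sup>2 = 4 * (\<bar>q\<bar> + \<bar>K\<bar>) * (w\<^sup>2 / 4)" by simp
    also have "\<dots> \<le> k * (1 - cos w)"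
      using assms c by (intro mult_mono) auto
    finally show ?thesis .
  qed
  ultimately show ?thesis by (simp add: algebra_simps)
qed

text \<open>The jet of \<open>u\<close> and the expansion of \<open>V\<close> each cost \<delta> |y
  - x|^2. Raising the Hessian by \<open>4 * \<delta>\<close> times the identity adds twice this
  amount to \<open>V\<close> and pays for both. In time, a large \<open>k\<close> absorbs the
  unknown constant in front of (s - t)^2.\<close>

lemma upper_jet_test_function:
  fixes u :: "real \<Rightarrow> real ^ 'd \<Rightarrow> real"
  assumes J: "upper_jet u t x q v A" and \<delta>: "\<delta> > 0"
  obtains V p S T k where "smooth_test V p S T" and "V x = 0" and "p x = v"
    and "\<And>z. (S x *v z) \<bullet> z = ((A + (4 * \<delta>) *\<^sub>R mat 1) *v z) \<bullet> z"
    and "\<forall>\<^sub>F (s, y) in nhds (t, x). u s y \<le> u t x + (q * sin (s - t) + k * (1 - cos (s - t))) + V y"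
proof -
  obtain V p S T where V: "smooth_test V p S T" and Vx: "V x = 0" and px: "p x = v"
    and Sx: "\<And>z. (S x *v z) \<bullet> z = ((A + (4 * \<delta>) *\<^sub>R mat 1) *v z) \<bullet> z"
    using smooth_test_with_jet[of x v "A + (4 * \<delta>) *\<^sub>R mat 1"] by blast
  obtain K r where r: "r > 0" and K: "\<And>s y. \<bar>s - t\<bar> < r \<Longrightarrow> norm (y - x) < r \<Longrightarrow>
     u s y \<le> u t x + q * (s - t) + v \<bullet> (y - x) + (A *v (y - x)) \<bullet> (y - x) / 2
             + \<delta> * (norm (y - x))\<^sup>2 + K * (s - t)\<^sup>2"
    using J \<delta> unfolding upper_jet_def by meson
  have "upper_jet (\<lambda>s y. - V y) t x 0 (- p x) (- S x)" using V by (simp add: smooth_test_def)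
  then obtain K' r' where r': "r' > 0" and K': "\<And>s y. \<bar>s - t\<bar> < r' \<Longrightarrow> norm (y - x) < r' \<Longrightarrow>
     - V y \<le> - V x + 0 * (s - t) + (- p x) \<bullet> (y - x) + ((- S x) *v (y - x)) \<bullet> (y - x) / 2
             + \<delta> * (norm (y - x))\<^sup>2 + K' * (s - t)\<^sup>2"
    using \<delta> unfolding upper_jet_def by meson
  define k where "k = 4 * (\<bar>q\<bar> + \<bar>K\<bar>)"
  define r0 where "r0 = min (min r r') (1/4)"
  have r0: "r0 > 0" using r r' by (simp add: r0_def)
  have neg: "((- S x) *v z) \<bullet> z = - ((S x *v z) \<bullet> z)" for z
    by (simp add: uminus_mult_vec)
  have loc: "u s y \<le> u t x + (q * sin (s - t) + k * (1 - cos (s - t))) + V y"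
    if s: "\<bar>s - t\<bar> < r0" and y: "norm (y - x) < r0" for s y
  proof -
    define z where "z = y - x"
    have 1: "u s y \<le> u t x + q * (s - t) + v \<bullet> z + (A *v z) \<bullet> z / 2 + \<delta> * (norm z)\<^sup>2 + K * (s - t)\<^sup>2"
      using K[of s y] s y by (simp add: r0_def z_def)
    have 2: "- V y \<le> - (v \<bullet> z) - ((A + (4 * \<delta>) *\<^sub>R mat 1) *v z) \<bullet> z / 2 + \<delta> * (norm z)\<^sup>2"
      using K'[of t y] y r' by (simp add: r0_def z_def[symmetric] Vx px neg Sx)
    have 3: "((A + (4 * \<delta>) *\<^sub>R mat 1) *v z) \<bullet> z = (A *v z) \<bullet> z + 4 * (\<delta> * (norm z)\<^sup>2)"
      by (simp add: matrix_vector_mult_add_rdistrib inner_add_left scaleR_matrix_vector_assoc[symmetric]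
          matrix_vector_mul_lid power2_norm_eq_inner)
    have 4: "q * (s - t) + K * (s - t)\<^sup>2 \<le> q * sin (s - t) + k * (1 - cos (s - t))"
      using s by (intro trig_dominates_quadratic) (auto simp: k_def r0_def)
    have "U \<le> a' + R + W" if "U \<le> a' + b + c + d / 2 + e + f" "- W \<le> - c - (d + 4 * e) / 2 + e" "b + f \<le> R"
      for U a' b c d e f R W :: real using that by (simp add: field_simps)
    from this[OF 1 2[unfolded 3] 4] show ?thesis .
  qed
  have "\<forall>\<^sub>F (s, y) in nhds (t, x). u s y \<le> u t x + (q * sin (s - t) + k * (1 - cos (s - t))) + V y"
    unfolding eventually_nhds_metric
  proof (intro exI[of _ r0] conjI allI impI r0)
    fix z assume d: "dist z (t, x) < r0"
    obtain s y where z: "z = (s, y)" by (cases z)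
    have "\<bar>s - t\<bar> < r0" "norm (y - x) < r0"
      using d dist_fst_le[of z "(t, x)"] dist_snd_le[of z "(t, x)"] by (auto simp: z dist_norm)
    then show "case z of (s, y) \<Rightarrow> u s y \<le> u t x + (q * sin (s - t) + k * (1 - cos (s - t))) + V y"
      using loc by (simp add: z)
  qed
  with V Vx px Sx show ?thesis by (rule that)
qed

text \<open>The touching test function gives
  \<open>q \<le> G (A + (4 * \<delta>) *\<^sub>R mat 1)\<close>, and the assumed bound on
  \<open>G\<close> lets \<delta> tend to 0. The assumption \<open>quad\<close> enters because the
  Hessian of the test function matches the jet only as a quadratic form.\<close>

lemma viscosity_solution_jet_sub:
  fixes G :: "real ^ 'd ^ 'd \<Rightarrow> real"
  assumes vs: "viscosity_solution (\<lambda>t x r p A. G A) \<phi> u"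
    and G: "\<And>A \<beta>. \<beta> \<ge> 0 \<Longrightarrow> G (A + \<beta> *\<^sub>R mat 1) \<le> G A + C * \<beta>"
    and quad: "\<And>A B. (\<And>z. (A *v z) \<bullet> z = (B *v z) \<bullet> z) \<Longrightarrow> G A = G B"
  shows "jet_sub G u"
  unfolding jet_sub_def
proof (intro allI impI)
  fix t :: real and x q v A assume t: "t > 0" and J: "upper_jet u t x q v A"
  have "q \<le> G A + 4 * C * \<delta>" if \<delta>: "\<delta> > 0" for \<delta>
  proof -
    obtain V p S T k where V: "smooth_test V p S T" and Vx: "V x = 0" and "p x = v"
      and Sx: "\<And>z. (S x *v z) \<bullet> z = ((A + (4 * \<delta>) *\<^sub>R mat 1) *v z) \<bullet> z"
      and ev: "\<forall>\<^sub>F (s, y) in nhds (t, x). u s y \<le> u t x + (q * sin (s - t) + k * (1 - cos (s - t))) + V y"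
      by (rule upper_jet_test_function[OF J \<delta>]) (rule that)
    define \<psi> where "\<psi> = (\<lambda>s y. u t x + (q * sin (s - t) + k * (1 - cos (s - t))) + V y)"
    have Cb: "Cb_1_3 \<psi> (\<lambda>s y. q * cos (s - t) + k * sin (s - t)) (\<lambda>s. p) (\<lambda>s. S) (\<lambda>s. T)"
      unfolding \<psi>_def by (rule smooth_test_Cb_1_3[OF V])
    have at: "u t x = \<psi> t x" by (simp add: \<psi>_def Vx)
    have "\<forall>\<^sub>F (s, y) in nhds (t, x). u s y - \<psi> s y \<le> u t x - \<psi> t x"
      using ev by (rule eventually_mono) (auto simp: \<psi>_def Vx)
    then have "q * cos (t - t) + k * sin (t - t) - G (S x) \<le> 0"
      using vs Cb t at unfolding viscosity_solution_def by blast
    then have "q \<le> G (S x)" by simp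
    also have "\<dots> = G (A + (4 * \<delta>) *\<^sub>R mat 1)" by (rule quad) (rule Sx)
    also have "\<dots> \<le> G A + C * (4 * \<delta>)" using \<delta> by (intro G) simp
    finally show ?thesis by simp
  qed
  note * = this
  show "q \<le> G A"
  proof (rule field_le_epsilon)
    fix e :: real assume e: "e > 0"
    have "q \<le> G A + 4 * C * (e / (4 * (\<bar>C\<bar> + 1)))" using e by (intro *) simp
    also have "4 * C * (e / (4 * (\<bar>C\<bar> + 1))) = e * (C / (\<bar>C\<bar> + 1))"
    proof -
      have "4 * C * (e / (4 * D)) = e * (C / D)" for D :: real by simp
      then show ?thesis .
    qed
    also have "\<dots> \<le> e * 1" using e by (intro mult_left_mono) (auto simp: divide_le_eq)
    finally show "q \<le> G A + e" by simp
  qed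
qed

lemma viscosity_solution_jet_super:
  fixes G :: "real ^ 'd ^ 'd \<Rightarrow> real"
  assumes vs: "viscosity_solution (\<lambda>t x r p A. G A) \<phi> u"
    and G: "\<And>A \<beta>. \<beta> \<ge> 0 \<Longrightarrow> G (A + \<beta> *\<^sub>R mat 1) \<le> G A + C * \<beta>"
    and quad: "\<And>A B. (\<And>z. (A *v z) \<bullet> z = (B *v z) \<bullet> z) \<Longrightarrow> G A = G B"
  shows "jet_sub (\<lambda>A. - G (- A)) (\<lambda>s y. - u s y)"
  unfolding jet_sub_def
proof (intro allI impI)
  fix t :: real and x q v A assume t: "t > 0" and J: "upper_jet (\<lambda>s y. - u s y) t x q v A"
  have "q \<le> - G (- A) + 4 * C * \<delta>" if \<delta>: "\<delta> > 0" for \<delta>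
  proof -
    obtain V p S T k where V: "smooth_test V p S T" and Vx: "V x = 0" and "p x = v"
      and Sx: "\<And>z. (S x *v z) \<bullet> z = ((A + (4 * \<delta>) *\<^sub>R mat 1) *v z) \<bullet> z"
      and ev: "\<forall>\<^sub>F (s, y) in nhds (t, x). - u s y \<le> - u t x + (q * sin (s - t) + k * (1 - cos (s - t))) + V y"
      by (rule upper_jet_test_function[OF J \<delta>]) (rule that)
    define \<psi> where "\<psi> = (\<lambda>s y. - (- u t x + (q * sin (s - t) + k * (1 - cos (s - t))) + V y))"
    have Cb: "Cb_1_3 \<psi> (\<lambda>s y. - (q * cos (s - t) + k * sin (s - t))) (\<lambda>s y. - p y) (\<lambda>s y. - S y) (\<lambda>s y. - T y)"
      unfolding \<psi>_def by (rule Cb_1_3_minus[OF smooth_test_Cb_1_3[OF V]])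
    have at: "u t x = \<psi> t x" by (simp add: \<psi>_def Vx)
    have "\<forall>\<^sub>F (s, y) in nhds (t, x). u t x - \<psi> t x \<le> u s y - \<psi> s y"
      using ev by (rule eventually_mono) (auto simp: \<psi>_def Vx)
    then have "- (q * cos (t - t) + k * sin (t - t)) - G (- S x) \<ge> 0"
      using vs Cb t at unfolding viscosity_solution_def by blast
    then have "q \<le> - G (- S x)" by simp
    moreover have "G (- S x) = G (- (A + (4 * \<delta>) *\<^sub>R mat 1))"
      by (rule quad) (simp only: uminus_mult_vec inner_minus_left Sx)
    \<comment> \<open>The perturbation bound is used at the smaller matrix; adding the multiple of
      the identity brings it back to \<open>- A\<close>.\<close>
    moreover have "G (- (A + (4 * \<delta>) *\<^sub>R mat 1) + (4 * \<delta>) *\<^sub>R mat 1) \<le> G (- (A + (4 * \<delta>) *\<^sub>R mat 1)) + C * (4 * \<delta>)"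
      using \<delta> by (intro G) simp
    ultimately show ?thesis by simp
  qed
  note * = this
  show "q \<le> - G (- A)"
  proof (rule field_le_epsilon)
    fix e :: real assume e: "e > 0"
    have "q \<le> - G (- A) + 4 * C * (e / (4 * (\<bar>C\<bar> + 1)))" using e by (intro *) simp
    also have "4 * C * (e / (4 * (\<bar>C\<bar> + 1))) = e * (C / (\<bar>C\<bar> + 1))"
    proof -
      have "4 * C * (e / (4 * D)) = e * (C / D)" for D :: real by simp
      then show ?thesis .
    qed
    also have "\<dots> \<le> e * 1" using e by (intro mult_left_mono) (auto simp: divide_le_eq)
    finally show "q \<le> - G (- A) + e" by simp
  qed
qed

section \<open>Fejer means\<close>

definition multi_index :: "nat \<Rightarrow> ('d::finite \<Rightarrow> nat) set" where
  "multi_index N = {l. \<forall>i. l i < N}"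

definition vec_of :: "('d::finite \<Rightarrow> nat) \<Rightarrow> real ^ 'd" where
  "vec_of l = (\<chi> i. real (l i))"

lemma multi_index_PiE: "multi_index N = PiE UNIV (\<lambda>_. {..<N})"
  by (auto simp: multi_index_def PiE_def)

lemma finite_multi_index [simp]: "finite (multi_index N)"
  by (simp add: multi_index_PiE finite_PiE)

lemma card_multi_index: "card (multi_index N :: ('d::finite \<Rightarrow> nat) set) = N ^ CARD('d)"
  by (simp add: multi_index_PiE card_PiE)

lemma vec_of_inj: "vec_of l = vec_of l' \<longleftrightarrow> l = l'"
  by (auto simp: vec_of_def vec_eq_iff fun_eq_iff)

definition integer_vec :: "nat \<Rightarrow> real ^ 'd \<Rightarrow> bool" where
  "integer_vec N a \<longleftrightarrow> (\<forall>i. \<exists>n::int. a $ i = of_int n \<and> \<bar>n\<bar> < int N)"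

lemma integer_vec_diff:
  assumes "l \<in> multi_index N" and "l' \<in> multi_index N"
  shows "integer_vec N (vec_of l - vec_of l')"
  unfolding integer_vec_def
proof
  fix i
  have "l i < N" "l' i < N" using assms by (auto simp: multi_index_def)
  then show "\<exists>n::int. (vec_of l - vec_of l') $ i = of_int n \<and> \<bar>n\<bar> < int N"
    by (intro exI[of _ "int (l i) - int (l' i)"]) (auto simp: vec_of_def)
qed

text \<open>The bounds in \<open>integer_vec\<close> are strict: the entries have modulus at most
  \<open>N - 1\<close> and \<open>D - 1\<close>, so sums and differences reach at most
  \<open>N + D - 2\<close>, which is below \<open>m\<close>.\<close>

lemma integer_vec_add:
  assumes "integer_vec N a" and "integer_vec D b" and "N + D \<le> m + 1"
  shows "integer_vec m (a + b)" and "integer_vec m (a - b)"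
proof -
  have "\<exists>n::int. (a + b) $ i = of_int n \<and> \<bar>n\<bar> < int m" 
    and "\<exists>n::int. (a - b) $ i = of_int n \<and> \<bar>n\<bar> < int m" for i
  proof -
    obtain n k where n: "a $ i = of_int n" "\<bar>n\<bar> < int N" "b $ i = of_int k" "\<bar>k\<bar> < int D"
      using assms(1,2) unfolding integer_vec_def by meson
    then show "\<exists>n::int. (a + b) $ i = of_int n \<and> \<bar>n\<bar> < int m"
      using assms(3) by (intro exI[of _ "n + k"]) auto
    show "\<exists>n::int. (a - b) $ i = of_int n \<and> \<bar>n\<bar> < int m"
      using n assms(3) by (intro exI[of _ "n - k"]) auto
  qed
  then show "integer_vec m (a + b)" "integer_vec m (a - b)"
    by (auto simp: integer_vec_def)
qed

text \<open>The mean over the grid with mesh \<open>2\<pi>/m\<close>. On trigonometric polynomials of degree less than \<open>m\<close>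
  it agrees with the mean over the torus.\<close>

definition grid_point :: "nat \<Rightarrow> ('d::finite \<Rightarrow> nat) \<Rightarrow> real ^ 'd" where
  "grid_point m j = (2 * pi / real m) *\<^sub>R vec_of j"

definition grid_mean :: "nat \<Rightarrow> (real ^ 'd \<Rightarrow> real) \<Rightarrow> real" where
  "grid_mean m f = (\<Sum>j\<in>multi_index m. f (grid_point m j)) / real m ^ CARD('d)"

lemma grid_mean_add: "grid_mean m (\<lambda>y. f y + g y) = grid_mean m f + grid_mean m g"
  by (simp add: grid_mean_def sum.distrib add_divide_distrib)

lemma grid_mean_diff: "grid_mean m (\<lambda>y. f y - g y) = grid_mean m f - grid_mean m g"
  by (simp add: grid_mean_def sum_subtractf diff_divide_distrib)

lemma grid_mean_mult: "grid_mean m (\<lambda>y. c * f y) = c * grid_mean m f"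
  by (simp add: grid_mean_def sum_distrib_left)

lemma grid_mean_divide: "grid_mean m (\<lambda>y. f y / c) = grid_mean m f / c"
  using grid_mean_mult[of m "inverse c" f] by (simp add: divide_inverse mult.commute)

lemma grid_mean_sum: "grid_mean m (\<lambda>y. \<Sum>j\<in>J. f j y) = (\<Sum>j\<in>J. grid_mean m (f j))"
  unfolding grid_mean_def sum_divide_distrib[symmetric] by (subst sum.swap) simp

lemma grid_mean_mono: "(\<And>y. f y \<le> g y) \<Longrightarrow> grid_mean m f \<le> grid_mean m g"
  unfolding grid_mean_def by (intro divide_right_mono sum_mono) auto

lemma grid_mean_const: "m > 0 \<Longrightarrow> grid_mean m (\<lambda>y. c) = c"
  by (simp add: grid_mean_def card_multi_index)

text \<open>The sum factorizes over the coordinates into geometric sums of \<open>m\<close>-th roots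
  of unity. A nonzero entry of modulus below \<open>m\<close> is not divisible by \<open>m\<close>,
  so one of these roots differs from 1 and its geometric sum vanishes.\<close>

lemma grid_mean_cos:
  fixes a :: "real ^ 'd"
  assumes a: "integer_vec m a" and a0: "a \<noteq> 0"
  shows "grid_mean m (\<lambda>y. cos (a \<bullet> y - \<theta>)) = 0"
proof -
  obtain n :: "'d \<Rightarrow> int" where n: "\<And>i. a $ i = of_int (n i)" "\<And>i. \<bar>n i\<bar> < int m"
    using a unfolding integer_vec_def by metis
  obtain i0 where i0: "n i0 \<noteq> 0" using a0 n by (auto simp: vec_eq_iff)
  have m: "m > 0" using n(2)[of i0] by simp
  define z where "z i = cis (2 * pi * of_int (n i) / real m)" for i
  have zm: "z i ^ m = 1" for i
  proof -
    have "real m * (2 * pi * of_int (n i) / real m) = 2 * pi * of_int (n i)" using m by simp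
    then have "cis (real m * (2 * pi * of_int (n i) / real m)) = cis (2 * pi * of_int (n i))"
      by (rule arg_cong)
    moreover have "z i ^ m = cis (real m * (2 * pi * of_int (n i) / real m))"
      unfolding z_def by (rule Complex.DeMoivre)
    ultimately show ?thesis by (simp only: cis_multiple_2pi Ints_of_int)
  qed
  have z1: "z i0 \<noteq> 1"
  proof
    assume "z i0 = 1"
    then have "cos (2 * pi * of_int (n i0) / real m) = 1"
      by (metis z_def cis.simps(1) one_complex.simps(1))
    then obtain k :: int where "2 * pi * of_int (n i0) / real m = of_int k * 2 * pi"
      unfolding cos_one_2pi_int by blast
    then have "(of_int (n i0) :: real) = of_int k * real m" using m by (simp add: field_simps)
    then have "n i0 = k * int m" by (metis of_int_eq_iff of_int_mult of_int_of_nat_eq)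
    then have abs_n: "\<bar>n i0\<bar> = \<bar>k\<bar> * int m" and "k \<noteq> 0" using i0 by (auto simp: abs_mult)
    then have "1 * int m \<le> \<bar>k\<bar> * int m" by (intro mult_right_mono) auto
    then show False using n(2)[of i0] abs_n by simp
  qed
  have geo: "(\<Sum>j<m. z i0 ^ j) = 0"
    using geometric_sum[OF z1, of m] zm[of i0] by simp
  have "(\<Sum>j\<in>multi_index m. \<Prod>i\<in>UNIV. z i ^ j i) = (\<Prod>i\<in>UNIV. \<Sum>j<m. z i ^ j)"
    unfolding multi_index_PiE by (subst prod_sum_PiE) auto
  also have "\<dots> = 0" using geo by (intro prod_zero) auto
  finally have s0: "(\<Sum>j\<in>multi_index m. \<Prod>i\<in>UNIV. z i ^ j i) = 0" .
  have cisP: "(\<Prod>i\<in>UNIV. z i ^ j i) = cis (a \<bullet> grid_point m j)" for j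
  proof -
    have "cis (\<Sum>i\<in>I. g i) = (\<Prod>i\<in>I. cis (g i))" if "finite I" for I :: "'d set" and g
      using that by (induction I rule: finite_induct) (auto simp: cis_mult[symmetric])
    then have "cis (a \<bullet> grid_point m j) = (\<Prod>i\<in>UNIV. cis (a $ i * grid_point m j $ i))"
      by (simp add: inner_vec_def)
    also have "\<dots> = (\<Prod>i\<in>UNIV. z i ^ j i)"
      by (intro prod.cong) (auto simp: z_def Complex.DeMoivre grid_point_def vec_of_def n(1) mult_ac)
    finally show ?thesis by simp
  qed
  have "cos (a \<bullet> y - \<theta>) = Re (cis (- \<theta>) * cis (a \<bullet> y))" for y
    by (simp add: cis_mult)
  then have "(\<Sum>j\<in>multi_index m. cos (a \<bullet> grid_point m j - \<theta>)) = Re (cis (- \<theta>) * (\<Sum>j\<in>multi_index m. \<Prod>i\<in>UNIV. z i ^ j i))"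
    by (simp only: cisP Re_sum sum_distrib_left)
  then show ?thesis by (simp add: grid_mean_def s0)
qed

text \<open>Only the frequencies \<open>a + b\<close> and \<open>a - b\<close> occur in the product,
  and its mean vanishes unless one of them is 0; then \<open>a\<close> and \<open>b\<close> agree up
  to sign and the even \<open>g\<close> does not distinguish them. This is the commutation of
  Fourier multipliers, without Fourier coefficients.\<close>

lemma grid_mean_cos_cos:
  fixes a b :: "real ^ 'd"
  assumes a: "integer_vec N a" and b: "integer_vec D b" and m: "N + D \<le> m + 1"
    and g: "\<And>k. g (- k) = g k"
  shows "g a * grid_mean m (\<lambda>y. cos (a \<bullet> (y - y')) * cos (b \<bullet> (x - y)))
       = g b * grid_mean m (\<lambda>y. cos (a \<bullet> (y - y')) * cos (b \<bullet> (x - y)))"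
proof -
  have split: "cos (a \<bullet> (y - y')) * cos (b \<bullet> (x - y))
     = 1/2 * cos ((a + b) \<bullet> y - (a \<bullet> y' + b \<bullet> x)) + 1/2 * cos ((a - b) \<bullet> y - (a \<bullet> y' - b \<bullet> x))" for y
    by (simp add: cos_times_cos inner_diff_right inner_add_left inner_diff_left algebra_simps)
  show ?thesis
  proof (cases "a = b \<or> a = - b")
    case True
    then show ?thesis using g by auto
  next
    case False
    then have "a + b \<noteq> 0" "a - b \<noteq> 0" by (auto simp: add_eq_0_iff2)
    then have "grid_mean m (\<lambda>y. cos (a \<bullet> (y - y')) * cos (b \<bullet> (x - y))) = 0"
      unfolding split grid_mean_add grid_mean_mult using integer_vec_add[OF a b m]
      by (simp add: grid_mean_cos)
    then show ?thesis by simp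
  qed
qed

text \<open>Summing over pairs of indices counts each frequency with its Fejer weight, so that
  \<open>g = (\<lambda>_. 1)\<close> gives the product of the one-dimensional Fejer kernels. A
  general \<open>g\<close> acts as a Fourier multiplier; \<open>exp (- (h * \<l> (outer a)))\<close>
  is the one of the heat evolution.\<close>

definition fejer_kernel :: "nat \<Rightarrow> (real ^ 'd \<Rightarrow> real) \<Rightarrow> real ^ 'd \<Rightarrow> real" where
  "fejer_kernel N g z =
     (\<Sum>k\<in>multi_index N \<times> multi_index N.
        g (vec_of (fst k) - vec_of (snd k)) * cos ((vec_of (fst k) - vec_of (snd k)) \<bullet> z))
     / real N ^ CARD('d)"

text \<open>Up to normalization the kernel is the squared modulus of the exponential sum over the
  index cube.\<close>

lemma fejer_kernel_nonneg: "fejer_kernel N (\<lambda>_. 1) (z :: real ^ 'd) \<ge> 0"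
proof -
  have "(\<Sum>k\<in>multi_index N \<times> multi_index N. cos ((vec_of (fst k) - vec_of (snd k)) \<bullet> z))
     = (\<Sum>l\<in>multi_index N. cos (vec_of l \<bullet> z))\<^sup>2 + (\<Sum>l\<in>multi_index N. sin (vec_of l \<bullet> z))\<^sup>2"
    unfolding power2_eq_square sum_product sum.cartesian_product sum.distrib[symmetric]
    by (rule sum.cong) (auto simp: inner_diff_left cos_diff)
  then show ?thesis by (simp add: fejer_kernel_def)
qed

lemma fejer_kernel_bound:
  fixes z :: "real ^ 'd"
  assumes "N > 0" and g: "\<And>k. integer_vec N k \<Longrightarrow> \<bar>g k\<bar> \<le> c"
  shows "\<bar>fejer_kernel N g z\<bar> \<le> c * real N ^ CARD('d)"
proof -
  have "\<bar>\<Sum>k\<in>multi_index N \<times> multi_index N. g (vec_of (fst k) - vec_of (snd k)) * cos ((vec_of (fst k) - vec_of (snd k)) \<bullet> z)\<bar>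
    \<le> (\<Sum>k\<in>(multi_index N :: ('d \<Rightarrow> nat) set) \<times> (multi_index N :: ('d \<Rightarrow> nat) set). c)"
  proof (rule order_trans[OF sum_abs], rule sum_mono)
    fix k :: "('d \<Rightarrow> nat) \<times> ('d \<Rightarrow> nat)" assume "k \<in> multi_index N \<times> multi_index N"
    then have "\<bar>g (vec_of (fst k) - vec_of (snd k))\<bar> \<le> c" by (intro g integer_vec_diff) auto
    then have "\<bar>g (vec_of (fst k) - vec_of (snd k))\<bar> * \<bar>cos ((vec_of (fst k) - vec_of (snd k)) \<bullet> z)\<bar> \<le> c * 1"
      by (intro mult_mono) auto
    then show "\<bar>g (vec_of (fst k) - vec_of (snd k)) * cos ((vec_of (fst k) - vec_of (snd k)) \<bullet> z)\<bar> \<le> c"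
      by (simp add: abs_mult)
  qed
  also have "\<dots> = c * real N ^ CARD('d) * real N ^ CARD('d)"
    by (simp add: card_cartesian_product card_multi_index)
  finally show ?thesis using assms(1) by (simp add: fejer_kernel_def divide_le_eq)
qed

lemma fejer_kernel_times_cos:
  "fejer_kernel N (\<lambda>_. 1) z * cos (b \<bullet> z) =
     (\<Sum>k\<in>multi_index N \<times> multi_index N.
        1/2 * cos ((vec_of (fst k) - vec_of (snd k) + b) \<bullet> z) + 1/2 * cos ((vec_of (fst k) - vec_of (snd k) - b) \<bullet> z))
     / real N ^ CARD('d)" for z :: "real ^ 'd"
  unfolding fejer_kernel_def times_divide_eq_left sum_distrib_right
  by (intro arg_cong2[where f = "(/)"] sum.cong refl)
     (simp only: mult_1_left cos_times_cos inner_add_left inner_diff_left add_divide_distrib)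

lemma grid_mean_cos_shift:
  fixes a x :: "real ^ 'd"
  assumes "integer_vec m a" and "m > 0"
  shows "grid_mean m (\<lambda>y. cos (a \<bullet> (x - y))) = (if a = 0 then 1 else 0)"
proof (cases "a = 0")
  case True
  then show ?thesis using assms by (simp add: grid_mean_const)
next
  case False
  have "cos (a \<bullet> (x - y)) = cos (a \<bullet> y - a \<bullet> x)" for y
    by (metis cos_minus inner_diff_right minus_diff_eq)
  then show ?thesis using False assms by (simp add: grid_mean_cos)
qed

text \<open>Only the \<open>N ^ CARD('d)\<close> diagonal pairs of indices have frequency 0.\<close>

lemma grid_mean_fejer_kernel:
  fixes x :: "real ^ 'd"
  assumes N: "0 < N" "2 * N \<le> m + 1" and g: "g 0 = 1"
  shows "grid_mean m (\<lambda>y. fejer_kernel N g (x - y)) = 1"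
proof -
  have m: "m > 0" using N by simp
  have Nm: "N \<le> m" using N by simp
  have "grid_mean m (\<lambda>y. fejer_kernel N g (x - y)) =
     (\<Sum>k\<in>multi_index N \<times> multi_index N. g (vec_of (fst k) - vec_of (snd k))
        * grid_mean m (\<lambda>y. cos ((vec_of (fst k) - vec_of (snd k)) \<bullet> (x - y)))) / real N ^ CARD('d)"
    by (simp only: fejer_kernel_def grid_mean_divide grid_mean_sum grid_mean_mult)
  also have "(\<Sum>k\<in>multi_index N \<times> multi_index N. g (vec_of (fst k) - vec_of (snd k))
        * grid_mean m (\<lambda>y. cos ((vec_of (fst k) - vec_of (snd k)) \<bullet> (x - y))))
      = (\<Sum>k\<in>multi_index N \<times> multi_index N. if fst k = (snd k :: 'd \<Rightarrow> nat) then 1 else 0)"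
  proof (rule sum.cong[OF refl])
    fix k :: "('d \<Rightarrow> nat) \<times> ('d \<Rightarrow> nat)" assume "k \<in> multi_index N \<times> multi_index N"
    then have "integer_vec N (vec_of (fst k) - vec_of (snd k))" by (intro integer_vec_diff) auto
    then have "integer_vec m (vec_of (fst k) - vec_of (snd k))"
      using Nm by (force simp: integer_vec_def)
    then show "g (vec_of (fst k) - vec_of (snd k)) * grid_mean m (\<lambda>y. cos ((vec_of (fst k) - vec_of (snd k)) \<bullet> (x - y)))
       = (if fst k = snd k then 1 else 0)"
      by (simp add: grid_mean_cos_shift[OF _ m] vec_of_inj g)
  qed
  also have "\<dots> = (\<Sum>l\<in>multi_index N. \<Sum>l'\<in>multi_index N. if l = (l' :: 'd \<Rightarrow> nat) then 1 else 0)"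
    by (simp only: sum.cartesian_product case_prod_unfold)
  also have "\<dots> = real N ^ CARD('d)" by (simp add: card_multi_index)
  finally show ?thesis using N by simp
qed

text \<open>Frequency 0 arises from pairs of indices that differ by one unit in coordinate
  \<open>i\<close>, and there are (N - 1) N^(d - 1) of these in either direction. The defect
  \<open>1 / real N\<close> measures how well the kernel concentrates at 0; the rate of
  approximation rests on it.\<close>

lemma grid_mean_fejer_kernel_cos:
  fixes x :: "real ^ 'd"
  assumes N: "0 < N" "N + 2 \<le> m + 1"
  shows "grid_mean m (\<lambda>y. fejer_kernel N (\<lambda>_. 1) (x - y) * cos ((x - y) $ i)) = 1 - 1 / real N"
proof -
  have m: "m > 0" using N by simp
  define e :: "real ^ 'd" where "e = axis i 1"
  have ez: "z $ i = e \<bullet> z" for z by (simp add: e_def inner_axis')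
  have ie: "integer_vec 2 e"
    unfolding integer_vec_def
  proof
    fix j show "\<exists>n::int. e $ j = of_int n \<and> \<bar>n\<bar> < int 2"
      by (cases "j = i") (auto simp: e_def axis_def intro!: exI[of _ 1] exI[of _ 0])
  qed
  define P where "P = (multi_index N :: ('d \<Rightarrow> nat) set)"
  have up: "vec_of l - vec_of l' + e = 0 \<longleftrightarrow> l' = l(i := l i + 1)" for l l' :: "'d \<Rightarrow> nat"
    unfolding vec_eq_iff fun_eq_iff by (auto simp: vec_of_def e_def axis_def)
  have down: "vec_of l - vec_of l' - e = 0 \<longleftrightarrow> l = l'(i := l' i + 1)" for l l' :: "'d \<Rightarrow> nat"
    using up[of l' l] by (metis (no_types) add_diff_eq diff_add_eq diff_eq_eq eq_iff_diff_eq_0 add.commute)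
  have cnt: "(\<Sum>l\<in>P. \<Sum>l'\<in>P. if l' = l(i := l i + 1) then 1 else 0 :: real) = real N ^ CARD('d) * (1 - 1 / real N)"
  proof -
    have "(\<Sum>l'\<in>P. if l' = l(i := l i + 1) then 1 else 0 :: real) = (if l i < N - 1 then 1 else 0)" if "l \<in> P" for l
    proof -
      have "l(i := l i + 1) \<in> P \<longleftrightarrow> l i < N - 1" using that by (auto simp: P_def multi_index_def)
      then show ?thesis by (simp add: P_def)
    qed
    then have "(\<Sum>l\<in>P. \<Sum>l'\<in>P. if l' = l(i := l i + 1) then 1 else 0 :: real) = (\<Sum>l\<in>P. if l i < N - 1 then 1 else 0)"
      by (intro sum.cong) auto
    also have "\<dots> = real (card {l \<in> P. l i < N - 1})" by (simp add: P_def sum.If_cases Int_def)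
    also have "{l \<in> P. l i < N - 1} = PiE UNIV (\<lambda>j. if j = i then {..<N - 1} else {..<N})"
    proof (intro set_eqI iffI)
      fix l assume "l \<in> {l \<in> P. l i < N - 1}"
      then show "l \<in> PiE UNIV (\<lambda>j. if j = i then {..<N - 1} else {..<N})"
        by (simp add: P_def multi_index_def PiE_def)
    next
      fix l assume "l \<in> PiE UNIV (\<lambda>j. if j = i then {..<N - 1} else {..<N})"
      then have l: "l j \<in> (if j = i then {..<N - 1} else {..<N})" for j
        by (simp add: PiE_def Pi_def)
      have "l j < N" for j using l[of j] by (cases "j = i") auto
      moreover have "l i < N - 1" using l[of i] by simp
      ultimately show "l \<in> {l \<in> P. l i < N - 1}" by (simp add: P_def multi_index_def)
    qed
    also have "card \<dots> = (\<Prod>j\<in>UNIV. if j = i then N - 1 else N)"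
      by (subst card_PiE) (auto intro!: prod.cong)
    also have "\<dots> = (N - 1) * N ^ (CARD('d) - 1)"
      by (subst prod.remove[of _ i]) (auto simp: card_Diff_singleton)
    also have "real \<dots> = real N ^ CARD('d) * (1 - 1 / real N)"
    proof -
      have "real N ^ CARD('d) = real N * real N ^ (CARD('d) - 1)"
        by (metis power_minus_mult zero_less_card_finite mult.commute)
      then show ?thesis using N by (simp add: of_nat_diff field_simps)
    qed
    finally show ?thesis .
  qed
  have "grid_mean m (\<lambda>y. fejer_kernel N (\<lambda>_. 1) (x - y) * cos ((x - y) $ i)) =
     (\<Sum>k\<in>P \<times> P. 1/2 * grid_mean m (\<lambda>y. cos ((vec_of (fst k) - vec_of (snd k) + e) \<bullet> (x - y)))
        + 1/2 * grid_mean m (\<lambda>y. cos ((vec_of (fst k) - vec_of (snd k) - e) \<bullet> (x - y)))) / real N ^ CARD('d)"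
    by (simp only: ez fejer_kernel_times_cos grid_mean_divide grid_mean_sum grid_mean_add grid_mean_mult P_def)
  also have "(\<Sum>k\<in>P \<times> P. 1/2 * grid_mean m (\<lambda>y. cos ((vec_of (fst k) - vec_of (snd k) + e) \<bullet> (x - y)))
        + 1/2 * grid_mean m (\<lambda>y. cos ((vec_of (fst k) - vec_of (snd k) - e) \<bullet> (x - y))))
     = (\<Sum>k\<in>P \<times> P. 1/2 * (if snd k = (fst k)(i := fst k i + 1) then 1 else 0)
        + 1/2 * (if fst k = (snd k)(i := snd k i + 1) then 1 else 0))"
  proof (rule sum.cong[OF refl])
    fix k assume "k \<in> P \<times> P"
    then have "integer_vec N (vec_of (fst k) - vec_of (snd k))" by (intro integer_vec_diff) (auto simp: P_def)
    from integer_vec_add[OF this ie N(2)]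
    show "1/2 * grid_mean m (\<lambda>y. cos ((vec_of (fst k) - vec_of (snd k) + e) \<bullet> (x - y)))
        + 1/2 * grid_mean m (\<lambda>y. cos ((vec_of (fst k) - vec_of (snd k) - e) \<bullet> (x - y)))
       = 1/2 * (if snd k = (fst k)(i := fst k i + 1) then 1 else 0)
        + 1/2 * (if fst k = (snd k)(i := snd k i + 1) then 1 else 0)"
      by (simp only: grid_mean_cos_shift[OF _ m] up down)
  qed
  also have "\<dots> = 1/2 * (\<Sum>l\<in>P. \<Sum>l'\<in>P. if l' = l(i := l i + 1) then 1 else 0)
     + 1/2 * (\<Sum>l\<in>P. \<Sum>l'\<in>P. if l = l'(i := l' i + 1) then 1 else 0)"
    unfolding sum.distrib sum_distrib_left[symmetric] sum.cartesian_product
    by (simp add: case_prod_unfold)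
  also have "(\<Sum>l\<in>P. \<Sum>l'\<in>P. if l = l'(i := l' i + 1) then 1 else 0 :: real)
      = (\<Sum>l\<in>P. \<Sum>l'\<in>P. if l' = l(i := l i + 1) then 1 else 0)"
    by (rule sum.swap)
  finally show ?thesis unfolding cnt using N by simp
qed

text \<open>A convolution with the torus integral replaced by the grid mean. The result is a
  trigonometric polynomial of degree below \<open>N\<close> in each variable for every
  \<open>w\<close>, since only the values of \<open>w\<close> at grid points enter.\<close>

definition fejer_mean :: "nat \<Rightarrow> nat \<Rightarrow> (real ^ 'd \<Rightarrow> real) \<Rightarrow> (real ^ 'd \<Rightarrow> real) \<Rightarrow> real ^ 'd \<Rightarrow> real" where
  "fejer_mean N m g w x = grid_mean m (\<lambda>y. w y * fejer_kernel N g (x - y))"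

lemma fejer_mean_diff: "fejer_mean N m g (\<lambda>y. w y - w' y) x = fejer_mean N m g w x - fejer_mean N m g w' x"
  by (simp add: fejer_mean_def left_diff_distrib grid_mean_diff)

lemma fejer_mean_add: "fejer_mean N m g (\<lambda>y. w y + w' y) x = fejer_mean N m g w x + fejer_mean N m g w' x"
  by (simp add: fejer_mean_def distrib_right grid_mean_add)

lemma fejer_mean_mono:
  assumes "\<And>y. w y \<le> w' y"
  shows "fejer_mean N m (\<lambda>_. 1) w x \<le> fejer_mean N m (\<lambda>_. 1) w' x"
  unfolding fejer_mean_def using assms
  by (intro grid_mean_mono mult_right_mono fejer_kernel_nonneg)

lemma fejer_mean_const:
  assumes "0 < N" and "2 * N \<le> m + 1" and "g 0 = 1"
  shows "fejer_mean N m g (\<lambda>_. c) x = c"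
  by (simp add: fejer_mean_def grid_mean_mult grid_mean_fejer_kernel[of N m g, OF assms])

lemma fejer_mean_bound:
  fixes w :: "real ^ 'd \<Rightarrow> real"
  assumes "N > 0" and "m > 0" and g: "\<And>k. integer_vec N k \<Longrightarrow> \<bar>g k\<bar> \<le> c" and w: "\<And>y. \<bar>w y\<bar> \<le> B"
  shows "\<bar>fejer_mean N m g w x\<bar> \<le> B * (c * real N ^ CARD('d))"
proof -
  have b: "\<bar>w y * fejer_kernel N g (x - y)\<bar> \<le> B * (c * real N ^ CARD('d))" for y
    unfolding abs_mult using w fejer_kernel_bound[of N g c "x - y", OF assms(1) g]
    by (intro mult_mono) (auto intro: order_trans[OF abs_ge_zero])
  have "grid_mean m (\<lambda>y. w y * fejer_kernel N g (x - y)) \<le> grid_mean m (\<lambda>y :: real ^ 'd. B * (c * real N ^ CARD('d)))"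
    using b by (intro grid_mean_mono) (meson abs_le_D1)
  moreover have "grid_mean m (\<lambda>y :: real ^ 'd. - (B * (c * real N ^ CARD('d)))) \<le> grid_mean m (\<lambda>y. w y * fejer_kernel N g (x - y))"
    using b by (intro grid_mean_mono) (meson abs_le_D2 minus_le_iff)
  ultimately show ?thesis
    unfolding grid_mean_const[OF assms(2)] fejer_mean_def by linarith
qed

text \<open>A term of the expanded mean is labelled by a grid point and a pair of indices. The value
  of \<open>w\<close> at the grid point becomes the coefficient and the point itself a phase; equal
  frequencies are not collected, so all formulas stay plain finite sums of cosines.\<close>

definition mean_index :: "nat \<Rightarrow> nat \<Rightarrow> (('d::finite \<Rightarrow> nat) \<times> ('d \<Rightarrow> nat) \<times> ('d \<Rightarrow> nat)) set" where
  "mean_index N m = multi_index m \<times> (multi_index N \<times> multi_index N)"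

definition mean_freq :: "('d::finite \<Rightarrow> nat) \<times> ('d \<Rightarrow> nat) \<times> ('d \<Rightarrow> nat) \<Rightarrow> real ^ 'd" where
  "mean_freq p = vec_of (fst (snd p)) - vec_of (snd (snd p))"

definition mean_phase :: "nat \<Rightarrow> ('d::finite \<Rightarrow> nat) \<times> ('d \<Rightarrow> nat) \<times> ('d \<Rightarrow> nat) \<Rightarrow> real" where
  "mean_phase m p = mean_freq p \<bullet> grid_point m (fst p)"

definition mean_coeff ::
  "nat \<Rightarrow> nat \<Rightarrow> (real ^ 'd \<Rightarrow> real) \<Rightarrow> ('d::finite \<Rightarrow> nat) \<times> ('d \<Rightarrow> nat) \<times> ('d \<Rightarrow> nat) \<Rightarrow> real" where
  "mean_coeff N m w p = w (grid_point m (fst p)) / (real m ^ CARD('d) * real N ^ CARD('d))"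

lemma finite_mean_index [simp]: "finite (mean_index N m)"
  by (simp add: mean_index_def)

lemma mean_freq_integer: "p \<in> mean_index N m \<Longrightarrow> integer_vec N (mean_freq p)"
  unfolding mean_freq_def by (intro integer_vec_diff) (auto simp: mean_index_def)

lemma fejer_mean_explicit:
  "fejer_mean N m g w x =
     (\<Sum>p\<in>mean_index N m. mean_coeff N m w p * g (mean_freq p) * cos (mean_freq p \<bullet> x - mean_phase m p))"
proof -
  have "fejer_mean N m g w x =
     (\<Sum>j\<in>multi_index m. \<Sum>k\<in>multi_index N \<times> multi_index N. mean_coeff N m w (j, k) * g (mean_freq (j, k))
        * cos (mean_freq (j, k) \<bullet> x - mean_phase m (j, k)))"
    unfolding fejer_mean_def grid_mean_def fejer_kernel_def sum_divide_distrib sum_distrib_left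
    by (intro sum.cong refl) (simp add: mean_coeff_def mean_freq_def mean_phase_def inner_diff_right mult_ac)
  then show ?thesis
    by (simp add: mean_index_def sum.cartesian_product case_prod_unfold)
qed

text \<open>The inner mean has degree below \<open>D\<close> and the outer kernel degree below
  \<open>N\<close>; on the grid of mesh 2 pi/m only frequencies that agree up to sign interact.
  Hence the even multiplier \<open>g\<close> may sit on either factor.\<close>

lemma fejer_mean_commute:
  fixes w :: "real ^ 'd \<Rightarrow> real"
  assumes m: "N + D \<le> m + 1" and g: "\<And>k. g (- k) = g k"
  shows "fejer_mean N m (\<lambda>_. 1) (fejer_mean D m' g w) x = fejer_mean N m g (fejer_mean D m' (\<lambda>_. 1) w) x"
proof -
  define d where "d k = vec_of (fst k) - vec_of (snd k)" for k :: "('d \<Rightarrow> nat) \<times> ('d \<Rightarrow> nat)"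
  define y' where "y' p = grid_point m' (fst p)" for p :: "('d \<Rightarrow> nat) \<times> ('d \<Rightarrow> nat) \<times> ('d \<Rightarrow> nat)"
  have ex: "fejer_mean N m g1 (fejer_mean D m' g2 w) x =
    (\<Sum>p\<in>mean_index D m'. \<Sum>k\<in>multi_index N \<times> multi_index N. mean_coeff D m' w p *
       (g1 (d k) * g2 (mean_freq p) * grid_mean m (\<lambda>y. cos (mean_freq p \<bullet> (y - y' p)) * cos (d k \<bullet> (x - y))))) / real N ^ CARD('d)"
    for g1 g2
  proof -
    have "fejer_mean D m' g2 w y * fejer_kernel N g1 (x - y)
      = (\<Sum>p\<in>mean_index D m'. \<Sum>k\<in>multi_index N \<times> multi_index N. (mean_coeff D m' w p *
       (g1 (d k) * g2 (mean_freq p))) * (cos (mean_freq p \<bullet> (y - y' p)) * cos (d k \<bullet> (x - y)))) / real N ^ CARD('d)" for y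
      unfolding fejer_mean_explicit fejer_kernel_def times_divide_eq_right sum_product
      by (intro arg_cong2[where f = "(/)"] sum.cong refl)
         (simp add: d_def y'_def mean_phase_def inner_diff_right)
    then show ?thesis
      unfolding fejer_mean_def[of N] by (simp only: grid_mean_divide grid_mean_sum grid_mean_mult mult.assoc)
  qed
  show ?thesis
    unfolding ex
  proof (rule arg_cong2[where f = "(/)", OF sum.cong[OF refl sum.cong[OF refl arg_cong2[where f = "(*)", OF refl]]] refl])
    fix p :: "('d \<Rightarrow> nat) \<times> ('d \<Rightarrow> nat) \<times> ('d \<Rightarrow> nat)" and k :: "('d \<Rightarrow> nat) \<times> ('d \<Rightarrow> nat)"
    assume p: "p \<in> mean_index D m'" and k: "k \<in> multi_index N \<times> multi_index N"
    have "integer_vec N (d k)" unfolding d_def using k by (intro integer_vec_diff) auto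
    then show "1 * g (mean_freq p) * grid_mean m (\<lambda>y. cos (mean_freq p \<bullet> (y - y' p)) * cos (d k \<bullet> (x - y)))
      = g (d k) * 1 * grid_mean m (\<lambda>y. cos (mean_freq p \<bullet> (y - y' p)) * cos (d k \<bullet> (x - y)))"
      using grid_mean_cos_cos[of D "mean_freq p" N "d k" m g] mean_freq_integer[OF p] m g by simp
  qed
qed

text \<open>This inequality forces \<open>w\<close> to be \<open>2\<pi>\<close>-periodic in every coordinate.\<close>

definition torus_Lip :: "real \<Rightarrow> (real ^ 'd \<Rightarrow> real) \<Rightarrow> bool" where
  "torus_Lip K w \<longleftrightarrow> (\<forall>x y. \<bar>w x - w y\<bar> \<le> K * (\<Sum>i\<in>UNIV. \<bar>sin ((x $ i - y $ i) / 2)\<bar>))"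

text \<open>With s = |sin ((x_i - y_i)/2)| one has s \<le> r/2 + s^2/(2r) and 2 s^2 = 1 - cos (x_i -
  y_i), whose mean against the kernel is 1/N. The choice r = 1/sqrt N makes both terms of order
  1/sqrt N.\<close>

lemma fejer_mean_approx:
  fixes w :: "real ^ 'd \<Rightarrow> real"
  assumes N: "0 < N" "2 * N \<le> m" and m: "2 \<le> m" and w: "torus_Lip K w" and K: "K \<ge> 0"
  shows "\<bar>fejer_mean N m (\<lambda>_. 1) w x - w x\<bar> \<le> K * real CARD('d) / sqrt (real N)"
proof -
  have m0: "m > 0" using m by simp
  define r where "r = 1 / sqrt (real N)"
  have r: "r > 0" using N by (simp add: r_def)
  have r2: "r * r = 1 / real N" using N by (simp add: r_def)
  define ker where "ker y = fejer_kernel N (\<lambda>_. 1) (x - y)" for y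
  have k0: "ker y \<ge> 0" for y by (simp add: ker_def fejer_kernel_nonneg)
  define b where "b y = (\<Sum>i\<in>UNIV. K * (r / 2 * ker y + 1 / (4 * r) * (ker y - ker y * cos ((x - y) $ i))))" for y
  have pt: "\<bar>(w y - w x) * ker y\<bar> \<le> b y" for y
  proof -
    have "\<bar>w y - w x\<bar> \<le> K * (\<Sum>i\<in>UNIV. \<bar>sin ((x $ i - y $ i) / 2)\<bar>)"
      using w unfolding torus_Lip_def by (metis abs_minus_commute)
    also have "\<dots> \<le> K * (\<Sum>i\<in>UNIV. r / 2 + 1 / (4 * r) * (1 - cos ((x - y) $ i)))"
    proof (intro mult_left_mono sum_mono K)
      fix i
      define s where "s = \<bar>sin ((x $ i - y $ i) / 2)\<bar>"
      have "cos (2 * ((x $ i - y $ i) / 2)) = 1 - 2 * (sin ((x $ i - y $ i) / 2))\<^sup>2"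
        by (rule cos_double_sin)
      moreover have "2 * ((x $ i - y $ i) / 2) = (x - y) $ i" by simp
      ultimately have c: "1 - cos ((x - y) $ i) = 2 * s\<^sup>2" by (simp only: s_def power2_abs)
      have "0 \<le> (r - s)\<^sup>2" by simp
      then have "2 * (r * s) \<le> r\<^sup>2 + s\<^sup>2" by (simp add: power2_eq_square algebra_simps)
      then have "s \<le> r / 2 + s\<^sup>2 / (2 * r)" using r by (simp add: field_simps power2_eq_square)
      then show "s \<le> r / 2 + 1 / (4 * r) * (1 - cos ((x - y) $ i))" unfolding c by simp
    qed
    finally have "\<bar>w y - w x\<bar> * ker y \<le> K * (\<Sum>i\<in>UNIV. r / 2 + 1 / (4 * r) * (1 - cos ((x - y) $ i))) * ker y"
      using k0 by (rule mult_right_mono)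
    also have "\<dots> = b y"
      unfolding b_def sum_distrib_left sum_distrib_right by (intro sum.cong refl) (simp add: algebra_simps)
    finally show ?thesis using k0 by (simp add: abs_mult)
  qed
  have mk: "grid_mean m ker = 1"
    unfolding ker_def using N by (intro grid_mean_fejer_kernel) auto
  have mc: "grid_mean m (\<lambda>y. ker y * cos ((x - y) $ i)) = 1 - 1 / real N" for i
    unfolding ker_def using N m by (intro grid_mean_fejer_kernel_cos) auto
  have "grid_mean m b = (\<Sum>i\<in>(UNIV :: 'd set). K * (r / 2 * 1 + 1 / (4 * r) * (1 - (1 - 1 / real N))))"
    unfolding b_def grid_mean_sum
    by (simp only: grid_mean_mult grid_mean_add grid_mean_diff mk mc)
  also have "\<dots> = real CARD('d) * (K * (r / 2 + 1 / (4 * r) * (r * r)))" by (simp add: r2)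
  also have "\<dots> = real CARD('d) * (K * (r * 3 / 4))" using r by simp
  also have "\<dots> \<le> real CARD('d) * (K * r)" using r K by (intro mult_left_mono) auto
  finally have mb: "grid_mean m b \<le> K * real CARD('d) / sqrt (real N)" by (simp add: r_def mult_ac)
  have eq: "fejer_mean N m (\<lambda>_. 1) w x - w x = grid_mean m (\<lambda>y. (w y - w x) * ker y)"
    using mk by (simp add: fejer_mean_def ker_def[symmetric] left_diff_distrib grid_mean_diff grid_mean_mult)
  have "grid_mean m (\<lambda>y. (w y - w x) * ker y) \<le> grid_mean m b"
    using pt by (intro grid_mean_mono) (meson abs_le_D1)
  moreover have "grid_mean m (\<lambda>y. - 1 * ((w y - w x) * ker y)) \<le> grid_mean m b"
    using pt by (intro grid_mean_mono) (metis abs_le_D2 mult_minus1)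
  then have "- grid_mean m (\<lambda>y. (w y - w x) * ker y) \<le> grid_mean m b"
    unfolding grid_mean_mult by simp
  ultimately show ?thesis unfolding eq using mb by linarith
qed

text \<open>(1 - v + v^2)(1 + v) = 1 + v^3 \<ge> 1, combined with \<open>1 + v \<le> exp v\<close>.
  The bound covers large \<open>v\<close> as well, hence all frequencies at a given time
  step.\<close>

lemma exp_second_order_neg: "0 \<le> (v :: real) \<Longrightarrow> \<bar>exp (- v) - 1 + v\<bar> \<le> v\<^sup>2"
proof -
  assume v: "0 \<le> v"
  have "1 \<le> (1 - v + v\<^sup>2) * (1 + v)" using v by (simp add: algebra_simps power2_eq_square)
  also have "\<dots> \<le> (1 - v + v\<^sup>2) * exp v"
  proof (rule mult_left_mono)
    have "0 \<le> (v - 1/2)\<^sup>2" by simp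
    then show "0 \<le> 1 - v + v\<^sup>2" by (simp add: power2_eq_square algebra_simps)
  qed (simp add: exp_ge_add_one_self)
  finally have "exp (- v) \<le> 1 - v + v\<^sup>2" by (simp add: exp_minus field_simps)
  moreover have "1 - v \<le> exp (- v)" using exp_ge_add_one_self[of "- v"] by simp
  ultimately show ?thesis by simp
qed

lemma exp_second_order: "\<bar>v :: real\<bar> \<le> 1 \<Longrightarrow> \<bar>exp (- v) - 1 + v\<bar> \<le> v\<^sup>2"
proof (cases "0 \<le> v")
  case False
  assume "\<bar>v\<bar> \<le> 1"
  then have "exp (- v) \<le> 1 + (- v) + (- v)\<^sup>2" using False by (intro exp_bound) auto
  moreover have "1 - v \<le> exp (- v)" using exp_ge_add_one_self[of "- v"] by simp
  ultimately show ?thesis by simp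
qed (rule exp_second_order_neg)

lemma upper_jet_cos_sum:
  fixes a :: "'j \<Rightarrow> real ^ 'd"
  assumes "finite J"
    and g: "\<And>j. j \<in> J \<Longrightarrow> \<exists>r>0. \<exists>K. \<forall>s. \<bar>s - t\<bar> < r \<longrightarrow> \<bar>g j s - g j t - g' j * (s - t)\<bar> \<le> K * (s - t)\<^sup>2"
  shows "upper_jet (\<lambda>s y. \<Sum>j\<in>J. g j s * cos (a j \<bullet> y - \<theta> j)) t x (\<Sum>j\<in>J. g' j * cos (a j \<bullet> x - \<theta> j))
           (\<Sum>j\<in>J. (- (g j t * sin (a j \<bullet> x - \<theta> j))) *\<^sub>R a j)
           (\<Sum>j\<in>J. (- (g j t * cos (a j \<bullet> x - \<theta> j))) *\<^sub>R outer (a j))"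
proof (rule upper_jet_sum[OF assms(1)])
  fix j assume "j \<in> J"
  then obtain r K where "r > 0" "\<And>s. \<bar>s - t\<bar> < r \<Longrightarrow> \<bar>g j s - g j t - g' j * (s - t)\<bar> \<le> K * (s - t)\<^sup>2"
    using g by meson
  then show "upper_jet (\<lambda>s y. g j s * cos (a j \<bullet> y - \<theta> j)) t x (g' j * cos (a j \<bullet> x - \<theta> j))
     ((- (g j t * sin (a j \<bullet> x - \<theta> j))) *\<^sub>R a j) ((- (g j t * cos (a j \<bullet> x - \<theta> j))) *\<^sub>R outer (a j))"
    by (rule upper_jet_cos)
qed

lemma exp_quadratic_remainder:
  fixes c q t t0 :: real
  assumes "q \<ge> 0"
  shows "\<exists>r>0. \<exists>K. \<forall>s. \<bar>s - t\<bar> < r \<longrightarrow>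
    \<bar>c * exp (- ((s - t0) * q)) - c * exp (- ((t - t0) * q)) - (- (q * (c * exp (- ((t - t0) * q))))) * (s - t)\<bar> \<le> K * (s - t)\<^sup>2"
proof (intro exI conjI allI impI)
  \<comment> \<open>Within this radius |s - t| q \<le> 1, the range of the expansion for exponents
    of either sign.\<close>
  show "1 / (q + 1) > 0" using assms by simp
  fix s assume "\<bar>s - t\<bar> < 1 / (q + 1)"
  then have "\<bar>s - t\<bar> * (q + 1) < 1" using assms by (simp add: field_simps)
  moreover have "\<bar>s - t\<bar> * q \<le> \<bar>s - t\<bar> * (q + 1)" by (intro mult_left_mono) auto
  ultimately have "\<bar>s - t\<bar> * q \<le> 1" by simp
  then have "\<bar>(s - t) * q\<bar> \<le> 1" using assms by (simp only: abs_mult abs_of_nonneg)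
  then have *: "\<bar>exp (- ((s - t) * q)) - 1 + (s - t) * q\<bar> \<le> ((s - t) * q)\<^sup>2" by (rule exp_second_order)
  have "exp (- ((s - t0) * q)) = exp (- ((t - t0) * q)) * exp (- ((s - t) * q))"
    by (simp add: exp_add[symmetric] algebra_simps)
  then have "c * exp (- ((s - t0) * q)) - c * exp (- ((t - t0) * q)) - (- (q * (c * exp (- ((t - t0) * q))))) * (s - t)
     = c * exp (- ((t - t0) * q)) * (exp (- ((s - t) * q)) - 1 + (s - t) * q)"
    by (simp add: algebra_simps)
  then have "\<bar>c * exp (- ((s - t0) * q)) - c * exp (- ((t - t0) * q)) - (- (q * (c * exp (- ((t - t0) * q))))) * (s - t)\<bar>
     \<le> \<bar>c * exp (- ((t - t0) * q))\<bar> * ((s - t) * q)\<^sup>2"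
    using * by (simp add: abs_mult mult_left_mono)
  also have "\<dots> = (\<bar>c * exp (- ((t - t0) * q))\<bar> * q\<^sup>2) * (s - t)\<^sup>2" by (simp add: power_mult_distrib)
  finally show "\<bar>c * exp (- ((s - t0) * q)) - c * exp (- ((t - t0) * q)) - (- (q * (c * exp (- ((t - t0) * q))))) * (s - t)\<bar>
     \<le> (\<bar>c * exp (- ((t - t0) * q))\<bar> * q\<^sup>2) * (s - t)\<^sup>2" .
qed

section \<open>Uniqueness for periodic data\<close>

lemma upper_jet_affine_time: "upper_jet (\<lambda>s y. c * (s - b) + e) t x c 0 0"
  unfolding upper_jet_def
  by (auto intro!: exI[of _ 0] exI[of _ 1] simp: algebra_simps)

lemma outer_minus: "outer (- a) = outer a"
  by (simp add: outer_def vec_eq_iff)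

lemma norm_integer_vec:
  fixes a :: "real ^ 'd"
  assumes "integer_vec N a"
  shows "(norm a)\<^sup>2 \<le> real CARD('d) * (real N)\<^sup>2"
proof -
  have "(a $ i)\<^sup>2 \<le> (real N)\<^sup>2" for i
  proof -
    obtain n :: int where "a $ i = of_int n" "\<bar>n\<bar> < int N" using assms unfolding integer_vec_def by meson
    then have "\<bar>a $ i\<bar> \<le> real N" by linarith
    then show ?thesis using power_mono[of "\<bar>a $ i\<bar>" "real N" 2] by simp
  qed
  then have "(\<Sum>i\<in>(UNIV :: 'd set). (a $ i)\<^sup>2) \<le> (\<Sum>i\<in>(UNIV :: 'd set). (real N)\<^sup>2)"
    by (intro sum_mono)
  moreover have "(norm a)\<^sup>2 = (\<Sum>i\<in>UNIV. (a $ i)\<^sup>2)" by (simp add: norm_vec_def L2_set_def sum_nonneg)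
  ultimately show ?thesis by simp
qed

lemma sum_uminus_affine:
  "(\<Sum>p\<in>J. - (a p + r * b p) * k p) = - ((\<Sum>p\<in>J. a p * k p) + r * (\<Sum>p\<in>J. b p * k p :: real))"
  unfolding sum_distrib_left sum.distrib[symmetric] sum_negf[symmetric]
  by (intro sum.cong refl) (simp add: algebra_simps)

lemma sum_scaleR_uminus_affine:
  "(\<Sum>p\<in>J. (- ((a p + r * b p) * k p)) *\<^sub>R l p) = - ((\<Sum>p\<in>J. a p * l p * k p) + r * (\<Sum>p\<in>J. b p * l p * k p :: real))"
  unfolding sum_distrib_left sum.distrib[symmetric] sum_negf[symmetric]
  by (intro sum.cong refl) (simp add: algebra_simps)

text \<open>Collects the uniform bounds shared by the evolutions of periodic data. The exponent 1/2
  in time comes from the factor \<open>sqrt t\<close> in front of \<open>X\<close>; it is what makes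
  the error of one slab of order h sqrt h.\<close>

definition regular :: "(real \<Rightarrow> real ^ 'd \<Rightarrow> real) \<Rightarrow> real \<Rightarrow> real \<Rightarrow> real \<Rightarrow> bool" where
  "regular w B K C \<longleftrightarrow> (\<forall>s\<ge>0. \<forall>y. \<bar>w s y\<bar> \<le> B) \<and> (\<forall>s\<ge>0. torus_Lip K (w s)) \<and>
     (\<forall>s\<ge>0. \<forall>t\<ge>0. \<forall>y. \<bar>w s y - w t y\<bar> \<le> C * sqrt \<bar>s - t\<bar>) \<and>
     continuous_on ({0..} \<times> UNIV) (\<lambda>(s, y). w s y)"

text \<open>\<open>G\<close> is the infimum of the linear operators in \<open>L\<close>, of which \<open>greatest\<close> is the half used here.\<close>

locale concave_operator =
  fixes G :: "real ^ 'd ^ 'd \<Rightarrow> real" and L :: "(real ^ 'd ^ 'd \<Rightarrow> real) set" and M C0 :: real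
  assumes lin: "\<And>\<l>. \<l> \<in> L \<Longrightarrow> linear \<l>"
    and pos: "\<And>\<l> a. \<l> \<in> L \<Longrightarrow> 0 \<le> \<l> (outer a)"
    and bdd: "\<And>\<l> a. \<l> \<in> L \<Longrightarrow> \<l> (outer a) \<le> M * (norm a)\<^sup>2"
    and greatest: "\<And>c S. (\<And>\<l>. \<l> \<in> L \<Longrightarrow> c \<le> \<l> S) \<Longrightarrow> c \<le> G S"
    and G_mat: "\<And>S \<beta>. \<beta> \<ge> 0 \<Longrightarrow> G (S + \<beta> *\<^sub>R mat 1) \<le> G S + C0 * \<beta>"
    and M_nonneg: "0 \<le> M"
begin

text \<open>The Fejer mean of \<open>w t\<close> of high degree \<open>D\<close> dominates \<open>w t\<close> up to a small error and has an explicit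
  heat evolution. The latter commutes with the mean of degree \<open>N\<close>, so the bound involves \<open>D\<close> only
  through that small error.\<close>

lemma fejer_mean_heat_bound:
  assumes l: "\<l> \<in> L" and sub: "jet_sub \<l> w" and reg: "regular w B K C" and K: "K \<ge> 0"
    and t: "0 \<le> t" and h: "0 < h"
    and N: "0 < N" "2 * N \<le> m" and D: "0 < D" "2 * D \<le> m" and ND: "N + D \<le> m" and m: "2 \<le> m"
  shows "fejer_mean N m (\<lambda>_. 1) (w (t + h)) x \<le> fejer_mean N m (\<lambda>a. exp (- (h * \<l> (outer a)))) (w t) x
           + (1 + real N ^ CARD('d)) * (K * real CARD('d) / sqrt (real D))"
proof -
  have m0: "m > 0" using m by simp
  define \<epsilon> where "\<epsilon> = K * real CARD('d) / sqrt (real D)"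
  define q where "q a = \<l> (outer a)" for a
  have q: "0 \<le> q a" for a using pos[OF l] by (simp add: q_def)
  interpret \<l>: linear \<l> using lin[OF l] .
  have ap: "\<bar>fejer_mean D m (\<lambda>_. 1) (w t) y - w t y\<bar> \<le> \<epsilon>" for y
    unfolding \<epsilon>_def using reg t D m K by (intro fejer_mean_approx) (auto simp: regular_def)
  have \<epsilon>: "\<epsilon> \<ge> 0" using K by (simp add: \<epsilon>_def)
  \<comment> \<open>The heat evolution of the mean of degree \<open>D\<close>, raised by
    \<open>\<epsilon>\<close> so that it starts above \<open>w t\<close>. The slope \<open>0\<close>
    casts the constant into the shape of \<open>upper_jet_affine_time\<close>.\<close>
  define f where "f s y = fejer_mean D m (\<lambda>a. exp (- ((s - t) * q a))) (w t) y + (0 * (s - 0) + \<epsilon>)" for s y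
  define g where "g p s = mean_coeff D m (w t) p * exp (- ((s - t) * q (mean_freq p)))" for p s
  have f_eq: "f = (\<lambda>s y. (\<Sum>p\<in>mean_index D m. g p s * cos (mean_freq p \<bullet> y - mean_phase m p)) + (0 * (s - 0) + \<epsilon>))"
    by (simp add: fun_eq_iff f_def fejer_mean_explicit g_def)
  have wB: "\<bar>w s y\<bar> \<le> B" if "s \<ge> 0" for s y using reg that by (simp add: regular_def)
  have B0: "B \<ge> 0" using wB[of 0 0] by simp
  have step: "w (t + h) y \<le> f (t + h) y" for y
  \<comment> \<open>The interval extends beyond \<open>t + h\<close> because the comparison holds
    only strictly before its end.\<close>
  proof (rule comparison[where u = w and f = f and t = "t + h" and x = y and F = \<l> and C = "\<l> (mat 1)" and a = t and b = "t + h + 1" and B = "B + B * (1 * real D ^ CARD('d)) + \<epsilon>"])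
    show "jet_sub \<l> w" by fact
    show "\<l> (S + \<beta> *\<^sub>R mat 1) \<le> \<l> S + \<l> (mat 1) * \<beta>" for S \<beta>
      by (simp add: \<l>.add \<l>.scale)
    show "continuous_on ({t..t + h + 1} \<times> UNIV) (\<lambda>(s, y). w s y)"
      using reg t unfolding regular_def by (auto intro: continuous_on_subset)
    show "continuous_on ({t..t + h + 1} \<times> UNIV) (\<lambda>(s, y). f s y)"
      unfolding f_eq g_def case_prod_unfold by (intro continuous_intros)
    show "\<bar>w s y\<bar> \<le> B + B * (1 * real D ^ CARD('d)) + \<epsilon>" if "t \<le> s" "s \<le> t + h + 1" for s y
      using wB[of s y] that t B0 \<epsilon> by (simp add: add_increasing2)
    show "\<bar>f s y\<bar> \<le> B + B * (1 * real D ^ CARD('d)) + \<epsilon>" if "t \<le> s" "s \<le> t + h + 1" for s y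
    proof -
      have "\<bar>fejer_mean D m (\<lambda>a. exp (- ((s - t) * q a))) (w t) y\<bar> \<le> B * (1 * real D ^ CARD('d))"
        using D m0 wB[OF t] q that by (intro fejer_mean_bound) auto
      then show ?thesis using B0 \<epsilon> by (simp add: f_def)
    qed
    show "\<exists>qq p S. upper_jet f s y qq p S \<and> \<l> S \<le> qq" for s y
    proof -
      have J: "upper_jet f s y
        ((\<Sum>p\<in>mean_index D m. - (q (mean_freq p) * g p s) * cos (mean_freq p \<bullet> y - mean_phase m p)) + 0)
        ((\<Sum>p\<in>mean_index D m. (- (g p s * sin (mean_freq p \<bullet> y - mean_phase m p))) *\<^sub>R mean_freq p) + 0)
        ((\<Sum>p\<in>mean_index D m. (- (g p s * cos (mean_freq p \<bullet> y - mean_phase m p))) *\<^sub>R outer (mean_freq p)) + 0)"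
        unfolding f_eq
      proof (intro upper_jet_add upper_jet_affine_time upper_jet_cos_sum finite_mean_index)
        fix p :: "('d \<Rightarrow> nat) \<times> ('d \<Rightarrow> nat) \<times> ('d \<Rightarrow> nat)"
        show "\<exists>r>0. \<exists>K. \<forall>s'. \<bar>s' - s\<bar> < r \<longrightarrow> \<bar>g p s' - g p s - - (q (mean_freq p) * g p s) * (s' - s)\<bar> \<le> K * (s' - s)\<^sup>2"
          unfolding g_def by (rule exp_quadratic_remainder[OF q])
      qed
      moreover have "\<l> ((\<Sum>p\<in>mean_index D m. (- (g p s * cos (mean_freq p \<bullet> y - mean_phase m p))) *\<^sub>R outer (mean_freq p)) + 0)
         \<le> (\<Sum>p\<in>mean_index D m. - (q (mean_freq p) * g p s) * cos (mean_freq p \<bullet> y - mean_phase m p)) + 0"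
        unfolding add_0_right \<l>.sum \<l>.scale q_def by (intro eq_refl sum.cong refl) simp
      ultimately show ?thesis by blast
    qed
    show "w t y \<le> f t y" for y
      using ap[of y] by (simp add: f_def)
  qed (use t h in auto)
  have "fejer_mean N m (\<lambda>_. 1) (w (t + h)) x \<le> fejer_mean N m (\<lambda>_. 1) (f (t + h)) x"
    by (rule fejer_mean_mono[OF step])
  also have "\<dots> = fejer_mean N m (\<lambda>_. 1) (fejer_mean D m (\<lambda>a. exp (- (h * q a))) (w t)) x + \<epsilon>"
  proof -
    have "f (t + h) = (\<lambda>y. fejer_mean D m (\<lambda>a. exp (- (h * q a))) (w t) y + \<epsilon>)"
      by (simp add: fun_eq_iff f_def)
    then show ?thesis using N by (simp add: fejer_mean_add fejer_mean_const)
  qed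
  \<comment> \<open>The multiplier moves from degree \<open>D\<close> to degree \<open>N\<close>;
    after that the inner mean can be replaced by \<open>w t\<close> itself.\<close>
  also have "fejer_mean N m (\<lambda>_. 1) (fejer_mean D m (\<lambda>a. exp (- (h * q a))) (w t)) x
     = fejer_mean N m (\<lambda>a. exp (- (h * q a))) (fejer_mean D m (\<lambda>_. 1) (w t)) x"
    using ND by (intro fejer_mean_commute) (auto simp: q_def outer_minus)
  also have "\<dots> = fejer_mean N m (\<lambda>a. exp (- (h * q a))) (w t) x
     + fejer_mean N m (\<lambda>a. exp (- (h * q a))) (\<lambda>y. fejer_mean D m (\<lambda>_. 1) (w t) y - w t y) x"
    by (simp add: fejer_mean_diff)
  \<comment> \<open>The replacement error is estimated by the size of the kernel, the origin of the
    factor \<open>real N ^ CARD('d)\<close>.\<close>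
  also have "fejer_mean N m (\<lambda>a. exp (- (h * q a))) (\<lambda>y. fejer_mean D m (\<lambda>_. 1) (w t) y - w t y) x
     \<le> \<epsilon> * (1 * real N ^ CARD('d))"
    using N m0 ap q h by (intro order_trans[OF abs_ge_self fejer_mean_bound]) auto
  finally show ?thesis by (simp add: \<epsilon>_def[symmetric] q_def algebra_simps)
qed

definition freq_bound :: "nat \<Rightarrow> real" where
  "freq_bound N = M * (real CARD('d) * (real N)\<^sup>2)"

text \<open>The summands account for the variation of \<open>w1\<close> in time, with a factor 2
  from an interval of length \<open>2 * h\<close>; for the quadratic remainder of the exponential;
  and for the approximation error, at most \<open>h\<^sup>2\<close> per slab.\<close>

definition slab_const :: "nat \<Rightarrow> real \<Rightarrow> real \<Rightarrow> real" where
  "slab_const N B C = 2 * (C * (freq_bound N * real N ^ CARD('d))) + B * ((freq_bound N)\<^sup>2 * real N ^ CARD('d)) + 1"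

lemma freq_bound:
  assumes "\<l> \<in> L" and "integer_vec N a"
  shows "\<bar>\<l> (outer a)\<bar> \<le> freq_bound N"
proof -
  have "\<l> (outer a) \<le> M * (norm a)\<^sup>2" by (rule bdd[OF assms(1)])
  also have "\<dots> \<le> freq_bound N"
    unfolding freq_bound_def by (intro mult_left_mono norm_integer_vec assms M_nonneg)
  finally show ?thesis using pos[OF assms(1), of a] by simp
qed

text \<open>The linear interpolation in time of the mollified subsolution between \<open>t\<close> and \<open>t + h\<close> is, after a
  correction of order \<open>h sqrt h\<close>, a classical subsolution; concavity of \<open>G\<close> enters by testing
  with each linear operator separately.\<close>

lemma slab_step:
  assumes w1: "\<And>\<l>. \<l> \<in> L \<Longrightarrow> jet_sub \<l> w1" and reg1: "regular w1 B K C"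
    and w2: "jet_sub (\<lambda>A. - G (- A)) (\<lambda>s y. - w2 s y)" and reg2: "regular w2 B K C"
    and K: "K \<ge> 0" and C: "C \<ge> 0"
    and t: "0 \<le> t" and h: "0 < h" "h \<le> 1"
    and N: "0 < N" "2 * N \<le> m" and D: "0 < D" "2 * D \<le> m" and ND: "N + D \<le> m" and m: "2 \<le> m"
    and small: "(1 + real N ^ CARD('d)) * (K * real CARD('d) / sqrt (real D)) \<le> h\<^sup>2"
    and init: "\<And>y. fejer_mean N m (\<lambda>_. 1) (w1 t) y - \<eta> \<le> w2 t y"
  shows "fejer_mean N m (\<lambda>_. 1) (w1 (t + h)) x - \<eta> - slab_const N B C * (h * sqrt h) \<le> w2 (t + h) x"
proof -
  have m0: "m > 0" using m by simp
  define W where "W s = fejer_mean N m (\<lambda>_. 1) (w1 s)" for s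
  define \<Lambda> where "\<Lambda> = freq_bound N"
  define Nd where "Nd = real N ^ CARD('d)"
  define c where "c = slab_const N B C * sqrt h"
  have w1B: "\<bar>w1 s y\<bar> \<le> B" and w2B: "\<bar>w2 s y\<bar> \<le> B" if "s \<ge> 0" for s y
    using reg1 reg2 that by (auto simp: regular_def)
  have B0: "B \<ge> 0" using w1B[of 0 0] by simp
  have Nd0: "Nd \<ge> 0" by (simp add: Nd_def)
  have \<Lambda>0: "\<Lambda> \<ge> 0" using M_nonneg by (simp add: \<Lambda>_def freq_bound_def)
  have hs: "h \<le> sqrt h" using h by (metis less_eq_real_def mult_left_le_one_le mult_less_cancel_right2 not_le real_le_rsqrt power2_eq_square)
  have sq: "sqrt h * sqrt h = h" using h by simp
  define \<Delta> where "\<Delta> y = w1 (t + h) y - w1 t y" for y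
  have \<Delta>: "\<bar>\<Delta> y\<bar> \<le> C * sqrt h" for y
  proof -
    have "\<bar>w1 (t + h) y - w1 t y\<bar> \<le> C * sqrt \<bar>(t + h) - t\<bar>"
      using reg1 t h unfolding regular_def by (metis add_nonneg_nonneg less_imp_le)
    then show ?thesis using h by (simp add: \<Delta>_def)
  qed
  have W\<Delta>: "W (t + h) y - W t y = fejer_mean N m (\<lambda>_. 1) \<Delta> y" for y
    by (simp add: W_def \<Delta>_def[abs_def] fejer_mean_diff)
  \<comment> \<open>Linear interpolation of the coefficients, extrapolated beyond
    \<open>t + h\<close>, because the comparison runs on an interval of length \<open>2 * h\<close>
    to have \<open>t + h\<close> before its end.\<close>
  define g where "g p s = mean_coeff N m (w1 t) p + (s - t) / h * mean_coeff N m \<Delta> p" for p s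
  define Sf where "Sf s y = (\<Sum>p\<in>mean_index N m. (- (g p s * cos (mean_freq p \<bullet> y - mean_phase m p))) *\<^sub>R outer (mean_freq p))" for s y
  \<comment> \<open>The sign is reversed: \<open>f\<close> is minus the interpolated mean plus the
    correction, to be compared with \<open>- w2\<close>, a subsolution for
    \<open>\<lambda>A. - G (- A)\<close>.\<close>
  define f where "f s y = (\<Sum>p\<in>mean_index N m. - g p s * cos (mean_freq p \<bullet> y - mean_phase m p)) + (c * (s - t) + \<eta>)" for s y
  have f_eq: "f s y = - (W t y + (s - t) / h * (W (t + h) y - W t y)) + (c * (s - t) + \<eta>)" for s y
  proof -
    show ?thesis
      unfolding f_def g_def W\<Delta> unfolding W_def fejer_mean_explicit sum_uminus_affine by simp
  qed
  \<comment> \<open>The left-hand side is the time derivative of the corrected interpolation and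
    \<open>Sf\<close> its Hessian, so this is the classical subsolution inequality. By
    \<open>greatest\<close> it is enough to prove it with \<open>\<l>\<close> in place of
    \<open>G\<close>.\<close>
  have key: "(W (t + h) y - W t y) / h - c \<le> G (Sf s y)" if s: "t < s" "s < t + 2 * h" for s y
  proof (rule greatest)
    fix \<l> assume l: "\<l> \<in> L"
    interpret \<l>: linear \<l> using lin[OF l] .
    define q where "q a = \<l> (outer a)" for a
    have q0: "0 \<le> q a" for a using pos[OF l] by (simp add: q_def)
    have q\<Lambda>: "\<bar>q a\<bar> \<le> \<Lambda>" if "integer_vec N a" for a using freq_bound[OF l that] by (simp add: q_def \<Lambda>_def)
    have "\<l> (Sf s y) = - (fejer_mean N m q (w1 t) y + (s - t) / h * fejer_mean N m q \<Delta> y)"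
      unfolding Sf_def \<l>.sum \<l>.scale fejer_mean_explicit g_def q_def
      by (rule sum_scaleR_uminus_affine)
    moreover have "(s - t) / h * fejer_mean N m q \<Delta> y \<le> 2 * (C * sqrt h * (\<Lambda> * Nd))"
    proof -
      have b: "\<bar>fejer_mean N m q \<Delta> y\<bar> \<le> C * sqrt h * (\<Lambda> * Nd)"
        unfolding Nd_def using N m0 q\<Lambda> \<Delta> by (intro fejer_mean_bound) auto
      have "(s - t) / h * fejer_mean N m q \<Delta> y \<le> (s - t) / h * \<bar>fejer_mean N m q \<Delta> y\<bar>"
        using s h by (intro mult_left_mono) auto
      also have "\<dots> \<le> 2 * (C * sqrt h * (\<Lambda> * Nd))"
        using s h b by (intro mult_mono) (auto simp: divide_le_eq)
      finally show ?thesis .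
    qed
    \<comment> \<open>The mean of \<open>w1 (t + h)\<close> lies below a heat evolution; expanding
      its multiplier to first order leaves \<open>W t\<close> plus \<open>h\<close> times
      \<open>\<l>\<close> of the Hessian of \<open>W t\<close>.\<close>
    moreover have "(W (t + h) y - W t y) / h \<le> - fejer_mean N m q (w1 t) y + h * (B * (\<Lambda>\<^sup>2 * Nd) + 1)"
    proof -
      have "W (t + h) y \<le> fejer_mean N m (\<lambda>a. exp (- (h * q a))) (w1 t) y + h\<^sup>2"
        using fejer_mean_heat_bound[OF l w1[OF l] reg1 K t h(1) N D ND m, of y] small
        by (simp add: W_def q_def)
      moreover have "fejer_mean N m (\<lambda>a. exp (- (h * q a))) (w1 t) y
         = W t y - h * fejer_mean N m q (w1 t) y + fejer_mean N m (\<lambda>a. exp (- (h * q a)) - 1 + h * q a) (w1 t) y"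
        unfolding W_def fejer_mean_explicit
        by (simp add: sum.distrib sum_subtractf sum_distrib_left algebra_simps)
      moreover have "fejer_mean N m (\<lambda>a. exp (- (h * q a)) - 1 + h * q a) (w1 t) y \<le> B * ((h * \<Lambda>)\<^sup>2 * Nd)"
        unfolding Nd_def
      proof (intro order_trans[OF abs_ge_self fejer_mean_bound])
        fix k assume k: "integer_vec N (k :: real ^ 'd)"
        have "\<bar>exp (- (h * q k)) - 1 + h * q k\<bar> \<le> (h * q k)\<^sup>2"
          using h q0 by (intro exp_second_order_neg) simp
        also have "\<dots> \<le> (h * \<Lambda>)\<^sup>2"
          using h q0[of k] q\<Lambda>[OF k] by (intro power_mono mult_left_mono) auto
        finally show "\<bar>exp (- (h * q k)) - 1 + h * q k\<bar> \<le> (h * \<Lambda>)\<^sup>2" .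
      qed (use N m0 w1B t in auto)
      ultimately have "W (t + h) y - W t y \<le> - (h * fejer_mean N m q (w1 t) y) + (B * ((h * \<Lambda>)\<^sup>2 * Nd) + h\<^sup>2)"
        by linarith
      also have "\<dots> = h * (- fejer_mean N m q (w1 t) y + h * (B * (\<Lambda>\<^sup>2 * Nd) + 1))"
        by (simp add: algebra_simps power2_eq_square)
      finally show ?thesis using h by (simp add: divide_le_eq mult.commute)
    qed
    moreover have "h * (B * (\<Lambda>\<^sup>2 * Nd) + 1) \<le> sqrt h * (B * (\<Lambda>\<^sup>2 * Nd) + 1)"
      using hs B0 Nd0 by (intro mult_right_mono) auto
    moreover have "c = 2 * (C * sqrt h * (\<Lambda> * Nd)) + sqrt h * (B * (\<Lambda>\<^sup>2 * Nd) + 1)"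
      by (simp add: c_def slab_const_def \<Lambda>_def Nd_def algebra_simps)
    ultimately show "(W (t + h) y - W t y) / h - c \<le> \<l> (Sf s y)" by linarith
  qed
  have "- w2 (t + h) x \<le> f (t + h) x"
  proof (rule comparison[where F = "\<lambda>A. - G (- A)" and C = C0 and a = t and b = "t + 2 * h"
      and B = "B + 5 * (B * (1 * Nd)) + \<bar>c\<bar> * 2 + \<bar>\<eta>\<bar>" and u = "\<lambda>s y. - w2 s y" and f = f and t = "t + h" and x = x])
    have BN: "B * (1 * Nd) \<ge> 0" using B0 Nd0 by simp
    show "jet_sub (\<lambda>A. - G (- A)) (\<lambda>s y. - w2 s y)" by fact
    show "- G (- (S + \<beta> *\<^sub>R mat 1)) \<le> - G (- S) + C0 * \<beta>" if "\<beta> \<ge> 0" for S \<beta>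
      using G_mat[OF that, of "- (S + \<beta> *\<^sub>R mat 1)"] by simp
    have "continuous_on ({t..t + 2 * h} \<times> UNIV) (\<lambda>(s, y). w2 s y)"
      using reg2 t unfolding regular_def by (auto intro: continuous_on_subset)
    then show "continuous_on ({t..t + 2 * h} \<times> UNIV) (\<lambda>(s, y). - w2 s y)"
      unfolding case_prod_unfold by (rule continuous_on_minus)
    show "continuous_on ({t..t + 2 * h} \<times> UNIV) (\<lambda>(s, y). f s y)"
      unfolding f_def g_def case_prod_unfold using h by (intro continuous_intros) auto
    show "\<bar>- w2 s y\<bar> \<le> B + 5 * (B * (1 * Nd)) + \<bar>c\<bar> * 2 + \<bar>\<eta>\<bar>" if "t \<le> s" for s y
      using w2B[of s y] that t BN by simp
    show "\<bar>f s y\<bar> \<le> B + 5 * (B * (1 * Nd)) + \<bar>c\<bar> * 2 + \<bar>\<eta>\<bar>" if s: "t \<le> s" "s \<le> t + 2 * h" for s y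
    proof -
      have Wb: "\<bar>W r y\<bar> \<le> B * (1 * Nd)" if "r \<ge> 0" for r
        unfolding W_def Nd_def using N m0 w1B[OF that] by (intro fejer_mean_bound) auto
      have "\<bar>(s - t) / h * (W (t + h) y - W t y)\<bar> \<le> 2 * (2 * (B * (1 * Nd)))"
        unfolding abs_mult using Wb[of t] Wb[of "t + h"] s h t
        by (intro mult_mono) (auto simp: divide_le_eq)
      moreover have "\<bar>c * (s - t)\<bar> \<le> \<bar>c\<bar> * 2"
        unfolding abs_mult using s h by (intro mult_left_mono) auto
      moreover have "\<bar>- (w + v) + (r + \<eta>)\<bar> \<le> B + 5 * P + R + \<bar>\<eta>\<bar>"
        if "\<bar>v\<bar> \<le> 2 * (2 * P)" "\<bar>r\<bar> \<le> R" "\<bar>w\<bar> \<le> P" for w v r P R :: real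
        using that B0 by linarith
      ultimately show ?thesis using Wb[OF t] unfolding f_eq by blast
    qed
    show "\<exists>q p S. upper_jet f s y q p S \<and> - G (- S) \<le> q" if s: "t < s" "s < t + 2 * h" for s y
    proof -
      have J: "upper_jet f s y
        ((\<Sum>p\<in>mean_index N m. - (mean_coeff N m \<Delta> p / h) * cos (mean_freq p \<bullet> y - mean_phase m p)) + c)
        ((\<Sum>p\<in>mean_index N m. (- (- g p s * sin (mean_freq p \<bullet> y - mean_phase m p))) *\<^sub>R mean_freq p) + 0)
        ((\<Sum>p\<in>mean_index N m. (- (- g p s * cos (mean_freq p \<bullet> y - mean_phase m p))) *\<^sub>R outer (mean_freq p)) + 0)"
        unfolding f_def
      proof (intro upper_jet_add upper_jet_affine_time upper_jet_cos_sum)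
        fix p :: "('d \<Rightarrow> nat) \<times> ('d \<Rightarrow> nat) \<times> ('d \<Rightarrow> nat)"
        have "- g p s' - - g p s - - (mean_coeff N m \<Delta> p / h) * (s' - s) = 0" for s'
          using h by (simp add: g_def field_simps)
        then show "\<exists>r>0. \<exists>K. \<forall>s'. \<bar>s' - s\<bar> < r \<longrightarrow>
           \<bar>- g p s' - - g p s - - (mean_coeff N m \<Delta> p / h) * (s' - s)\<bar> \<le> K * (s' - s)\<^sup>2"
          by (intro exI[of _ 1]) (simp add: exI[of _ 0])
      qed simp
      have "(\<Sum>p\<in>mean_index N m. - (mean_coeff N m \<Delta> p / h) * cos (mean_freq p \<bullet> y - mean_phase m p))
          = - ((W (t + h) y - W t y) / h)"
        unfolding W\<Delta> fejer_mean_explicit by (simp add: sum_negf sum_divide_distrib)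
      moreover have "(\<Sum>p\<in>mean_index N m. (- (- g p s * cos (mean_freq p \<bullet> y - mean_phase m p))) *\<^sub>R outer (mean_freq p)) + 0 = - Sf s y"
        by (simp add: Sf_def sum_negf)
      ultimately show ?thesis using J key[OF s, of y] 
        by (intro exI conjI) (assumption, simp)
    qed
    show "- w2 t y \<le> f t y" for y
      using init[of y] by (simp add: f_eq W_def)
  qed (use t h in auto)
  then show ?thesis
    using h by (simp add: f_eq W_def c_def algebra_simps)
qed

lemma exists_inverse_sqrt_le:
  fixes c e :: real
  assumes "e > 0"
  shows "\<exists>N>0. c / sqrt (real N) \<le> e"
proof -
  obtain N :: nat where N: "(\<bar>c\<bar> / e)\<^sup>2 < real N" using reals_Archimedean2 by blast
  have N0: "N > 0" using N by (metis not_gr0 of_nat_0 not_less zero_le_power2)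
  have "\<bar>c\<bar> / e \<le> sqrt (real N)" using N by (intro real_le_rsqrt) simp
  then have "\<bar>c\<bar> \<le> e * sqrt (real N)" using assms by (simp add: field_simps)
  then have "c \<le> e * sqrt (real N)" by linarith
  then show ?thesis using N0 by (intro exI[of _ N]) (simp add: divide_le_eq mult.commute)
qed

text \<open>\<open>n\<close> slabs of length \<open>h = T / n\<close> lose a constant times h sqrt h
  each, in total \<open>T\<close> times this constant times sqrt h. The thirds of \<open>e\<close>
  go to the mollification at time 0, to the sum over the slabs and to the mollification at time
  \<open>T\<close>.\<close>

lemma viscosity_comparison:
  assumes w1: "\<And>\<l>. \<l> \<in> L \<Longrightarrow> jet_sub \<l> w1" and reg1: "regular w1 B K C"
    and w2: "jet_sub (\<lambda>A. - G (- A)) (\<lambda>s y. - w2 s y)" and reg2: "regular w2 B K C"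
    and K: "K \<ge> 0" and C: "C \<ge> 0" and init: "\<And>y. w1 0 y \<le> w2 0 y" and T: "0 \<le> T"
  shows "w1 T x \<le> w2 T x"
proof (cases "T = 0")
  case True
  then show ?thesis using init by simp
next
  case False
  then have T0: "T > 0" using T by simp
  show ?thesis
  proof (rule field_le_epsilon)
    fix e :: real assume e: "e > 0"
    obtain N where N: "N > 0" and Ne: "K * real CARD('d) / sqrt (real N) \<le> e / 3"
      using exists_inverse_sqrt_le[of "e / 3" "K * real CARD('d)"] e by auto
    define c where "c = slab_const N B C"
    obtain n0 where n0: "n0 > 0" and n0e: "(T * \<bar>c\<bar> * sqrt T) / sqrt (real n0) \<le> e / 3"
      using exists_inverse_sqrt_le[of "e / 3" "T * \<bar>c\<bar> * sqrt T"] e by auto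
    \<comment> \<open>The rounded \<open>T\<close> in the maximum ensures
      \<open>h \<le> 1\<close>.\<close>
    define n where "n = max n0 (nat \<lceil>T\<rceil>)"
    have n: "n > 0" "n \<ge> n0" using n0 by (auto simp: n_def)
    have Tn: "T \<le> real n" by (simp add: n_def) linarith
    define h where "h = T / real n"
    have h: "0 < h" "h \<le> 1" using T0 n Tn by (auto simp: h_def divide_le_eq)
    have nh: "real n * h = T" using n by (simp add: h_def)
    obtain D where D: "D > 0" and Dh: "(1 + real N ^ CARD('d)) * (K * real CARD('d)) / sqrt (real D) \<le> h\<^sup>2"
      using exists_inverse_sqrt_le[of "h\<^sup>2" "(1 + real N ^ CARD('d)) * (K * real CARD('d))"] h by auto
    \<comment> \<open>A grid fine enough for both degrees and for their product.\<close>
    define m where "m = 2 * N + 2 * D"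
    define W where "W s = fejer_mean N m (\<lambda>_. 1) (w1 s)" for s
    have ap: "\<bar>W s y - w1 s y\<bar> \<le> e / 3" if "s \<ge> 0" for s y
      unfolding W_def using reg1 that N D K
      by (intro order_trans[OF fejer_mean_approx Ne]) (auto simp: regular_def m_def)
    have "W (real k * h) y - (e / 3 + real k * (c * (h * sqrt h))) \<le> w2 (real k * h) y" for k y
    proof (induction k arbitrary: y)
      case 0
      have "W 0 y - e / 3 \<le> w2 0 y" using ap[of 0 y] init[of y] by linarith
      then show ?case by simp
    next
      case (Suc k)
      have "W (real k * h + h) y - (e / 3 + real k * (c * (h * sqrt h))) - slab_const N B C * (h * sqrt h) \<le> w2 (real k * h + h) y"
        unfolding W_def
      proof (rule slab_step[OF w1 reg1 w2 reg2 K C _ h N(1) _ D])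
        show "fejer_mean N m (\<lambda>_. 1) (w1 (real k * h)) z - (e / 3 + real k * (c * (h * sqrt h))) \<le> w2 (real k * h) z" for z
          using Suc.IH[of z] by (simp add: W_def)
        show "(1 + real N ^ CARD('d)) * (K * real CARD('d) / sqrt (real D)) \<le> h\<^sup>2" using Dh by simp
      qed (use N D h in \<open>auto simp: m_def\<close>)
      then show ?case by (simp add: c_def algebra_simps)
    qed
    from this[of n x] have "W T x - (e / 3 + real n * (c * (h * sqrt h))) \<le> w2 T x" by (simp add: nh)
    moreover have "real n * (c * (h * sqrt h)) \<le> e / 3"
    proof -
      have "real n * (c * (h * sqrt h)) = T * (c * sqrt h)" by (simp add: nh[symmetric] mult_ac)
      also have "\<dots> \<le> T * (\<bar>c\<bar> * sqrt h)" using T h by (intro mult_left_mono mult_right_mono) auto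
      also have "\<dots> = (T * \<bar>c\<bar> * sqrt T) / sqrt (real n)" by (simp add: h_def real_sqrt_divide)
      also have "\<dots> \<le> (T * \<bar>c\<bar> * sqrt T) / sqrt (real n0)"
        using T n n0 by (intro divide_left_mono) auto
      finally show ?thesis using n0e by (rule order_trans)
    qed
    ultimately show "w1 T x \<le> w2 T x + e" using ap[OF T, of x] by linarith
  qed
qed

end

section \<open>Functions of polynomial growth and superlinear expectations\<close>

lemma one_plus_powers_le:
  fixes a b :: real
  assumes "0 \<le> a" and "0 \<le> b"
  shows "1 + a ^ k + b ^ k \<le> 3 * (1 + a + b) ^ k"
proof -
  have "1 \<le> (1 + a + b) ^ k" "a ^ k \<le> (1 + a + b) ^ k" "b ^ k \<le> (1 + a + b) ^ k"
    using assms by (auto intro: one_le_power power_mono)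
  then show ?thesis by linarith
qed

lemma power_sum_le:
  fixes a b :: real
  assumes "0 \<le> a" and "0 \<le> b"
  shows "(1 + a + b) ^ k \<le> 3 ^ k * (1 + a ^ k + b ^ k)"
proof -
  define c where "c = max 1 (max a b)"
  have "(1 + a + b) ^ k \<le> (3 * c) ^ k" using assms by (intro power_mono) (auto simp: c_def)
  also have "\<dots> = 3 ^ k * c ^ k" by (rule power_mult_distrib)
  also have "c ^ k \<le> 1 + a ^ k + b ^ k"
    using assms by (auto simp: c_def max_def)
  finally show ?thesis by simp
qed

text \<open>The growth condition with the submultiplicative weight \<open>1 + |x| + |y|\<close>, for which
  exponents can be raised and products formed freely.\<close>

definition growth_Lip :: "('a \<Rightarrow> real) \<Rightarrow> ('a \<Rightarrow> 'a \<Rightarrow> real) \<Rightarrow> ('a \<Rightarrow> real) \<Rightarrow> bool" where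
  "growth_Lip n d \<phi> \<longleftrightarrow> (\<exists>C\<ge>0. \<exists>k::nat. \<forall>x y. \<bar>\<phi> x - \<phi> y\<bar> \<le> C * (1 + n x + n y) ^ k * d x y)"

text \<open>The two weights are comparable with factors 3 and 3^k. Sums of powers are the form of
  the definitions, powers of sums the form used in the proofs.\<close>

lemma growth_Lip_iff:
  assumes n: "\<And>x. 0 \<le> n x" and d: "\<And>x y. 0 \<le> d x y"
  shows "growth_Lip n d \<phi> \<longleftrightarrow> (\<exists>C>0. \<exists>k::nat. \<forall>x y. \<bar>\<phi> x - \<phi> y\<bar> \<le> C * (1 + n x ^ k + n y ^ k) * d x y)"
proof
  assume "growth_Lip n d \<phi>"
  then obtain C k where C: "C \<ge> 0" and b: "\<And>x y. \<bar>\<phi> x - \<phi> y\<bar> \<le> C * (1 + n x + n y) ^ k * d x y"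
    unfolding growth_Lip_def by meson
  have "\<bar>\<phi> x - \<phi> y\<bar> \<le> (C * 3 ^ k + 1) * (1 + n x ^ k + n y ^ k) * d x y" for x y
  proof -
    have "C * (1 + n x + n y) ^ k \<le> C * (3 ^ k * (1 + n x ^ k + n y ^ k))"
      using power_sum_le[OF n n] C by (rule mult_left_mono)
    also have "\<dots> \<le> (C * 3 ^ k + 1) * (1 + n x ^ k + n y ^ k)"
      using n by (simp add: algebra_simps)
    finally have "C * (1 + n x + n y) ^ k * d x y \<le> (C * 3 ^ k + 1) * (1 + n x ^ k + n y ^ k) * d x y"
      using d by (rule mult_right_mono)
    then show ?thesis using b[of x y] by simp
  qed
  moreover have "C * 3 ^ k + 1 > 0" using C by (simp add: add_nonneg_pos)
  ultimately show "\<exists>C>0. \<exists>k::nat. \<forall>x y. \<bar>\<phi> x - \<phi> y\<bar> \<le> C * (1 + n x ^ k + n y ^ k) * d x y" by blast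
next
  assume "\<exists>C>0. \<exists>k::nat. \<forall>x y. \<bar>\<phi> x - \<phi> y\<bar> \<le> C * (1 + n x ^ k + n y ^ k) * d x y"
  then obtain C k where C: "C > 0" and b: "\<And>x y. \<bar>\<phi> x - \<phi> y\<bar> \<le> C * (1 + n x ^ k + n y ^ k) * d x y"
    by meson
  have "\<bar>\<phi> x - \<phi> y\<bar> \<le> (C * 3) * (1 + n x + n y) ^ k * d x y" for x y
  proof -
    have "C * (1 + n x ^ k + n y ^ k) * d x y \<le> C * (3 * (1 + n x + n y) ^ k) * d x y"
      using one_plus_powers_le[OF n n] C d by (intro mult_right_mono mult_left_mono) auto
    then show ?thesis using b[of x y] by simp
  qed
  then show "growth_Lip n d \<phi>" using C unfolding growth_Lip_def by (intro exI[of _ "C * 3"]) auto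
qed

lemma cl_Lip_iff: "cl_Lip \<phi> \<longleftrightarrow> growth_Lip norm (\<lambda>x y. norm (x - y)) \<phi>"
  unfolding cl_Lip_def by (subst growth_Lip_iff) auto

lemma cl_Lip_dim_iff:
  "cl_Lip_dim m \<phi> \<longleftrightarrow> growth_Lip (\<lambda>x. L2_set x {..<m}) (\<lambda>x y. L2_set (\<lambda>i. x i - y i) {..<m}) \<phi>"
  unfolding cl_Lip_dim_def by (subst growth_Lip_iff) auto

lemma cl_LipI:
  fixes \<phi> :: "'a::euclidean_space \<Rightarrow> real"
  assumes "\<And>x y. \<bar>\<phi> x - \<phi> y\<bar> \<le> C * (1 + norm x + norm y) ^ k * norm (x - y)"
  shows "cl_Lip \<phi>"
  unfolding cl_Lip_iff growth_Lip_def
proof (intro exI conjI allI)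
  fix x y :: 'a
  have "C * (1 + norm x + norm y) ^ k * norm (x - y) \<le> \<bar>C\<bar> * (1 + norm x + norm y) ^ k * norm (x - y)"
    by (intro mult_right_mono) auto
  then show "\<bar>\<phi> x - \<phi> y\<bar> \<le> \<bar>C\<bar> * (1 + norm x + norm y) ^ k * norm (x - y)"
    using assms order_trans by blast
qed simp

lemma cl_LipE:
  assumes "cl_Lip \<phi>"
  obtains C k where "C \<ge> 0" and "\<And>x y. \<bar>\<phi> x - \<phi> y\<bar> \<le> C * (1 + norm x + norm y) ^ k * norm (x - y)"
  using assms unfolding cl_Lip_iff growth_Lip_def by meson

lemma cl_Lip_Lipschitz:
  assumes "\<And>x y. \<bar>\<phi> x - \<phi> y\<bar> \<le> C * norm (x - y)"
  shows "cl_Lip \<phi>"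
  by (rule cl_LipI[of _ C 0]) (simp add: assms)

text \<open>If \<open>F\<close> grows polynomially, so does the weight along \<open>F\<close>, and
  the exponents combine to \<open>l * r + k\<close>. Norm and distance are parameters, so that the
  lemma serves vectors as well as sequences of numbered variables.\<close>

lemma growth_Lip_compose:
  assumes \<phi>: "growth_Lip n' d' \<phi>"
    and n: "\<And>x. 0 \<le> n x" and d: "\<And>x y. 0 \<le> d x y" and n': "\<And>x. 0 \<le> n' x"
    and F: "\<And>x y. d' (F x) (F y) \<le> A * (1 + n x + n y) ^ k * d x y"
    and Fn: "\<And>x. n' (F x) \<le> B * (1 + n x) ^ l"
  shows "growth_Lip n d (\<lambda>x. \<phi> (F x))"
proof -
  obtain C r where C: "C \<ge> 0" and b: "\<And>x y. \<bar>\<phi> x - \<phi> y\<bar> \<le> C * (1 + n' x + n' y) ^ r * d' x y"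
    using \<phi> unfolding growth_Lip_def by meson
  define B' where "B' = 1 + 2 * \<bar>B\<bar>"
  have B': "B' \<ge> 0" by (simp add: B'_def)
  have "\<bar>\<phi> (F x) - \<phi> (F y)\<bar> \<le> (C * B' ^ r * \<bar>A\<bar>) * (1 + n x + n y) ^ (l * r + k) * d x y" for x y
  proof -
    define R where "R = 1 + n x + n y"
    have R: "1 \<le> R" using n by (simp add: R_def)
    have nF: "n' (F z) \<le> \<bar>B\<bar> * R ^ l" if "z = x \<or> z = y" for z
    proof -
      have "B * (1 + n z) ^ l \<le> \<bar>B\<bar> * R ^ l"
        using n[of x] n[of y] that by (intro mult_mono power_mono) (auto simp: R_def)
      then show ?thesis using Fn[of z] by simp
    qed
    have "1 + n' (F x) + n' (F y) \<le> R ^ l + \<bar>B\<bar> * R ^ l + \<bar>B\<bar> * R ^ l"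
      using nF[OF disjI1[OF refl]] nF[OF disjI2[OF refl]] one_le_power[OF R, of l] by linarith
    also have "\<dots> = B' * R ^ l" by (simp add: B'_def algebra_simps)
    finally have "(1 + n' (F x) + n' (F y)) ^ r \<le> (B' * R ^ l) ^ r" using n' by (intro power_mono) auto
    moreover have "d' (F x) (F y) \<le> \<bar>A\<bar> * R ^ k * d x y"
    proof -
      have "A * R ^ k * d x y \<le> \<bar>A\<bar> * R ^ k * d x y" using R d by (intro mult_right_mono) auto
      then show ?thesis using F[of x y] by (simp add: R_def)
    qed
    ultimately have "C * (1 + n' (F x) + n' (F y)) ^ r * d' (F x) (F y) \<le> C * (B' * R ^ l) ^ r * (\<bar>A\<bar> * R ^ k * d x y)"
    proof -
      assume 1: "(1 + n' (F x) + n' (F y)) ^ r \<le> (B' * R ^ l) ^ r" and 2: "d' (F x) (F y) \<le> \<bar>A\<bar> * R ^ k * d x y"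
      have "C * (1 + n' (F x) + n' (F y)) ^ r * d' (F x) (F y) \<le> C * (1 + n' (F x) + n' (F y)) ^ r * (\<bar>A\<bar> * R ^ k * d x y)"
        using C n' 2 by (intro mult_left_mono) auto
      also have "\<dots> \<le> C * (B' * R ^ l) ^ r * (\<bar>A\<bar> * R ^ k * d x y)"
        using C R d 1 by (intro mult_right_mono mult_left_mono) auto
      finally show ?thesis .
    qed
    also have "\<dots> = (C * B' ^ r * \<bar>A\<bar>) * R ^ (l * r + k) * d x y"
      by (simp add: power_mult_distrib power_add power_mult mult_ac)
    finally show ?thesis using b[of "F x" "F y"] by (simp add: R_def)
  qed
  moreover have "C * B' ^ r * \<bar>A\<bar> \<ge> 0" using C B' by simp
  ultimately show ?thesis unfolding growth_Lip_def by blast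
qed

lemma cl_Lip_compose:
  fixes f :: "'b::euclidean_space \<Rightarrow> 'a::euclidean_space"
  assumes "cl_Lip \<phi>" and f: "\<And>x y. norm (f x - f y) \<le> c * norm (x - y)"
  shows "cl_Lip (\<lambda>x. \<phi> (f x))"
  unfolding cl_Lip_iff
proof (rule growth_Lip_compose[OF assms(1)[unfolded cl_Lip_iff], of _ _ _ c 0 "norm (f 0) + \<bar>c\<bar>" 1])
  fix x
  have "norm (f x) \<le> norm (f 0) + c * norm x"
    using f[of x 0] norm_triangle_sub[of "f x" "f 0"] by simp
  also have "\<dots> \<le> norm (f 0) + \<bar>c\<bar> * norm x" by (simp add: mult_right_mono)
  also have "\<dots> \<le> (norm (f 0) + \<bar>c\<bar>) * (1 + norm x) ^ 1"
    by (simp add: algebra_simps)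
  finally show "norm (f x) \<le> (norm (f 0) + \<bar>c\<bar>) * (1 + norm x) ^ 1" .
qed (use f in auto)

lemma one_plus_power_diff:
  fixes a b :: real
  assumes "0 \<le> a" and "0 \<le> b"
  shows "\<bar>(1 + a) ^ k - (1 + b) ^ k\<bar> \<le> real k * (1 + a + b) ^ k * \<bar>a - b\<bar>"
proof (induction k)
  case (Suc k)
  have "(1 + a) ^ Suc k - (1 + b) ^ Suc k = (1 + a) * ((1 + a) ^ k - (1 + b) ^ k) + (1 + b) ^ k * (a - b)"
    by (simp add: algebra_simps)
  also have "\<bar>\<dots>\<bar> \<le> (1 + a) * \<bar>(1 + a) ^ k - (1 + b) ^ k\<bar> + (1 + b) ^ k * \<bar>a - b\<bar>"
    using assms by (intro order_trans[OF abs_triangle_ineq]) (simp add: abs_mult)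
  also have "\<dots> \<le> (1 + a + b) * (real k * (1 + a + b) ^ k * \<bar>a - b\<bar>) + (1 + a + b) ^ Suc k * \<bar>a - b\<bar>"
  proof (rule add_mono[OF mult_mono[OF _ Suc.IH] mult_right_mono])
    have "(1 + b) ^ k \<le> (1 + a + b) ^ k" using assms by (intro power_mono) auto
    also have "\<dots> \<le> (1 + a + b) ^ Suc k" using assms by (intro power_increasing) auto
    finally show "(1 + b) ^ k \<le> (1 + a + b) ^ Suc k" .
  qed (use assms in auto)
  also have "\<dots> = real (Suc k) * (1 + a + b) ^ Suc k * \<bar>a - b\<bar>" by (simp add: algebra_simps)
  finally show ?case .
qed simp

lemma cl_Lip_weight: "cl_Lip (\<lambda>x :: 'a::euclidean_space. (1 + norm x) ^ k)"
proof (rule cl_LipI[of _ "real k" k])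
  fix x y :: 'a
  have "\<bar>(1 + norm x) ^ k - (1 + norm y) ^ k\<bar> \<le> real k * (1 + norm x + norm y) ^ k * \<bar>norm x - norm y\<bar>"
    by (rule one_plus_power_diff) auto
  also have "\<dots> \<le> real k * (1 + norm x + norm y) ^ k * norm (x - y)"
    by (intro mult_left_mono norm_triangle_ineq3) auto
  finally show "\<bar>(1 + norm x) ^ k - (1 + norm y) ^ k\<bar> \<le> real k * (1 + norm x + norm y) ^ k * norm (x - y)" .
qed

lemma cl_Lip_inner: "cl_Lip (\<lambda>x. p \<bullet> x)"
  by (rule cl_Lip_Lipschitz[of _ "norm p"]) (metis Cauchy_Schwarz_ineq2 inner_diff_right)

lemma cl_Lip_quadratic: "cl_Lip (\<lambda>x. (A *v x) \<bullet> x)" for A :: "real ^ 'd ^ 'd"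
proof (rule cl_LipI[of _ "onorm (\<lambda>x. A *v x)" 1])
  fix x y :: "real ^ 'd"
  define c where "c = onorm (\<lambda>x. A *v x)"
  have bl: "bounded_linear (\<lambda>x. A *v x)" by (rule matrix_vector_mul_bounded_linear)
  have c: "norm (A *v z) \<le> c * norm z" for z unfolding c_def by (rule onorm[OF bl])
  have c0: "c \<ge> 0" unfolding c_def by (rule onorm_pos_le[OF bl])
  have "(A *v x) \<bullet> x - (A *v y) \<bullet> y = (A *v (x - y)) \<bullet> x + (A *v y) \<bullet> (x - y)"
    by (simp add: matrix_vector_mult_diff_distrib inner_diff_left inner_diff_right)
  also have "\<bar>\<dots>\<bar> \<le> \<bar>(A *v (x - y)) \<bullet> x\<bar> + \<bar>(A *v y) \<bullet> (x - y)\<bar>" by (rule abs_triangle_ineq)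
  also have "\<dots> \<le> norm (A *v (x - y)) * norm x + norm (A *v y) * norm (x - y)"
    by (intro add_mono Cauchy_Schwarz_ineq2)
  also have "\<dots> \<le> (c * norm (x - y)) * norm x + (c * norm y) * norm (x - y)"
    by (intro add_mono mult_right_mono c) auto
  also have "\<dots> \<le> c * (1 + norm x + norm y) ^ 1 * norm (x - y)"
    using c0 by (simp add: algebra_simps)
  finally show "\<bar>(A *v x) \<bullet> x - (A *v y) \<bullet> y\<bar> \<le> onorm (\<lambda>x. A *v x) * (1 + norm x + norm y) ^ 1 * norm (x - y)"
    by (simp add: c_def)
qed

text \<open>Enumerating the coordinates by \<open>b\<close> is an isometry, so the constants carry
  over. The closure of \<open>H\<close> is stated for numbered variables; this makes it available
  for vectors.\<close>

lemma cl_Lip_dim_of_cl_Lip: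
  fixes \<phi> :: "real ^ 'd \<Rightarrow> real"
  assumes "cl_Lip \<phi>" and b: "bij_betw b {..<m} (UNIV :: 'd set)"
  shows "cl_Lip_dim m (\<lambda>z. \<phi> (\<chi> i. z (inv_into {..<m} b i)))"
proof -
  define v where "v z = (\<chi> i. z (inv_into {..<m} b i))" for z :: "nat \<Rightarrow> real"
  have nv: "norm (v z) = L2_set z {..<m}" for z
  proof -
    have "(\<Sum>i\<in>UNIV. (z (inv_into {..<m} b i))\<^sup>2) = (\<Sum>j<m. (z (inv_into {..<m} b (b j)))\<^sup>2)"
      by (rule sum.reindex_bij_betw[OF b, symmetric])
    also have "\<dots> = (\<Sum>j<m. (z j)\<^sup>2)"
      using b by (intro sum.cong) (auto simp: bij_betw_def inv_into_f_f)
    finally show ?thesis by (simp add: norm_vec_def L2_set_def v_def)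
  qed
  have dv: "norm (v y - v z) = L2_set (\<lambda>i. y i - z i) {..<m}" for y z
  proof -
    have "v y - v z = v (\<lambda>i. y i - z i)" by (simp add: v_def vec_eq_iff)
    then show ?thesis by (simp add: nv)
  qed
  obtain C k where C: "C \<ge> 0" and b: "\<And>x y. \<bar>\<phi> x - \<phi> y\<bar> \<le> C * (1 + norm x + norm y) ^ k * norm (x - y)"
    by (rule cl_LipE[OF assms(1)]) (rule that)
  have "growth_Lip (\<lambda>x. L2_set x {..<m}) (\<lambda>x y. L2_set (\<lambda>i. x i - y i) {..<m}) (\<lambda>z. \<phi> (v z))"
    unfolding growth_Lip_def
    using C b[of "v x" "v y" for x y, unfolded nv dv] by (intro exI[of _ C] conjI exI[of _ k] allI)
  then show ?thesis by (simp add: cl_Lip_dim_iff v_def)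
qed

section \<open>The conjugate expectation and moments\<close>

context superlinear_expectation_space
begin

lemma const_in: "(\<lambda>_. c) \<in> H"
proof -
  \<comment> \<open>A constant is a function of zero variables.\<close>
  have "cl_Lip_dim 0 (\<lambda>_. c)" by (auto simp: cl_Lip_dim_def intro!: exI[of _ 1])
  from comp_in[OF this, of undefined] show ?thesis by simp
qed

lemma minus_in: "X \<in> H \<Longrightarrow> (\<lambda>\<omega>. - X \<omega>) \<in> H"
  using scale_in[of X "-1"] by simp

lemma cl_Lip_in:
  fixes X :: "'w \<Rightarrow> real ^ 'd"
  assumes "random_vector H X" and "cl_Lip \<phi>"
  shows "(\<lambda>\<omega>. \<phi> (X \<omega>)) \<in> H"
proof -
  obtain b where b: "bij_betw b {..<CARD('d)} (UNIV :: 'd set)"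
    using ex_bij_betw_nat_finite[OF finite_class.finite_UNIV[where ?'a = 'd]] unfolding atLeast0LessThan by blast
  have "(\<lambda>\<omega>. (\<lambda>z. \<phi> (\<chi> i. z (inv_into {..<CARD('d)} b i))) (\<lambda>j. X \<omega> $ b j)) \<in> H"
    by (rule comp_in[OF cl_Lip_dim_of_cl_Lip[OF assms(2) b]]) (use assms(1) in \<open>simp add: random_vector_def\<close>)
  moreover have "b (inv_into {..<CARD('d)} b i) = i" for i
    using b by (simp add: bij_betw_inv_into_right)
  ultimately show ?thesis by (simp add: vec_nth_inverse)
qed

text \<open>The conjugate sublinear expectation. Superadditivity bounds \<open>E\<close> of a sum
  from below only; estimates from above pass through \<open>upper\<close>.\<close>

definition upper :: "('w \<Rightarrow> real) \<Rightarrow> real" where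
  "upper Z = - E (\<lambda>\<omega>. - Z \<omega>)"

lemma upper_mono: "X \<in> H \<Longrightarrow> Y \<in> H \<Longrightarrow> (\<And>\<omega>. X \<omega> \<le> Y \<omega>) \<Longrightarrow> upper X \<le> upper Y"
  unfolding upper_def using mono[OF minus_in minus_in] by simp

lemma upper_scale: "0 \<le> c \<Longrightarrow> X \<in> H \<Longrightarrow> upper (\<lambda>\<omega>. c * X \<omega>) = c * upper X"
  unfolding upper_def using pos_homogeneous[OF _ minus_in, of c X] by simp

lemma upper_const: "upper (\<lambda>_. c) = c"
  by (simp add: upper_def const)

lemma upper_nonneg: "X \<in> H \<Longrightarrow> (\<And>\<omega>. 0 \<le> X \<omega>) \<Longrightarrow> 0 \<le> upper X"
  using upper_mono[OF const_in, of X 0] by (simp add: upper_const)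

text \<open>Superadditivity, applied to the summands X + Y and - Y.\<close>

lemma E_add_le: "X \<in> H \<Longrightarrow> Y \<in> H \<Longrightarrow> E (\<lambda>\<omega>. X \<omega> + Y \<omega>) \<le> E X + upper Y"
  unfolding upper_def using superadd[OF add_in minus_in, of X Y Y] by simp

lemma E_add_const: "X \<in> H \<Longrightarrow> E (\<lambda>\<omega>. c + X \<omega>) = c + E X"
  using superadd[OF const_in, of X c] superadd[OF const_in add_in[OF const_in], of X "- c" c]
  by (simp add: const)

lemma abs_E_diff_le:
  assumes "X \<in> H" "Y \<in> H" "Z \<in> H" "\<And>\<omega>. \<bar>X \<omega> - Y \<omega>\<bar> \<le> Z \<omega>"
  shows "\<bar>E X - E Y\<bar> \<le> upper Z"
proof -
  have "E X \<le> E (\<lambda>\<omega>. Y \<omega> + Z \<omega>)" using assms by (intro mono add_in) (auto simp: abs_le_iff algebra_simps)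
  moreover have "E Y \<le> E (\<lambda>\<omega>. X \<omega> + Z \<omega>)" using assms by (intro mono add_in) (auto simp: abs_le_iff algebra_simps)
  ultimately show ?thesis using E_add_le[of Y Z] E_add_le[of X Z] assms by linarith
qed

lemma abs_E_diff_le_const:
  assumes "X \<in> H" "Y \<in> H" "\<And>\<omega>. \<bar>X \<omega> - Y \<omega>\<bar> \<le> c"
  shows "\<bar>E X - E Y\<bar> \<le> c"
  using abs_E_diff_le[OF assms(1,2) const_in assms(3)] by (simp add: upper_const)

definition moment :: "('w \<Rightarrow> real ^ 'd) \<Rightarrow> nat \<Rightarrow> real" where
  "moment X k = upper (\<lambda>\<omega>. (1 + norm (X \<omega>)) ^ k)"

lemma moment_nonneg: "random_vector H X \<Longrightarrow> 0 \<le> moment X k"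
  unfolding moment_def by (intro upper_nonneg cl_Lip_in cl_Lip_weight) auto

lemma abs_E_diff_le_moment:
  fixes X :: "'w \<Rightarrow> real ^ 'd"
  assumes X: "random_vector H X" and "Y \<in> H" "Z \<in> H" and c: "0 \<le> c"
    and "\<And>\<omega>. \<bar>Y \<omega> - Z \<omega>\<bar> \<le> c * (1 + norm (X \<omega>)) ^ k"
  shows "\<bar>E Y - E Z\<bar> \<le> c * moment X k"
  unfolding moment_def using assms cl_Lip_in[OF X cl_Lip_weight, of k]
  by (subst upper_scale[symmetric]) (auto intro!: abs_E_diff_le scale_in)

end

text \<open>The operator \<open>P\<^sub>t\<close> of the overview; \<open>\<phi>\<close> precedes
  \<open>t\<close> so that \<open>evolution E X \<phi>\<close> is the candidate solution as a
  function of time and space.\<close>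

definition evolution ::
  "(('w \<Rightarrow> real) \<Rightarrow> real) \<Rightarrow> ('w \<Rightarrow> real ^ 'd) \<Rightarrow> (real ^ 'd \<Rightarrow> real) \<Rightarrow> real \<Rightarrow> real ^ 'd \<Rightarrow> real" where
  "evolution E X \<phi> t x = E (\<lambda>\<omega>. \<phi> (x + sqrt t *\<^sub>R X \<omega>))"

lemma cl_Lip_affine: "cl_Lip \<phi> \<Longrightarrow> cl_Lip (\<lambda>z. \<phi> (x + c *\<^sub>R z))"
  by (rule cl_Lip_compose[of \<phi> _ "\<bar>c\<bar>"]) (auto simp: scaleR_diff_right[symmetric])

context superlinear_expectation_space
begin

lemma affine_in: "random_vector H X \<Longrightarrow> cl_Lip \<phi> \<Longrightarrow> (\<lambda>\<omega>. \<phi> (x + c *\<^sub>R X \<omega>)) \<in> H"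
  using cl_Lip_in[OF _ cl_Lip_affine] by blast

text \<open>The weight at x + sqrt t X and y + sqrt s X is at most 1 + |x| + |y| + sqrt t + sqrt s
  times 1 + |X|, so taking expectations leaves a moment. The modulus in time is one in sqrt t, valid
  up to t = 0.\<close>

lemma evolution_modulus:
  fixes X :: "'w \<Rightarrow> real ^ 'd"
  assumes X: "random_vector H X" and \<phi>: "cl_Lip \<phi>"
  obtains C k where "C \<ge> 0" and "\<And>s t x y. s \<ge> 0 \<Longrightarrow> t \<ge> 0 \<Longrightarrow>
     \<bar>evolution E X \<phi> t x - evolution E X \<phi> s y\<bar>
       \<le> C * (1 + norm x + norm y + sqrt t + sqrt s) ^ k * (norm (x - y) + \<bar>sqrt t - sqrt s\<bar>)"
proof -
  obtain C k where C: "C \<ge> 0" and b: "\<And>x y. \<bar>\<phi> x - \<phi> y\<bar> \<le> C * (1 + norm x + norm y) ^ k * norm (x - y)"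
    by (rule cl_LipE[OF \<phi>]) (rule that)
  have "\<bar>evolution E X \<phi> t x - evolution E X \<phi> s y\<bar>
       \<le> (C * (1 + norm x + norm y + sqrt t + sqrt s) ^ k * (norm (x - y) + \<bar>sqrt t - sqrt s\<bar>)) * moment X (Suc k)"
    if st: "s \<ge> 0" "t \<ge> 0" for s t x y
    unfolding evolution_def
  proof (intro abs_E_diff_le_moment X affine_in \<phi>)
    define R where "R = 1 + norm x + norm y + sqrt t + sqrt s"
    have R: "R \<ge> 0" using st by (simp add: R_def)
    show "0 \<le> C * (1 + norm x + norm y + sqrt t + sqrt s) ^ k * (norm (x - y) + \<bar>sqrt t - sqrt s\<bar>)"
      using C st by simp
    fix \<omega>
    define z where "z = norm (X \<omega>)"
    have z: "z \<ge> 0" by (simp add: z_def)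
    have "norm (x + sqrt t *\<^sub>R X \<omega>) \<le> norm x + sqrt t * z" "norm (y + sqrt s *\<^sub>R X \<omega>) \<le> norm y + sqrt s * z"
      using st norm_triangle_ineq[of x "sqrt t *\<^sub>R X \<omega>"] norm_triangle_ineq[of y "sqrt s *\<^sub>R X \<omega>"] by (auto simp: z_def)
    then have "1 + norm (x + sqrt t *\<^sub>R X \<omega>) + norm (y + sqrt s *\<^sub>R X \<omega>) \<le> 1 + norm x + norm y + (sqrt t + sqrt s) * z"
      by (simp add: algebra_simps)
    also have "\<dots> \<le> R * (1 + z)"
      unfolding R_def using st z by (simp add: algebra_simps)
    finally have p: "(1 + norm (x + sqrt t *\<^sub>R X \<omega>) + norm (y + sqrt s *\<^sub>R X \<omega>)) ^ k \<le> (R * (1 + z)) ^ k"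
      by (intro power_mono) auto
    have eq: "(x + sqrt t *\<^sub>R X \<omega>) - (y + sqrt s *\<^sub>R X \<omega>) = (x - y) + (sqrt t - sqrt s) *\<^sub>R X \<omega>"
      by (simp add: algebra_simps)
    have "norm ((x + sqrt t *\<^sub>R X \<omega>) - (y + sqrt s *\<^sub>R X \<omega>)) \<le> norm (x - y) + \<bar>sqrt t - sqrt s\<bar> * z"
      using norm_triangle_ineq[of "x - y" "(sqrt t - sqrt s) *\<^sub>R X \<omega>"] by (simp only: eq z_def norm_scaleR)
    also have "\<dots> \<le> (norm (x - y) + \<bar>sqrt t - sqrt s\<bar>) * (1 + z)"
      using z by (simp add: algebra_simps)
    finally have n: "norm ((x + sqrt t *\<^sub>R X \<omega>) - (y + sqrt s *\<^sub>R X \<omega>)) \<le> (norm (x - y) + \<bar>sqrt t - sqrt s\<bar>) * (1 + z)" .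
    have "\<bar>\<phi> (x + sqrt t *\<^sub>R X \<omega>) - \<phi> (y + sqrt s *\<^sub>R X \<omega>)\<bar>
       \<le> C * (1 + norm (x + sqrt t *\<^sub>R X \<omega>) + norm (y + sqrt s *\<^sub>R X \<omega>)) ^ k * norm ((x + sqrt t *\<^sub>R X \<omega>) - (y + sqrt s *\<^sub>R X \<omega>))"
      by (rule b)
    also have "\<dots> \<le> C * (R * (1 + z)) ^ k * ((norm (x - y) + \<bar>sqrt t - sqrt s\<bar>) * (1 + z))"
      using C R z by (intro mult_mono mult_left_mono p n) auto
    also have "\<dots> = C * R ^ k * (norm (x - y) + \<bar>sqrt t - sqrt s\<bar>) * (1 + z) ^ Suc k"
      by (simp add: power_mult_distrib mult_ac)
    finally show "\<bar>\<phi> (x + sqrt t *\<^sub>R X \<omega>) - \<phi> (y + sqrt s *\<^sub>R X \<omega>)\<bar>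
       \<le> C * (1 + norm x + norm y + sqrt t + sqrt s) ^ k * (norm (x - y) + \<bar>sqrt t - sqrt s\<bar>) * (1 + norm (X \<omega>)) ^ Suc k"
      by (simp only: R_def z_def)
  qed
  then show ?thesis
    using C moment_nonneg[OF X, of "Suc k"]
    by (intro that[of "C * moment X (Suc k)" k]) (auto simp: mult_ac)
qed

lemma cl_Lip_evolution:
  fixes X :: "'w \<Rightarrow> real ^ 'd"
  assumes "random_vector H X" and "cl_Lip \<phi>" and t: "t \<ge> 0"
  shows "cl_Lip (evolution E X \<phi> t)"
proof -
  obtain C k where C: "C \<ge> 0" and b: "\<And>s t x y. s \<ge> 0 \<Longrightarrow> t \<ge> 0 \<Longrightarrow>
     \<bar>evolution E X \<phi> t x - evolution E X \<phi> s y\<bar>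
       \<le> C * (1 + norm x + norm y + sqrt t + sqrt s) ^ k * (norm (x - y) + \<bar>sqrt t - sqrt s\<bar>)"
    by (rule evolution_modulus[OF assms(1,2)]) (rule that)
  define A where "A = 1 + 2 * sqrt t"
  show ?thesis
  proof (rule cl_LipI[of _ "C * A ^ k" k])
    fix x y :: "real ^ 'd"
    have "1 + norm x + norm y + sqrt t + sqrt t \<le> A * (1 + norm x + norm y)"
      using t by (simp add: A_def algebra_simps)
    then have "(1 + norm x + norm y + sqrt t + sqrt t) ^ k \<le> (A * (1 + norm x + norm y)) ^ k"
      using t by (intro power_mono) auto
    then have "C * (1 + norm x + norm y + sqrt t + sqrt t) ^ k * norm (x - y) \<le> C * (A * (1 + norm x + norm y)) ^ k * norm (x - y)"
      using C by (intro mult_right_mono mult_left_mono) auto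
    then show "\<bar>evolution E X \<phi> t x - evolution E X \<phi> t y\<bar> \<le> C * A ^ k * (1 + norm x + norm y) ^ k * norm (x - y)"
      using b[OF t t, of x y] by (simp add: power_mult_distrib mult_ac)
  qed
qed

lemma continuous_on_evolution:
  fixes X :: "'w \<Rightarrow> real ^ 'd"
  assumes "random_vector H X" and "cl_Lip \<phi>"
  shows "continuous_on ({0..} \<times> UNIV) (\<lambda>(t, x). evolution E X \<phi> t x)"
proof -
  obtain C k where "C \<ge> 0" and b: "\<And>s t x y. s \<ge> 0 \<Longrightarrow> t \<ge> 0 \<Longrightarrow>
     \<bar>evolution E X \<phi> t x - evolution E X \<phi> s y\<bar>
       \<le> C * (1 + norm x + norm y + sqrt t + sqrt s) ^ k * (norm (x - y) + \<bar>sqrt t - sqrt s\<bar>)"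
    by (rule evolution_modulus[OF assms]) (rule that)
  show ?thesis
    unfolding continuous_on_def
  proof
    fix z :: "real \<times> (real ^ 'd)" assume z: "z \<in> {0..} \<times> UNIV"
    define bnd where "bnd w = C * (1 + norm (snd w) + norm (snd z) + sqrt (fst w) + sqrt (fst z)) ^ k
        * (norm (snd w - snd z) + \<bar>sqrt (fst w) - sqrt (fst z)\<bar>)" for w :: "real \<times> (real ^ 'd)"
    have "(bnd \<longlongrightarrow> bnd z) (at z within {0..} \<times> UNIV)"
      unfolding bnd_def[abs_def] by (intro tendsto_intros)
    moreover have "bnd z = 0" by (simp add: bnd_def)
    ultimately have lim: "(bnd \<longlongrightarrow> 0) (at z within {0..} \<times> UNIV)" by simp
    have "\<forall>\<^sub>F w in at z within {0..} \<times> UNIV. norm ((case w of (t, x) \<Rightarrow> evolution E X \<phi> t x) - (case z of (t, x) \<Rightarrow> evolution E X \<phi> t x)) \<le> bnd w"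
      unfolding eventually_at_filter
      using b z by (intro always_eventually) (auto simp: bnd_def case_prod_unfold)
    then have "((\<lambda>w. (case w of (t, x) \<Rightarrow> evolution E X \<phi> t x) - (case z of (t, x) \<Rightarrow> evolution E X \<phi> t x)) \<longlongrightarrow> 0) (at z within {0..} \<times> UNIV)"
      using lim by (rule Lim_null_comparison)
    then show "((\<lambda>(t, x). evolution E X \<phi> t x) \<longlongrightarrow> (case z of (t, x) \<Rightarrow> evolution E X \<phi> t x)) (at z within {0..} \<times> UNIV)"
      by (rule LIM_zero_cancel)
  qed
qed

end

section \<open>The product extension\<close>

lemma L2_set_diff_triangle: "L2_set f A \<le> L2_set g A + L2_set (\<lambda>i. f i - g i) A"
  using L2_set_triangle_ineq[of g "\<lambda>i. f i - g i" A] by simp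

lemma L2_set_abs_diff: "\<bar>L2_set f A - L2_set g A\<bar> \<le> L2_set (\<lambda>i. f i - g i) A"
  using L2_set_diff_triangle[of f A g] L2_set_diff_triangle[of g A f]
  by (simp add: L2_set_def power2_commute)

lemma cl_Lip_dim_coordinate_linear:
  "cl_Lip_dim 2 (\<lambda>x. x 0 + x 1)" "cl_Lip_dim 1 (\<lambda>x. c * x 0)"
proof -
  have co: "\<bar>z i\<bar> \<le> L2_set z {..<m}" if "i < m" for z :: "nat \<Rightarrow> real" and i m
    using member_le_L2_set[of "{..<m}" i "\<lambda>i. \<bar>z i\<bar>"] that by (simp add: L2_set_def)
  have "\<bar>x 0 + x 1 - (y 0 + y 1)\<bar> \<le> 2 * (1 + L2_set x {..<2} + L2_set y {..<2}) ^ 0 * L2_set (\<lambda>i. x i - y i) {..<2}"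
    for x y :: "nat \<Rightarrow> real"
    using co[of 0 2 "\<lambda>i. x i - y i"] co[of 1 2 "\<lambda>i. x i - y i"] by simp
  then show "cl_Lip_dim 2 (\<lambda>x. x 0 + x 1)"
    unfolding cl_Lip_dim_iff growth_Lip_def by (intro exI[of _ 2] conjI exI[of _ 0] allI) auto
  have "\<bar>c * x 0 - c * y 0\<bar> \<le> \<bar>c\<bar> * (1 + L2_set x {..<1} + L2_set y {..<1}) ^ 0 * L2_set (\<lambda>i. x i - y i) {..<1}"
    for x y :: "nat \<Rightarrow> real"
    using mult_left_mono[OF co[of 0 1 "\<lambda>i. x i - y i"], of "\<bar>c\<bar>"]
    by (simp add: abs_mult[symmetric] right_diff_distrib)
  then show "cl_Lip_dim 1 (\<lambda>x. c * x 0)"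
    unfolding cl_Lip_dim_iff growth_Lip_def by (intro exI[of _ "\<bar>c\<bar>"] conjI exI[of _ 0] allI) auto
qed

lemma cl_Lip_dim_weight: "cl_Lip_dim m (\<lambda>x. (1 + L2_set x {..<m}) ^ k)"
  unfolding cl_Lip_dim_iff growth_Lip_def
proof (intro exI[of _ "real k"] conjI exI[of _ k] allI)
  fix x y :: "nat \<Rightarrow> real"
  have "\<bar>(1 + L2_set x {..<m}) ^ k - (1 + L2_set y {..<m}) ^ k\<bar>
    \<le> real k * (1 + L2_set x {..<m} + L2_set y {..<m}) ^ k * \<bar>L2_set x {..<m} - L2_set y {..<m}\<bar>"
    by (rule one_plus_power_diff) auto
  also have "\<dots> \<le> real k * (1 + L2_set x {..<m} + L2_set y {..<m}) ^ k * L2_set (\<lambda>i. x i - y i) {..<m}"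
    by (intro mult_left_mono L2_set_abs_diff) auto
  finally show "\<bar>(1 + L2_set x {..<m}) ^ k - (1 + L2_set y {..<m}) ^ k\<bar>
    \<le> real k * (1 + L2_set x {..<m} + L2_set y {..<m}) ^ k * L2_set (\<lambda>i. x i - y i) {..<m}" .
qed simp

lemma cl_Lip_dim_depends:
  assumes "cl_Lip_dim m \<phi>" and "\<And>i. i < m \<Longrightarrow> x i = y i"
  shows "\<phi> x = \<phi> y"
proof -
  have "L2_set (\<lambda>i. x i - y i) {..<m} = 0" using assms(2) by (simp add: L2_set_def)
  moreover obtain C k where "\<bar>\<phi> x - \<phi> y\<bar>
     \<le> C * (1 + L2_set x {..<m} ^ k + L2_set y {..<m} ^ k) * L2_set (\<lambda>i. x i - y i) {..<m}"
    using assms(1) unfolding cl_Lip_dim_def by blast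
  ultimately show ?thesis by simp
qed

lemma L2_set_mono_index: "m \<le> n \<Longrightarrow> L2_set x {..<m} \<le> L2_set x {..<n :: nat}"
  unfolding L2_set_def by (intro real_sqrt_le_mono sum_mono2) auto

lemma cl_Lip_dim_mono:
  assumes "cl_Lip_dim m \<phi>" and "m \<le> n"
  shows "cl_Lip_dim n \<phi>"
  unfolding cl_Lip_dim_iff
proof (rule growth_Lip_compose[OF assms(1)[unfolded cl_Lip_dim_iff], of _ _ "\<lambda>x. x" 1 0 1 1])
  fix x :: "nat \<Rightarrow> real"
  show "L2_set x {..<m} \<le> 1 * (1 + L2_set x {..<n}) ^ 1"
    using L2_set_mono_index[OF assms(2), of x] by simp
qed (use L2_set_mono_index[OF assms(2)] in auto)

text \<open>Each inner function reads its own block of \<open>n\<close> consecutive variables, whose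
  norm is at most that of the whole sequence; the constants and exponents of the finitely many
  \<open>\<psi> i\<close> are replaced by their sums.\<close>

lemma cl_Lip_dim_concat:
  assumes \<phi>: "cl_Lip_dim m \<phi>" and \<psi>: "\<And>i. i < m \<Longrightarrow> cl_Lip_dim n (\<psi> i)"
  shows "cl_Lip_dim (m * n) (\<lambda>x. \<phi> (\<lambda>i. \<psi> i (\<lambda>j. x (i * n + j))))"
proof -
  define v where "v i x = (\<lambda>j. x (i * n + j))" for i and x :: "nat \<Rightarrow> real"
  have v: "L2_set (v i x) {..<n} \<le> L2_set x {..<m * n}" if "i < m" for i x
  proof -
    have "(\<Sum>j<n. (x (i * n + j))\<^sup>2) = (\<Sum>j\<in>(\<lambda>j. i * n + j) ` {..<n}. (x j)\<^sup>2)"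
      by (subst sum.reindex) (auto simp: inj_on_def)
    also have "\<dots> \<le> (\<Sum>j<m * n. (x j)\<^sup>2)"
    proof (rule sum_mono2)
      have "i * n + j < m * n" if "j < n" for j
      proof -
        have "i * n + j < Suc i * n" using that by simp
        also have "\<dots> \<le> m * n" using \<open>i < m\<close> by (intro mult_le_mono1) simp
        finally show ?thesis .
      qed
      then show "(\<lambda>j. i * n + j) ` {..<n} \<subseteq> {..<m * n}" by auto
    qed auto
    finally show ?thesis by (simp add: v_def L2_set_def real_sqrt_le_mono)
  qed
  have "\<forall>i. \<exists>C k. i < m \<longrightarrow> C \<ge> 0 \<and> (\<forall>x y. \<bar>\<psi> i x - \<psi> i y\<bar> \<le>
     C * (1 + L2_set x {..<n} + L2_set y {..<n}) ^ k * L2_set (\<lambda>j. x j - y j) {..<n})"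
    using \<psi> unfolding cl_Lip_dim_iff growth_Lip_def by meson
  then obtain C k where Ck: "\<And>i. i < m \<Longrightarrow> C i \<ge> 0 \<and> (\<forall>x y. \<bar>\<psi> i x - \<psi> i y\<bar> \<le>
     C i * (1 + L2_set x {..<n} + L2_set y {..<n}) ^ k i * L2_set (\<lambda>j. x j - y j) {..<n})"
    by metis
  define K where "K = (\<Sum>i<m. k i)"
  define A where "A = (\<Sum>i<m. C i)"
  have A: "A \<ge> 0" unfolding A_def using Ck by (intro sum_nonneg) auto
  define nr where "nr x = L2_set x {..<m * n}" for x
  have nr0: "nr x \<ge> 0" for x by (simp add: nr_def)
  define F where "F x = (\<lambda>i. \<psi> i (v i x))" for x
  have dF: "L2_set (\<lambda>i. F x i - F y i) {..<m} \<le> A * (1 + nr x + nr y) ^ K * nr (\<lambda>j. x j - y j)" for x y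
  proof -
    have "L2_set (\<lambda>i. F x i - F y i) {..<m} \<le> (\<Sum>i<m. \<bar>F x i - F y i\<bar>)" by (rule L2_set_le_sum_abs)
    also have "\<dots> \<le> (\<Sum>i<m. C i * ((1 + nr x + nr y) ^ K * nr (\<lambda>j. x j - y j)))"
    proof (rule sum_mono)
      fix i assume "i \<in> {..<m}"
      then have i: "i < m" by simp
      have C0: "C i \<ge> 0" using Ck[OF i] by blast
      have "\<bar>F x i - F y i\<bar> \<le> C i * (1 + L2_set (v i x) {..<n} + L2_set (v i y) {..<n}) ^ k i * L2_set (\<lambda>j. v i x j - v i y j) {..<n}"
        unfolding F_def using Ck[OF i] by blast
      also have "\<dots> \<le> C i * (1 + nr x + nr y) ^ K * nr (\<lambda>j. x j - y j)"
      proof (intro mult_mono mult_left_mono)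
        have "(1 + L2_set (v i x) {..<n} + L2_set (v i y) {..<n}) ^ k i \<le> (1 + nr x + nr y) ^ k i"
          using v[OF i] by (intro power_mono add_mono) (auto simp: nr_def)
        also have "\<dots> \<le> (1 + nr x + nr y) ^ K"
          using i nr0 unfolding K_def by (intro power_increasing member_le_sum) auto
        finally show "(1 + L2_set (v i x) {..<n} + L2_set (v i y) {..<n}) ^ k i \<le> (1 + nr x + nr y) ^ K" .
        show "L2_set (\<lambda>j. v i x j - v i y j) {..<n} \<le> nr (\<lambda>j. x j - y j)"
          using v[OF i, of "\<lambda>j. x j - y j"] by (simp add: v_def nr_def)
      qed (use C0 nr0 in auto)
      finally show "\<bar>F x i - F y i\<bar> \<le> C i * ((1 + nr x + nr y) ^ K * nr (\<lambda>j. x j - y j))" by (simp add: mult_ac)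
    qed
    finally show ?thesis by (simp only: A_def sum_distrib_right mult.assoc)
  qed
  have "growth_Lip nr (\<lambda>x y. nr (\<lambda>j. x j - y j)) (\<lambda>x. \<phi> (F x))"
  proof (rule growth_Lip_compose[OF \<phi>[unfolded cl_Lip_dim_iff], of _ _ _ A K "L2_set (F (\<lambda>_. 0)) {..<m} + A" "Suc K"])
    fix x
    have n0: "nr (\<lambda>_. 0) = 0" by (simp add: nr_def L2_set_def)
    have "L2_set (F x) {..<m} \<le> L2_set (F (\<lambda>_. 0)) {..<m} + L2_set (\<lambda>i. F x i - F (\<lambda>_. 0) i) {..<m}"
      by (rule L2_set_diff_triangle)
    also have "\<dots> \<le> L2_set (F (\<lambda>_. 0)) {..<m} * (1 + nr x) ^ Suc K + A * (1 + nr x) ^ Suc K"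
    proof (intro add_mono)
      have "1 \<le> (1 + nr x) ^ Suc K" using nr0 by (intro one_le_power) simp
      then show "L2_set (F (\<lambda>_. 0)) {..<m} \<le> L2_set (F (\<lambda>_. 0)) {..<m} * (1 + nr x) ^ Suc K"
        using mult_left_mono[of 1 "(1 + nr x) ^ Suc K" "L2_set (F (\<lambda>_. 0)) {..<m}"] by simp
      have "L2_set (\<lambda>i. F x i - F (\<lambda>_. 0) i) {..<m} \<le> A * (1 + nr x) ^ K * nr x"
        using dF[of x "\<lambda>_. 0"] by (simp add: n0)
      also have "\<dots> \<le> A * (1 + nr x) ^ K * (1 + nr x)" using A nr0 by (intro mult_left_mono) auto
      finally show "L2_set (\<lambda>i. F x i - F (\<lambda>_. 0) i) {..<m} \<le> A * (1 + nr x) ^ Suc K" by (simp add: mult_ac)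
    qed
    finally show "L2_set (F x) {..<m} \<le> (L2_set (F (\<lambda>_. 0)) {..<m} + A) * (1 + nr x) ^ Suc K"
      by (simp add: algebra_simps)
  qed (use dF nr0 in auto)
  then show ?thesis by (simp only: cl_Lip_dim_iff nr_def[abs_def] F_def v_def)
qed

context superlinear_expectation_space
begin

text \<open>The extension carrying the independent copy: functions of finitely many variables, each
  depending on one of the two sample points, with the iterated expectation.\<close>

definition prod_base :: "('w \<times> 'w \<Rightarrow> real) set" where
  "prod_base = {\<lambda>\<omega>. Z (fst \<omega>) | Z. Z \<in> H} \<union> {\<lambda>\<omega>. Z (snd \<omega>) | Z. Z \<in> H}"

definition prod_H :: "('w \<times> 'w \<Rightarrow> real) set" where
  "prod_H = {\<lambda>\<omega>. \<phi> (\<lambda>i. V i \<omega>) | m \<phi> V. cl_Lip_dim m \<phi> \<and> (\<forall>i<m. V i \<in> prod_base)}"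

text \<open>The inner expectation runs over the second sample point with the first one frozen. This
  order makes the second point independent of the first, in the sense of the non-symmetric relation
  \<open>independent_of\<close>.\<close>

definition prod_E :: "('w \<times> 'w \<Rightarrow> real) \<Rightarrow> real" where
  "prod_E \<xi> = E (\<lambda>\<omega>. E (\<lambda>\<omega>'. \<xi> (\<omega>, \<omega>')))"

lemma prod_base_in: "V \<in> prod_base \<Longrightarrow> V \<in> prod_H"
proof -
  assume V: "V \<in> prod_base"
  have "cl_Lip_dim 1 (\<lambda>x. 1 * x 0)" by (rule cl_Lip_dim_coordinate_linear)
  then have "cl_Lip_dim 1 (\<lambda>x. x 0)" by simp
  then have "\<exists>m \<phi> V'. V = (\<lambda>\<omega>. \<phi> (\<lambda>i. V' i \<omega>)) \<and> cl_Lip_dim m \<phi> \<and> (\<forall>i<m. V' i \<in> prod_base)"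
    using V by (intro exI[of _ 1] exI[of _ "\<lambda>x. x 0"] exI[of _ "\<lambda>_. V"]) simp
  then show ?thesis by (simp add: prod_H_def)
qed

text \<open>The \<open>\<xi> i\<close> may be represented with different numbers of variables. These
  are padded to a common length and laid out in consecutive blocks, so that the composition is again
  one function of finitely many members of \<open>prod_base\<close>.\<close>

lemma prod_H_comp:
  assumes \<phi>: "cl_Lip_dim m \<phi>" and \<xi>: "\<And>i. i < m \<Longrightarrow> \<xi> i \<in> prod_H"
  shows "(\<lambda>\<omega>. \<phi> (\<lambda>i. \<xi> i \<omega>)) \<in> prod_H"
proof -
  define Rep where "Rep \<eta> r \<longleftrightarrow> \<eta> = (\<lambda>\<omega>. fst (snd r) (\<lambda>j. snd (snd r) j \<omega>)) \<and> cl_Lip_dim (fst r) (fst (snd r))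
      \<and> (\<forall>j<fst r. snd (snd r) j \<in> prod_base)"
    for \<eta> and r :: "nat \<times> ((nat \<Rightarrow> real) \<Rightarrow> real) \<times> (nat \<Rightarrow> 'w \<times> 'w \<Rightarrow> real)"
  have "\<forall>i\<in>{..<m}. \<exists>r. Rep (\<xi> i) r"
  proof
    fix i assume "i \<in> {..<m}"
    then have "\<xi> i \<in> prod_H" using \<xi> by simp
    then obtain n \<psi> V where "\<xi> i = (\<lambda>\<omega>. \<psi> (\<lambda>j. V j \<omega>))" "cl_Lip_dim n \<psi>" "\<forall>j<n. V j \<in> prod_base"
      unfolding prod_H_def mem_Collect_eq by (elim exE conjE) (rule that)
    then have "Rep (\<xi> i) (n, \<psi>, V)" by (simp add: Rep_def)
    then show "\<exists>r. Rep (\<xi> i) r" by (rule exI)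
  qed
  then obtain r where "\<forall>i\<in>{..<m}. Rep (\<xi> i) (r i)" by (rule bchoice[THEN exE])
  then have r: "Rep (\<xi> i) (r i)" if "i < m" for i using that by simp
  define n where "n i = fst (r i)" for i
  define \<psi> where "\<psi> i = fst (snd (r i))" for i
  define V where "V i = snd (snd (r i))" for i
  have R: "\<xi> i = (\<lambda>\<omega>. \<psi> i (\<lambda>j. V i j \<omega>)) \<and> cl_Lip_dim (n i) (\<psi> i) \<and> (\<forall>j<n i. V i j \<in> prod_base)" if "i < m" for i
    using r[OF that] unfolding Rep_def n_def \<psi>_def V_def .
  have RV: "V i j \<in> prod_base" if "i < m" "j < n i" for i j using R[OF that(1)] that(2) by blast
  have RL: "cl_Lip_dim (n i) (\<psi> i)" if "i < m" for i using R[OF that] by blast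
  have R\<xi>: "\<xi> i \<omega> = \<psi> i (\<lambda>j. V i j \<omega>)" if "i < m" for i \<omega>
    using R[OF that, THEN conjunct1] by (rule fun_cong)
  \<comment> \<open>The successor keeps the block length positive, for division and remainder by
    \<open>k\<close>.\<close>
  define k where "k = Suc (\<Sum>i<m. n i)"
  have nk: "n i \<le> k" if "i < m" for i
    using member_le_sum[of i "{..<m}" n] that by (simp add: k_def)
  \<comment> \<open>Slots without a variable of their own hold the zero function, which belongs to
    \<open>prod_base\<close>.\<close>
  define U where "U l = (if l mod k < n (l div k) \<and> l div k < m then V (l div k) (l mod k) else (\<lambda>_. 0))" for l
  have zero: "(\<lambda>_. 0) \<in> prod_base" using zero_in unfolding prod_base_def by (intro UnI1 CollectI exI[of _ "\<lambda>_. 0"]) simp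
  have "U l \<in> prod_base" for l
    using RV[of "l div k" "l mod k"] zero by (simp add: U_def)
  moreover have "cl_Lip_dim (m * k) (\<lambda>x. \<phi> (\<lambda>i. \<psi> i (\<lambda>j. x (i * k + j))))"
    by (rule cl_Lip_dim_concat[OF \<phi> cl_Lip_dim_mono[OF RL nk]])
  moreover have "\<phi> (\<lambda>i. \<xi> i \<omega>) = \<phi> (\<lambda>i. \<psi> i (\<lambda>j. U (i * k + j) \<omega>))" for \<omega>
  proof (rule cl_Lip_dim_depends[OF \<phi>, of "\<lambda>i. \<xi> i \<omega>"])
    fix i assume i: "i < m"
    have "\<psi> i (\<lambda>j. V i j \<omega>) = \<psi> i (\<lambda>j. U (i * k + j) \<omega>)"
    proof (rule cl_Lip_dim_depends[of "n i" "\<psi> i" "\<lambda>j. V i j \<omega>"])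
      show "cl_Lip_dim (n i) (\<psi> i)" by (rule RL[OF i])
      fix j assume j: "j < n i"
      then have "j < k" using nk[OF i] by simp
      then have "(i * k + j) div k = i" "(i * k + j) mod k = j" by auto
      then show "V i j \<omega> = U (i * k + j) \<omega>" using i j by (simp add: U_def)
    qed
    then show "\<xi> i \<omega> = \<psi> i (\<lambda>j. U (i * k + j) \<omega>)" by (simp only: R\<xi>[OF i])
  qed
  ultimately have "\<exists>m' \<phi>' V'. (\<lambda>\<omega>. \<phi> (\<lambda>i. \<xi> i \<omega>)) = (\<lambda>\<omega>. \<phi>' (\<lambda>i. V' i \<omega>)) \<and> cl_Lip_dim m' \<phi>' \<and> (\<forall>i<m'. V' i \<in> prod_base)"
    by (intro exI[of _ "m * k"] exI[of _ "\<lambda>x. \<phi> (\<lambda>i. \<psi> i (\<lambda>j. x (i * k + j)))"] exI[of _ U]) simp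
  then show ?thesis by (simp add: prod_H_def)
qed

text \<open>In a section the variables of the first point are constants, hence again members of
  \<open>H\<close>. For the partial expectation, z \<mapsto> E[\<phi>(z, Z)] stays in the class: the
  weight splits into a factor in z and one in Z, and \<open>upper\<close> of the latter is a finite
  constant.\<close>

lemma prod_H_sections:
  assumes "\<xi> \<in> prod_H"
  shows "(\<lambda>\<omega>'. \<xi> (\<omega>, \<omega>')) \<in> H" and "(\<lambda>\<omega>. E (\<lambda>\<omega>'. \<xi> (\<omega>, \<omega>'))) \<in> H"
proof -
  obtain m \<phi> V where \<xi>: "\<xi> = (\<lambda>\<omega>. \<phi> (\<lambda>i. V i \<omega>))" and \<phi>: "cl_Lip_dim m \<phi>" and V: "\<And>i. i < m \<Longrightarrow> V i \<in> prod_base"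
  proof -
    have "\<exists>m \<phi> V. \<xi> = (\<lambda>\<omega>. \<phi> (\<lambda>i. V i \<omega>)) \<and> cl_Lip_dim m \<phi> \<and> (\<forall>i<m. V i \<in> prod_base)"
      using assms unfolding prod_H_def mem_Collect_eq .
    then show thesis by (elim exE conjE) (rule that, auto)
  qed
  have "\<forall>i. \<exists>Z b. i < m \<longrightarrow> Z \<in> H \<and> (\<forall>\<omega> \<omega>'. V i (\<omega>, \<omega>') = (if b then Z \<omega> else Z \<omega>'))"
  proof
    fix i
    show "\<exists>Z b. i < m \<longrightarrow> Z \<in> H \<and> (\<forall>\<omega> \<omega>'. V i (\<omega>, \<omega>') = (if b then Z \<omega> else Z \<omega>'))"
    proof (cases "i < m")
      case True
      from V[OF True] consider Z where "Z \<in> H" "V i = (\<lambda>\<omega>. Z (fst \<omega>))" | Z where "Z \<in> H" "V i = (\<lambda>\<omega>. Z (snd \<omega>))"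
        unfolding prod_base_def by blast
      then show ?thesis
      proof cases
        case 1
        then show ?thesis by (intro exI[of _ Z] exI[of _ True]) simp
      next
        case 2
        then show ?thesis by (intro exI[of _ Z] exI[of _ False]) simp
      qed
    qed simp
  qed
  then obtain Z b where Z: "\<And>i. i < m \<Longrightarrow> Z i \<in> H"
    and VZ: "\<And>i \<omega> \<omega>'. i < m \<Longrightarrow> V i (\<omega>, \<omega>') = (if b i then Z i \<omega> else Z i \<omega>')"
    by metis
  have \<xi>_eq: "\<xi> (\<omega>, \<omega>') = \<phi> (\<lambda>i. if b i then Z i \<omega> else Z i \<omega>')" for \<omega> \<omega>'
    unfolding \<xi> by (rule cl_Lip_dim_depends[OF \<phi>]) (rule VZ)
  have mem: "(\<lambda>\<omega>'. \<phi> (\<lambda>i. if b i then z i else Z i \<omega>')) \<in> H" for z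
  proof -
    have "(\<lambda>\<omega>'. \<phi> (\<lambda>i. (if b i then (\<lambda>_. z i) else Z i) \<omega>')) \<in> H"
      by (rule comp_in[OF \<phi>]) (simp add: const_in Z)
    moreover have "(if b i then (\<lambda>_. z i) else Z i) \<omega>' = (if b i then z i else Z i \<omega>')" for i \<omega>' by simp
    ultimately show ?thesis by (simp only:)
  qed
  then show "(\<lambda>\<omega>'. \<xi> (\<omega>, \<omega>')) \<in> H" unfolding \<xi>_eq .
  define \<psi> where "\<psi> z = E (\<lambda>\<omega>'. \<phi> (\<lambda>i. if b i then z i else Z i \<omega>'))" for z
  define nr where "nr x = L2_set x {..<m}" for x
  have nr0: "nr x \<ge> 0" for x by (simp add: nr_def)
  obtain C k where C: "C \<ge> 0" and Cb: "\<And>x y. \<bar>\<phi> x - \<phi> y\<bar> \<le> C * (1 + nr x + nr y) ^ k * nr (\<lambda>i. x i - y i)"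
    using \<phi> unfolding cl_Lip_dim_iff growth_Lip_def nr_def by meson
  define N where "N \<omega>' = nr (\<lambda>i. Z i \<omega>')" for \<omega>'
  have wt: "(\<lambda>\<omega>'. (1 + N \<omega>') ^ k) \<in> H"
    unfolding N_def nr_def by (rule comp_in[OF cl_Lip_dim_weight]) (rule Z)
  have "cl_Lip_dim m \<psi>"
    unfolding cl_Lip_dim_iff growth_Lip_def nr_def[symmetric]
  proof (intro exI[of _ "C * 2 ^ k * upper (\<lambda>\<omega>'. (1 + N \<omega>') ^ k)"] conjI exI[of _ k] allI)
    show "0 \<le> C * 2 ^ k * upper (\<lambda>\<omega>'. (1 + N \<omega>') ^ k)"
      using C nr0 wt by (auto intro!: mult_nonneg_nonneg upper_nonneg simp: N_def)
    fix x y
    have "\<bar>\<psi> x - \<psi> y\<bar> \<le> upper (\<lambda>\<omega>'. (C * 2 ^ k * (1 + nr x + nr y) ^ k * nr (\<lambda>i. x i - y i)) * (1 + N \<omega>') ^ k)"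
      unfolding \<psi>_def
    proof (intro abs_E_diff_le mem scale_in wt)
      fix \<omega>'
      define mg where "mg z = (\<lambda>i. if b i then z i else Z i \<omega>')" for z
      have N0: "N \<omega>' \<ge> 0" by (simp add: N_def nr0)
      have mgn: "nr (mg z) \<le> nr z + N \<omega>'" for z
      proof -
        have "nr (mg z) \<le> nr (\<lambda>i. \<bar>z i\<bar> + \<bar>Z i \<omega>'\<bar>)"
          unfolding nr_def L2_set_def by (intro real_sqrt_le_mono sum_mono) (auto simp: mg_def abs_le_square_iff[symmetric])
        also have "\<dots> \<le> nr (\<lambda>i. \<bar>z i\<bar>) + nr (\<lambda>i. \<bar>Z i \<omega>'\<bar>)" unfolding nr_def by (rule L2_set_triangle_ineq)
        finally show ?thesis by (simp add: nr_def N_def L2_set_def)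
      qed
      have mgd: "nr (\<lambda>i. mg x i - mg y i) \<le> nr (\<lambda>i. x i - y i)"
        unfolding nr_def L2_set_def by (intro real_sqrt_le_mono sum_mono) (auto simp: mg_def)
      have "1 + nr (mg x) + nr (mg y) \<le> 2 * (1 + nr x + nr y) * (1 + N \<omega>')"
      proof -
        have "1 + nr (mg x) + nr (mg y) \<le> 1 + nr x + nr y + 2 * N \<omega>'" using mgn[of x] mgn[of y] by linarith
        also have "\<dots> \<le> 2 * (1 + nr x + nr y) * (1 + N \<omega>')"
          using nr0[of x] nr0[of y] N0 by (simp add: algebra_simps)
        finally show ?thesis .
      qed
      then have p: "(1 + nr (mg x) + nr (mg y)) ^ k \<le> (2 * (1 + nr x + nr y) * (1 + N \<omega>')) ^ k"
        using nr0 by (intro power_mono) auto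
      have "\<bar>\<phi> (mg x) - \<phi> (mg y)\<bar> \<le> C * (1 + nr (mg x) + nr (mg y)) ^ k * nr (\<lambda>i. mg x i - mg y i)" by (rule Cb)
      also have "\<dots> \<le> C * (2 * (1 + nr x + nr y) * (1 + N \<omega>')) ^ k * nr (\<lambda>i. x i - y i)"
        using C nr0 N0 by (intro mult_mono mult_left_mono p mgd) auto
      also have "\<dots> = (C * 2 ^ k * (1 + nr x + nr y) ^ k * nr (\<lambda>i. x i - y i)) * (1 + N \<omega>') ^ k"
        by (simp only: power_mult_distrib mult_ac)
      finally show "\<bar>\<phi> (\<lambda>i. if b i then x i else Z i \<omega>') - \<phi> (\<lambda>i. if b i then y i else Z i \<omega>')\<bar>
        \<le> (C * 2 ^ k * (1 + nr x + nr y) ^ k * nr (\<lambda>i. x i - y i)) * (1 + N \<omega>') ^ k"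
        by (simp only: mg_def)
    qed
    also have "\<dots> = (C * 2 ^ k * (1 + nr x + nr y) ^ k * nr (\<lambda>i. x i - y i)) * upper (\<lambda>\<omega>'. (1 + N \<omega>') ^ k)"
      using C nr0 wt by (intro upper_scale) auto
    finally show "\<bar>\<psi> x - \<psi> y\<bar> \<le> C * 2 ^ k * upper (\<lambda>\<omega>'. (1 + N \<omega>') ^ k) * (1 + nr x + nr y) ^ k * nr (\<lambda>i. x i - y i)"
      by (simp add: mult_ac)
  qed
  then have "(\<lambda>\<omega>. \<psi> (\<lambda>i. Z i \<omega>)) \<in> H" by (rule comp_in) (rule Z)
  then show "(\<lambda>\<omega>. E (\<lambda>\<omega>'. \<xi> (\<omega>, \<omega>'))) \<in> H" unfolding \<xi>_eq \<psi>_def .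
qed

lemma prod_space: "superlinear_expectation_space prod_H prod_E"
proof
  have "cl_Lip_dim 0 (\<lambda>_. 0)" by (auto simp: cl_Lip_dim_def intro!: exI[of _ 1])
  from prod_H_comp[OF this, of undefined] show zero: "(\<lambda>_. 0) \<in> prod_H" by simp
  show add: "(\<lambda>\<omega>. \<xi> \<omega> + \<eta> \<omega>) \<in> prod_H" if "\<xi> \<in> prod_H" "\<eta> \<in> prod_H" for \<xi> \<eta>
    using prod_H_comp[OF cl_Lip_dim_coordinate_linear(1), of "\<lambda>i. if i = 0 then \<xi> else \<eta>"] that by simp
  show scale: "(\<lambda>\<omega>. c * \<xi> \<omega>) \<in> prod_H" if "\<xi> \<in> prod_H" for c \<xi>
    using prod_H_comp[OF cl_Lip_dim_coordinate_linear(2), of "\<lambda>_. \<xi>" c] that by simp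
  show "(\<lambda>\<omega>. \<phi> (\<lambda>i. \<xi> i \<omega>)) \<in> prod_H" if "cl_Lip_dim m \<phi>" "\<And>i. i < m \<Longrightarrow> \<xi> i \<in> prod_H" for m \<phi> \<xi>
    using that by (rule prod_H_comp)
  show "prod_E \<eta> \<le> prod_E \<xi>" if "\<xi> \<in> prod_H" "\<eta> \<in> prod_H" "\<And>\<omega>. \<eta> \<omega> \<le> \<xi> \<omega>" for \<xi> \<eta>
    unfolding prod_E_def using that by (intro mono prod_H_sections) auto
  show "prod_E (\<lambda>_. c) = c" for c by (simp add: prod_E_def const)
  show "prod_E \<xi> + prod_E \<eta> \<le> prod_E (\<lambda>\<omega>. \<xi> \<omega> + \<eta> \<omega>)" if \<xi>: "\<xi> \<in> prod_H" and \<eta>: "\<eta> \<in> prod_H" for \<xi> \<eta>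
  proof -
    have "prod_E \<xi> + prod_E \<eta> \<le> E (\<lambda>\<omega>. E (\<lambda>\<omega>'. \<xi> (\<omega>, \<omega>')) + E (\<lambda>\<omega>'. \<eta> (\<omega>, \<omega>')))"
      unfolding prod_E_def using \<xi> \<eta> by (intro superadd prod_H_sections)
    also have "\<dots> \<le> prod_E (\<lambda>\<omega>. \<xi> \<omega> + \<eta> \<omega>)"
      unfolding prod_E_def
      by (rule mono[OF prod_H_sections(2)[OF add[OF \<xi> \<eta>]] add_in[OF prod_H_sections(2)[OF \<xi>] prod_H_sections(2)[OF \<eta>]]])
         (rule superadd[OF prod_H_sections(1)[OF \<xi>] prod_H_sections(1)[OF \<eta>]])
    finally show ?thesis .
  qed
  show "prod_E (\<lambda>\<omega>. c * \<xi> \<omega>) = c * prod_E \<xi>" if "0 \<le> c" "\<xi> \<in> prod_H" for c \<xi>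
    unfolding prod_E_def using that by (simp add: pos_homogeneous prod_H_sections)
qed

lemma prod_extends: "extends_space prod_H prod_E H E"
  unfolding extends_space_def
proof (intro conjI ballI prod_space)
  fix Z assume "Z \<in> H"
  then show "(\<lambda>\<omega>. Z (fst \<omega>)) \<in> prod_H" by (intro prod_base_in) (auto simp: prod_base_def)
  show "prod_E (\<lambda>\<omega>. Z (fst \<omega>)) = E Z" by (simp add: prod_E_def const)
qed

text \<open>An expectation over a point that does not occur acts on a constant, so both sides of
  either condition reduce to the same expression.\<close>

lemma prod_independent_copy: "independent_copy prod_E (\<lambda>\<omega>. X (snd \<omega>)) (\<lambda>\<omega>. X (fst \<omega>))"
  by (simp add: independent_copy_def eq_dist_def independent_of_def prod_E_def const)

lemma prod_random_vector: "random_vector H X \<Longrightarrow> random_vector prod_H (\<lambda>\<omega>. X (snd \<omega>))"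
  unfolding random_vector_def
proof
  fix i assume "\<forall>i. (\<lambda>\<omega>. X \<omega> $ i) \<in> H"
  then show "(\<lambda>\<omega>. X (snd \<omega>) $ i) \<in> prod_H"
    by (intro prod_base_in, unfold prod_base_def) (intro UnI2 CollectI exI[of _ "\<lambda>\<omega>. X \<omega> $ i"], simp)
qed

end

section \<open>Normality implies the equation\<close>

lemma cl_Lip_affine_pair: "cl_Lip \<phi> \<Longrightarrow> cl_Lip (\<lambda>z. \<phi> (x + a *\<^sub>R fst z + b *\<^sub>R snd z))"
proof (rule cl_Lip_compose[of \<phi> _ "\<bar>a\<bar> + \<bar>b\<bar>"])
  fix y z :: "'a \<times> 'a"
  have "x + a *\<^sub>R fst y + b *\<^sub>R snd y - (x + a *\<^sub>R fst z + b *\<^sub>R snd z) = a *\<^sub>R fst (y - z) + b *\<^sub>R snd (y - z)"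
    by (simp add: algebra_simps)
  also have "norm \<dots> \<le> \<bar>a\<bar> * norm (fst (y - z)) + \<bar>b\<bar> * norm (snd (y - z))"
    using norm_triangle_ineq[of "a *\<^sub>R fst (y - z)" "b *\<^sub>R snd (y - z)"] by simp
  also have "\<dots> \<le> \<bar>a\<bar> * norm (y - z) + \<bar>b\<bar> * norm (y - z)"
  proof -
    have nw: "norm (fst w) \<le> norm w" "norm (snd w) \<le> norm w" for w :: "'a \<times> 'a"
      by (metis norm_fst_le prod.collapse) (metis norm_snd_le prod.collapse)
    show ?thesis by (intro add_mono mult_left_mono nw abs_ge_zero)
  qed
  finally show "norm (x + a *\<^sub>R fst y + b *\<^sub>R snd y - (x + a *\<^sub>R fst z + b *\<^sub>R snd z)) \<le> (\<bar>a\<bar> + \<bar>b\<bar>) * norm (y - z)"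
    by (simp add: algebra_simps)
qed

text \<open>The mean value theorem is applied along a segment to the function minus its quadratic
  polynomial; the derivative of this difference is small because the gradient is differentiable at
  \<open>x\<close>.\<close>

lemma second_order_Taylor_at:
  fixes f :: "real ^ 'd \<Rightarrow> real"
  assumes f: "\<And>y. (f has_derivative (\<lambda>h. p y \<bullet> h)) (at y)"
    and p: "(p has_derivative (\<lambda>h. S *v h)) (at x)" and \<epsilon>: "\<epsilon> > 0"
  shows "\<exists>r>0. \<forall>z. norm z < r \<longrightarrow> \<bar>f (x + z) - f x - p x \<bullet> z - (S *v z) \<bullet> z / 2\<bar> \<le> \<epsilon> * (norm z)\<^sup>2"
proof -
  obtain r where r: "r > 0" and pr: "\<And>y. norm (y - x) < r \<Longrightarrow> norm (p y - p x - S *v (y - x)) \<le> \<epsilon> * norm (y - x)"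
    using p \<epsilon> unfolding has_derivative_at_alt by meson
  have "\<bar>f (x + z) - f x - p x \<bullet> z - (S *v z) \<bullet> z / 2\<bar> \<le> \<epsilon> * (norm z)\<^sup>2" if z: "norm z < r" for z
  proof -
    define g where "g \<theta> = f (x + \<theta> *\<^sub>R z) - \<theta> * (p x \<bullet> z) - \<theta>\<^sup>2 / 2 * ((S *v z) \<bullet> z)" for \<theta>
    have "DERIV g \<theta> :> p (x + \<theta> *\<^sub>R z) \<bullet> z - p x \<bullet> z - \<theta> * ((S *v z) \<bullet> z)" for \<theta>
    proof -
      have "((\<lambda>\<theta>. f (x + \<theta> *\<^sub>R z)) has_derivative (\<lambda>h. p (x + \<theta> *\<^sub>R z) \<bullet> (h *\<^sub>R z))) (at \<theta>)"
        by (rule has_derivative_compose[OF _ f]) (auto intro!: derivative_eq_intros)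
      moreover have "(\<lambda>h. p (x + \<theta> *\<^sub>R z) \<bullet> (h *\<^sub>R z)) = (*) (p (x + \<theta> *\<^sub>R z) \<bullet> z)"
        by (simp add: fun_eq_iff)
      ultimately have "DERIV (\<lambda>\<theta>. f (x + \<theta> *\<^sub>R z)) \<theta> :> p (x + \<theta> *\<^sub>R z) \<bullet> z"
        unfolding has_field_derivative_def by (simp only:)
      then show ?thesis
        unfolding g_def by (auto intro!: derivative_eq_intros)
    qed
    then obtain \<theta> where \<theta>: "0 < \<theta>" "\<theta> < 1"
      and g1: "g 1 - g 0 = (1 - 0) * (p (x + \<theta> *\<^sub>R z) \<bullet> z - p x \<bullet> z - \<theta> * ((S *v z) \<bullet> z))"
      using MVT2[of 0 1 g] by force
    have "\<bar>g 1 - g 0\<bar> = \<bar>(p (x + \<theta> *\<^sub>R z) - p x - S *v (\<theta> *\<^sub>R z)) \<bullet> z\<bar>"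
      unfolding g1 by (simp add: inner_diff_left matrix_vector_mult_scaleR)
    also have "\<dots> \<le> norm (p (x + \<theta> *\<^sub>R z) - p x - S *v (\<theta> *\<^sub>R z)) * norm z"
      by (rule Cauchy_Schwarz_ineq2)
    also have "\<dots> \<le> (\<epsilon> * norm (\<theta> *\<^sub>R z)) * norm z"
    proof (rule mult_right_mono)
      have "norm (\<theta> *\<^sub>R z) \<le> norm z" using \<theta> by (simp add: mult_left_le_one_le)
      then show "norm (p (x + \<theta> *\<^sub>R z) - p x - S *v (\<theta> *\<^sub>R z)) \<le> \<epsilon> * norm (\<theta> *\<^sub>R z)"
        using pr[of "x + \<theta> *\<^sub>R z"] z by simp
    qed simp
    also have "\<dots> \<le> \<epsilon> * (norm z)\<^sup>2"
    proof -
      have "\<theta> * (norm z * norm z) \<le> 1 * (norm z * norm z)" using \<theta> by (intro mult_right_mono) auto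
      then show ?thesis using \<theta> \<epsilon> by (simp add: power2_eq_square mult_ac)
    qed
    finally show ?thesis by (simp add: g_def algebra_simps)
  qed
  then show ?thesis using r by blast
qed

text \<open>The path runs in time at the fixed point \<open>x + z\<close> and in space at the fixed
  time \<open>t\<close>. Thus Taylor's formula is applied at time \<open>t\<close> only, and joint
  continuity of \<open>q\<close> handles the time step.\<close>

lemma Cb_1_3_backward_expansion:
  fixes \<psi> :: "real \<Rightarrow> real ^ 'd \<Rightarrow> real"
  assumes Cb: "Cb_1_3 \<psi> q p S T" and t: "t > 0" and \<epsilon>: "\<epsilon> > 0"
  shows "\<exists>r>0. \<forall>h z. 0 < h \<longrightarrow> h < r \<longrightarrow> norm z < r \<longrightarrow>
    \<bar>\<psi> (t - h) (x + z) - (\<psi> t x - h * q t x + p t x \<bullet> z + (S t x *v z) \<bullet> z / 2)\<bar> \<le> \<epsilon> * h + \<epsilon> * (norm z)\<^sup>2"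
proof -
  obtain r1 where r1: "r1 > 0" and sp: "\<And>z. norm z < r1 \<Longrightarrow>
     \<bar>\<psi> t (x + z) - \<psi> t x - p t x \<bullet> z - (S t x *v z) \<bullet> z / 2\<bar> \<le> \<epsilon> * (norm z)\<^sup>2"
    using second_order_Taylor_at[of "\<psi> t" "p t" "S t x" x \<epsilon>] Cb t \<epsilon> unfolding Cb_1_3_def by blast
  have "continuous_on ({0<..} \<times> UNIV) (\<lambda>(t, x). q t x)"
    using Cb by (simp add: Cb_1_3_def bounded_continuous_def)
  moreover have "open ({0 :: real<..} \<times> (UNIV :: (real ^ 'd) set))" by (intro open_Times) auto
  ultimately have "isCont (\<lambda>(t, x). q t x) (t, x)"
    using t by (simp add: continuous_on_eq_continuous_at)
  then obtain r2 where r2: "r2 > 0" and qc: "\<And>w. dist w (t, x) < r2 \<Longrightarrow> dist ((\<lambda>(t, x). q t x) w) (q t x) < \<epsilon>"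
    using \<epsilon> unfolding continuous_at_eps_delta by (metis (no_types, lifting) case_prod_conv)
  define r where "r = min (min r1 (r2 / 2)) t"
  have r: "r > 0" using r1 r2 t by (simp add: r_def)
  have "\<bar>\<psi> (t - h) (x + z) - (\<psi> t x - h * q t x + p t x \<bullet> z + (S t x *v z) \<bullet> z / 2)\<bar> \<le> \<epsilon> * h + \<epsilon> * (norm z)\<^sup>2"
    if h: "0 < h" "h < r" and z: "norm z < r" for h z
  proof -
    have "DERIV (\<lambda>s. \<psi> s (x + z)) s :> q s (x + z)" if "t - h \<le> s" for s
      using Cb that h unfolding Cb_1_3_def r_def by auto
    then obtain \<tau> where \<tau>: "t - h < \<tau>" "\<tau> < t" and mv: "\<psi> t (x + z) - \<psi> (t - h) (x + z) = (t - (t - h)) * q \<tau> (x + z)"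
      using MVT2[of "t - h" t "\<lambda>s. \<psi> s (x + z)" "\<lambda>s. q s (x + z)"] h by auto
    have "dist (\<tau>, x + z) (t, x) \<le> \<bar>\<tau> - t\<bar> + norm z"
      using sqrt_sum_squares_le_sum_abs[of "\<tau> - t" "norm z"] by (simp add: dist_norm norm_Pair)
    also have "\<dots> < r2" using \<tau> h z by (simp add: r_def)
    finally have "\<bar>q \<tau> (x + z) - q t x\<bar> < \<epsilon>" using qc[of "(\<tau>, x + z)"] by (simp add: dist_real_def)
    then have "h * \<bar>q \<tau> (x + z) - q t x\<bar> \<le> h * \<epsilon>" using h by (intro mult_left_mono) auto
    then have "\<bar>h * q \<tau> (x + z) - h * q t x\<bar> \<le> \<epsilon> * h"
      using h by (simp add: abs_mult right_diff_distrib[symmetric] mult.commute)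
    moreover have "\<psi> (t - h) (x + z) = \<psi> t (x + z) - h * q \<tau> (x + z)" using mv by simp
    moreover have "\<bar>\<psi> t (x + z) - \<psi> t x - p t x \<bullet> z - (S t x *v z) \<bullet> z / 2\<bar> \<le> \<epsilon> * (norm z)\<^sup>2"
      using z by (intro sp) (simp add: r_def)
    ultimately show ?thesis by linarith
  qed
  then show ?thesis using r by blast
qed

text \<open>For fixed \<open>\<epsilon>\<close> first \<open>h\<close> is made small, then
  \<open>\<epsilon>\<close>. The constant \<open>C\<close> and the range of \<open>h\<close> may
  depend on \<open>\<epsilon>\<close>, whereas the factor \<open>M\<close>, a moment, may
  not.\<close>

lemma vanishing_remainder:
  fixes a b M :: real
  assumes "M \<ge> 0"
    and *: "\<And>\<epsilon>. \<epsilon> > 0 \<Longrightarrow> \<exists>C\<ge>0. \<exists>h0>0. \<forall>h. 0 < h \<longrightarrow> h < h0 \<longrightarrow> a \<le> b + (2 * \<epsilon> + C * sqrt h) * M"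
  shows "a \<le> b"
proof (rule field_le_epsilon)
  fix e :: real assume e: "e > 0"
  define \<epsilon> where "\<epsilon> = e / (3 * (M + 1))"
  have \<epsilon>: "\<epsilon> > 0" using e assms(1) by (simp add: \<epsilon>_def)
  obtain C h0 where C: "C \<ge> 0" and h0: "h0 > 0"
    and b: "\<And>h. 0 < h \<Longrightarrow> h < h0 \<Longrightarrow> a \<le> b + (2 * \<epsilon> + C * sqrt h) * M"
    using *[OF \<epsilon>] by blast
  define h where "h = min (h0 / 2) ((\<epsilon> / (C + 1))\<^sup>2)"
  have h: "0 < h" "h < h0" using h0 \<epsilon> C by (auto simp: h_def)
  have "sqrt h \<le> sqrt ((\<epsilon> / (C + 1))\<^sup>2)" by (intro real_sqrt_le_mono) (simp add: h_def)
  also have "\<dots> = \<epsilon> / (C + 1)" using \<epsilon> C by simp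
  finally have "(C + 1) * sqrt h \<le> \<epsilon>" using C by (simp add: field_simps)
  then have Cs: "C * sqrt h \<le> \<epsilon>" using h real_sqrt_ge_zero[of h] unfolding distrib_right by linarith
  have "(2 * \<epsilon> + C * sqrt h) * M \<le> (3 * \<epsilon>) * M" using Cs assms(1) by (intro mult_right_mono) auto
  also have "\<dots> \<le> (3 * \<epsilon>) * (M + 1)" using \<epsilon> by (intro mult_left_mono) auto
  also have "\<dots> = e"
  proof -
    have "3 * (e / (3 * D)) * D = e" if "D \<noteq> 0" for D :: real using that by simp
    from this[of "M + 1"] show ?thesis unfolding \<epsilon>_def using assms(1) by simp
  qed
  finally show "a \<le> b + e" using b[OF h] by linarith
qed

section \<open>The semigroup law and the viscosity inequalities\<close>

context superlinear_expectation_space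
begin

text \<open>The stability property is taken at \<open>a = sqrt s\<close> and
  \<open>b = sqrt t\<close>; independence then evaluates the inner expectation over the copy
  \<open>X'\<close> with the value of \<open>X\<close> frozen.\<close>

lemma evolution_semigroup:
  fixes X :: "'w \<Rightarrow> real ^ 'd"
  assumes X: "random_vector H X" and normal: "G_star_normal H E X" and \<phi>: "cl_Lip \<phi>"
    and s: "0 \<le> s" and t: "0 \<le> t"
  shows "evolution E X \<phi> (s + t) x = evolution E X (evolution E X \<phi> t) s x"
proof -
  obtain H' E' X' where ext: "extends_space H' E' H E"
    and copy: "independent_copy E' X' (\<lambda>\<omega>. X (fst \<omega>))"
    and dist: "\<And>a b. 0 \<le> a \<Longrightarrow> 0 \<le> b \<Longrightarrow> eq_dist E' (\<lambda>\<omega>. a *\<^sub>R X (fst \<omega>) + b *\<^sub>R X' \<omega>)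
                 (\<lambda>\<omega>. sqrt (a\<^sup>2 + b\<^sup>2) *\<^sub>R X (fst \<omega>))"
    using normal unfolding G_star_normal_def by blast
  have lift: "E' (\<lambda>\<omega>. \<kappa> (y + c *\<^sub>R X (fst \<omega>))) = E (\<lambda>\<omega>. \<kappa> (y + c *\<^sub>R X \<omega>))" if "cl_Lip \<kappa>" for \<kappa> y c
  proof -
    have "\<forall>Z\<in>H. E' (\<lambda>\<omega>. Z (fst \<omega>)) = E Z" using ext by (simp add: extends_space_def)
    from bspec[OF this affine_in[OF X that]] show ?thesis .
  qed
  have "evolution E X \<phi> (s + t) x = E' (\<lambda>\<omega>. \<phi> (x + sqrt (s + t) *\<^sub>R X (fst \<omega>)))"
    unfolding evolution_def by (rule lift[OF \<phi>, symmetric])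
  also have "\<dots> = E' (\<lambda>\<omega>. \<phi> (x + (sqrt s *\<^sub>R X (fst \<omega>) + sqrt t *\<^sub>R X' \<omega>)))"
  proof -
    have "cl_Lip (\<lambda>z. \<phi> (x + 1 *\<^sub>R z))" by (rule cl_Lip_affine[OF \<phi>])
    then have "cl_Lip (\<lambda>z. \<phi> (x + z))" by simp
    moreover have "sqrt ((sqrt s)\<^sup>2 + (sqrt t)\<^sup>2) = sqrt (s + t)" using s t by simp
    ultimately show ?thesis
      using dist[of "sqrt s" "sqrt t"] s t unfolding eq_dist_def by auto
  qed
  also have "\<dots> = E' (\<lambda>\<omega>. (\<lambda>z. \<phi> (x + sqrt s *\<^sub>R fst z + sqrt t *\<^sub>R snd z)) (X (fst \<omega>), X' \<omega>))"
    by (simp add: add.assoc)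
  also have "\<dots> = E' (\<lambda>\<omega>. E' (\<lambda>\<omega>'. (\<lambda>z. \<phi> (x + sqrt s *\<^sub>R fst z + sqrt t *\<^sub>R snd z)) (X (fst \<omega>), X' \<omega>')))"
    using copy cl_Lip_affine_pair[OF \<phi>] unfolding independent_copy_def independent_of_def by blast
  also have "\<dots> = E' (\<lambda>\<omega>. E' (\<lambda>\<omega>'. \<phi> (x + sqrt s *\<^sub>R X (fst \<omega>) + sqrt t *\<^sub>R X' \<omega>')))"
    by simp
  also have "\<dots> = E' (\<lambda>\<omega>. evolution E X \<phi> t (x + sqrt s *\<^sub>R X (fst \<omega>)))"
  proof -
    have "E' (\<lambda>\<omega>'. \<phi> (y + sqrt t *\<^sub>R X' \<omega>')) = evolution E X \<phi> t y" for y
    proof -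
      have "E' (\<lambda>\<omega>'. \<phi> (y + sqrt t *\<^sub>R X' \<omega>')) = E' (\<lambda>\<omega>. \<phi> (y + sqrt t *\<^sub>R X (fst \<omega>)))"
        using copy cl_Lip_affine[OF \<phi>, of y "sqrt t"] unfolding independent_copy_def eq_dist_def by blast
      then show ?thesis unfolding evolution_def lift[OF \<phi>] .
    qed
    then show ?thesis by simp
  qed
  also have "\<dots> = evolution E X (evolution E X \<phi> t) s x"
    unfolding evolution_def[of E X "evolution E X \<phi> t"] by (rule lift[OF cl_Lip_evolution[OF X \<phi> t]])
  finally show ?thesis .
qed

text \<open>On a linear function the semigroup law with both times equal to 1 reads
  \<open>sqrt 2 * e = 2 * e\<close>.\<close>

lemma mean_zero:
  fixes X :: "'w \<Rightarrow> real ^ 'd"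
  assumes X: "random_vector H X" and normal: "G_star_normal H E X"
  shows "E (\<lambda>\<omega>. p \<bullet> X \<omega>) = 0"
proof -
  define e where "e = E (\<lambda>\<omega>. p \<bullet> X \<omega>)"
  have in_H: "(\<lambda>\<omega>. p \<bullet> X \<omega>) \<in> H" by (rule cl_Lip_in[OF X cl_Lip_inner])
  have ev: "evolution E X (\<lambda>z. p \<bullet> z) t x = p \<bullet> x + sqrt t * e" if "t \<ge> 0" for t x
    unfolding evolution_def e_def inner_add_right inner_scaleR_right
    using that by (simp add: E_add_const scale_in in_H pos_homogeneous)
  have "sqrt 2 * e = evolution E X (\<lambda>z. p \<bullet> z) (1 + 1) 0" by (simp add: ev)
  also have "\<dots> = evolution E X (evolution E X (\<lambda>z. p \<bullet> z) 1) 1 0"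
    by (rule evolution_semigroup[OF X normal cl_Lip_inner]) auto
  also have "\<dots> = E (\<lambda>\<omega>. e + p \<bullet> X \<omega>)"
    by (simp add: evolution_def[of E X "evolution E X (\<lambda>z. p \<bullet> z) 1"] ev add.commute)
  also have "\<dots> = 2 * e" by (simp add: E_add_const in_H e_def)
  finally have "(2 - sqrt 2) * e = 0" by (simp add: algebra_simps)
  moreover have "sqrt 2 \<noteq> (2 :: real)" using sqrt2_less_2 by simp
  ultimately show ?thesis by (simp add: e_def)
qed

text \<open>As \<open>mz\<close> also covers \<open>- p\<close>, the linear part has expectation 0
  under \<open>E\<close> and under \<open>upper\<close>; such a summand drops out exactly, although
  \<open>E\<close> is not additive.\<close>

lemma E_linear_quadratic:
  fixes X :: "'w \<Rightarrow> real ^ 'd"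
  assumes X: "random_vector H X" and mz: "\<And>p. E (\<lambda>\<omega>. p \<bullet> X \<omega>) = 0" and h: "0 \<le> h"
  shows "E (\<lambda>\<omega>. c + (p \<bullet> (sqrt h *\<^sub>R X \<omega>) + (S *v (sqrt h *\<^sub>R X \<omega>)) \<bullet> (sqrt h *\<^sub>R X \<omega>) / 2)) = c + h * G_star E X S"
proof -
  have lin: "(\<lambda>\<omega>. p' \<bullet> X \<omega>) \<in> H" for p' by (rule cl_Lip_in[OF X cl_Lip_inner])
  have qd: "(\<lambda>\<omega>. (S *v X \<omega>) \<bullet> X \<omega>) \<in> H" by (rule cl_Lip_in[OF X cl_Lip_quadratic])
  define Y where "Y \<omega> = (sqrt h *\<^sub>R p) \<bullet> X \<omega>" for \<omega>
  define Z where "Z \<omega> = h / 2 * ((S *v X \<omega>) \<bullet> X \<omega>)" for \<omega>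
  have Y: "Y \<in> H" unfolding Y_def[abs_def] by (rule lin)
  have Z: "Z \<in> H" unfolding Z_def[abs_def] by (rule scale_in[OF qd])
  have EY: "E Y = 0" "upper Y = 0"
    using mz[of "sqrt h *\<^sub>R p"] mz[of "- (sqrt h *\<^sub>R p)"] by (auto simp: upper_def Y_def[abs_def])
  have EZ: "E Z = h * G_star E X S"
  proof -
    have "E Z = h / 2 * E (\<lambda>\<omega>. (S *v X \<omega>) \<bullet> X \<omega>)"
      unfolding Z_def[abs_def] by (rule pos_homogeneous[OF _ qd]) (use h in simp)
    then show ?thesis by (simp add: G_star_def)
  qed
  have "E (\<lambda>\<omega>. Z \<omega> + Y \<omega>) = E Z"
    using E_add_le[OF Z Y] superadd[OF Z Y] EY by linarith
  moreover have "p \<bullet> (sqrt h *\<^sub>R X \<omega>) + (S *v (sqrt h *\<^sub>R X \<omega>)) \<bullet> (sqrt h *\<^sub>R X \<omega>) / 2 = Z \<omega> + Y \<omega>" for \<omega>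
    using h by (simp add: Y_def Z_def matrix_vector_mult_scaleR mult.assoc[symmetric])
  ultimately show ?thesis
    using E_add_const[OF add_in[OF Z Y], of c] EZ by simp
qed

text \<open>Away from \<open>x\<close> touching gives no information, but the difference grows only
  polynomially, and for |z| \<ge> r a factor (|z|/r)^3 can be inserted; at z = sqrt h X it is of
  order h sqrt h. The exponent \<open>m\<close> comes before \<open>r\<close>, so that one moment
  serves every \<epsilon>.\<close>

lemma evolution_far_bound:
  fixes X :: "'w \<Rightarrow> real ^ 'd"
  assumes X: "random_vector H X" and \<phi>: "cl_Lip \<phi>" and t: "t > 0"
  shows "\<exists>m. \<forall>r>0. \<exists>C\<ge>0. \<forall>h z. 0 < h \<longrightarrow> h < t \<longrightarrow> r \<le> norm z \<longrightarrow>
    \<bar>evolution E X \<phi> (t - h) (x + z) - (evolution E X \<phi> t x - h * q + p \<bullet> z + (S *v z) \<bullet> z / 2)\<bar>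
      \<le> C * (norm z ^ 3 * (1 + norm z) ^ m)"
proof -
  obtain C k where C: "C \<ge> 0" and b: "\<And>s t x y. s \<ge> 0 \<Longrightarrow> t \<ge> 0 \<Longrightarrow>
     \<bar>evolution E X \<phi> t x - evolution E X \<phi> s y\<bar>
       \<le> C * (1 + norm x + norm y + sqrt t + sqrt s) ^ k * (norm (x - y) + \<bar>sqrt t - sqrt s\<bar>)"
    by (rule evolution_modulus[OF X \<phi>]) (rule that)
  define R where "R = 1 + 2 * norm x + 2 * sqrt t"
  define c where "c = onorm (\<lambda>z. S *v z)"
  have bl: "bounded_linear (\<lambda>z. S *v z)" by (rule matrix_vector_mul_bounded_linear)
  have c: "norm (S *v z) \<le> c * norm z" for z unfolding c_def by (rule onorm[OF bl])
  have c0: "c \<ge> 0" unfolding c_def by (rule onorm_pos_le[OF bl])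
  define A where "A = C * R ^ k * (1 + sqrt t) + t * \<bar>q\<bar> + norm p + c"
  have R0: "R \<ge> 1" using t by (simp add: R_def)
  have A: "A \<ge> 0" using C R0 t c0 by (simp add: A_def)
  have "\<bar>evolution E X \<phi> (t - h) (x + z) - (evolution E X \<phi> t x - h * q + p \<bullet> z + (S *v z) \<bullet> z / 2)\<bar>
      \<le> A / r ^ 3 * (norm z ^ 3 * (1 + norm z) ^ (k + 2))" if r: "r > 0" and h: "0 < h" "h < t" and z: "r \<le> norm z" for r h z
  proof -
    define n where "n = norm z"
    have n: "n \<ge> 0" by (simp add: n_def)
    define P where "P = (1 + n) ^ (k + 2)"
    have P1: "1 \<le> P" unfolding P_def by (rule one_le_power) (use n in simp)
    have Pn: "n \<le> P" "n\<^sup>2 \<le> P" "(1 + n) ^ Suc k \<le> P"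
    proof -
      have "(1 + n) ^ 1 \<le> P" "(1 + n) ^ 2 \<le> P" "(1 + n) ^ Suc k \<le> P"
        unfolding P_def by (rule power_increasing; use n in simp)+
      moreover have "n\<^sup>2 \<le> (1 + n)\<^sup>2" using n by (intro power_mono) auto
      ultimately show "n \<le> P" "n\<^sup>2 \<le> P" "(1 + n) ^ Suc k \<le> P" by auto
    qed
    have "\<bar>evolution E X \<phi> (t - h) (x + z) - evolution E X \<phi> t x\<bar>
       \<le> C * (1 + norm (x + z) + norm x + sqrt (t - h) + sqrt t) ^ k * (norm (x + z - x) + \<bar>sqrt (t - h) - sqrt t\<bar>)"
      using t h by (intro b) auto
    also have "\<dots> \<le> C * (R * (1 + n)) ^ k * ((1 + sqrt t) * (1 + n))"
    proof (intro mult_mono mult_left_mono power_mono)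
      have "1 + norm (x + z) + norm x + sqrt (t - h) + sqrt t \<le> R + n"
      proof -
        have "sqrt (t - h) \<le> sqrt t" using h by (intro real_sqrt_le_mono) simp
        then show ?thesis using norm_triangle_ineq[of x z] unfolding R_def n_def by linarith
      qed
      also have "\<dots> \<le> R * (1 + n)" using mult_right_mono[OF R0 n] by (simp add: algebra_simps)
      finally show "1 + norm (x + z) + norm x + sqrt (t - h) + sqrt t \<le> R * (1 + n)" .
      have "sqrt (t - h) \<le> sqrt t" "0 \<le> sqrt (t - h)" using h by auto
      then have "norm (x + z - x) + \<bar>sqrt (t - h) - sqrt t\<bar> \<le> n + sqrt t"
        by (simp add: n_def)
      also have "\<dots> \<le> (1 + sqrt t) * (1 + n)" using n t by (simp add: algebra_simps)
      finally show "norm (x + z - x) + \<bar>sqrt (t - h) - sqrt t\<bar> \<le> (1 + sqrt t) * (1 + n)" .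
    qed (use C R0 n t h in auto)
    also have "\<dots> = (C * R ^ k * (1 + sqrt t)) * (1 + n) ^ Suc k" by (simp add: power_mult_distrib mult_ac)
    also have "\<dots> \<le> (C * R ^ k * (1 + sqrt t)) * P" using C R0 t Pn by (intro mult_left_mono) auto
    finally have 1: "\<bar>evolution E X \<phi> (t - h) (x + z) - evolution E X \<phi> t x\<bar> \<le> (C * R ^ k * (1 + sqrt t)) * P" .
    have 2: "\<bar>h * q\<bar> \<le> t * \<bar>q\<bar> * P"
    proof -
      have "\<bar>h * q\<bar> \<le> t * \<bar>q\<bar> * 1" using h by (simp add: abs_mult mult_right_mono)
      also have "\<dots> \<le> t * \<bar>q\<bar> * P" using t P1 by (intro mult_left_mono) auto
      finally show ?thesis .
    qed
    have 3: "\<bar>p \<bullet> z\<bar> \<le> norm p * P"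
      using Cauchy_Schwarz_ineq2[of p z] mult_left_mono[OF Pn(1), of "norm p"] by (simp add: n_def)
    have 4: "\<bar>(S *v z) \<bullet> z / 2\<bar> \<le> c * P"
    proof -
      have "\<bar>(S *v z) \<bullet> z\<bar> \<le> norm (S *v z) * norm z" by (rule Cauchy_Schwarz_ineq2)
      also have "\<dots> \<le> c * norm z * norm z" by (intro mult_right_mono c) auto
      also have "\<dots> = c * n\<^sup>2" by (simp add: n_def power2_eq_square)
      also have "\<dots> \<le> c * P" using c0 Pn by (intro mult_left_mono) auto
      finally have *: "\<bar>(S *v z) \<bullet> z\<bar> \<le> c * P" .
      have "\<bar>(S *v z) \<bullet> z / 2\<bar> \<le> \<bar>(S *v z) \<bullet> z\<bar>" by simp
      then show ?thesis using * by linarith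
    qed
    have "\<bar>a - (b - d + e + f)\<bar> \<le> \<bar>a - b\<bar> + \<bar>d\<bar> + \<bar>e\<bar> + \<bar>f\<bar>" for a b d e f :: real by linarith
    then have "\<bar>evolution E X \<phi> (t - h) (x + z) - (evolution E X \<phi> t x - h * q + p \<bullet> z + (S *v z) \<bullet> z / 2)\<bar>
       \<le> \<bar>evolution E X \<phi> (t - h) (x + z) - evolution E X \<phi> t x\<bar> + \<bar>h * q\<bar> + \<bar>p \<bullet> z\<bar> + \<bar>(S *v z) \<bullet> z / 2\<bar>" .
    also have "\<dots> \<le> (C * R ^ k * (1 + sqrt t)) * P + t * \<bar>q\<bar> * P + norm p * P + c * P"
      by (intro add_mono 1 2 3 4)
    also have "\<dots> = A * P" by (simp add: A_def algebra_simps)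
    also have "\<dots> \<le> A / r ^ 3 * (n ^ 3 * P)"
    proof -
      have "r ^ 3 \<le> n ^ 3" using r z by (intro power_mono) (auto simp: n_def)
      then have "A * P * r ^ 3 \<le> A * P * n ^ 3" using A P1 by (intro mult_left_mono) auto
      then show ?thesis using r by (simp add: field_simps)
    qed
    finally show ?thesis by (simp only: n_def P_def)
  qed
  moreover have "A / r ^ 3 \<ge> 0" if "r > 0" for r using A that by simp
  ultimately show ?thesis by (intro exI[of _ "k + 2"] allI impI) blast
qed

text \<open>At z = sqrt h X the square contributes \<open>h\<close> and the cube
  \<open>h * sqrt h\<close>; all powers of |X| are dominated by one weight of exponent
  \<open>m + 3\<close>.\<close>

lemma remainder_expectation_bound:
  fixes X :: "'w \<Rightarrow> real ^ 'd"
  assumes X: "random_vector H X" and Y: "Y \<in> H" and Z: "Z \<in> H" and h: "0 < h" "h \<le> 1" and \<epsilon>: "0 \<le> \<epsilon>" and C: "0 \<le> C"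
    and le: "\<And>\<omega>. Y \<omega> \<le> Z \<omega> + (\<epsilon> * h + \<epsilon> * (norm (sqrt h *\<^sub>R X \<omega>))\<^sup>2
        + C * (norm (sqrt h *\<^sub>R X \<omega>) ^ 3 * (1 + norm (sqrt h *\<^sub>R X \<omega>)) ^ m))"
  shows "E Y \<le> E Z + h * (2 * \<epsilon> + C * sqrt h) * moment X (m + 3)"
proof -
  define W where "W \<omega> = (1 + norm (X \<omega>)) ^ (m + 3)" for \<omega>
  have W: "W \<in> H" unfolding W_def[abs_def] by (rule cl_Lip_in[OF X cl_Lip_weight])
  define d where "d = h * (2 * \<epsilon> + C * sqrt h)"
  have d: "d \<ge> 0" using h \<epsilon> C by (simp add: d_def)
  have "Y \<omega> \<le> Z \<omega> + d * W \<omega>" for \<omega>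
  proof -
    define n where "n = norm (X \<omega>)"
    have n: "n \<ge> 0" by (simp add: n_def)
    have s: "0 \<le> sqrt h" "sqrt h \<le> 1" using h by auto
    have W1: "1 \<le> W \<omega>" unfolding W_def by (intro one_le_power) simp
    have W2: "n\<^sup>2 \<le> W \<omega>"
    proof -
      have "n\<^sup>2 \<le> (1 + n)\<^sup>2" using n by (intro power_mono) auto
      also have "\<dots> \<le> (1 + n) ^ (m + 3)" using n by (intro power_increasing) auto
      finally show ?thesis by (simp add: W_def n_def)
    qed
    have W3: "n ^ 3 * (1 + sqrt h * n) ^ m \<le> W \<omega>"
    proof -
      have "sqrt h * n \<le> 1 * n" using s n by (intro mult_right_mono) auto
      then have "n ^ 3 * (1 + sqrt h * n) ^ m \<le> (1 + n) ^ 3 * (1 + n) ^ m"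
        using n s by (intro mult_mono power_mono) auto
      then show ?thesis by (simp add: W_def n_def power_add mult.commute)
    qed
    have nn: "norm (sqrt h *\<^sub>R X \<omega>) = sqrt h * n" using s by (simp add: n_def)
    have h3: "sqrt h ^ 3 = h * sqrt h" using h by (simp add: power3_eq_cube)
    have "\<epsilon> * h * 1 \<le> \<epsilon> * h * W \<omega>" using W1 \<epsilon> h by (intro mult_left_mono) auto
    moreover have "\<epsilon> * (sqrt h * n)\<^sup>2 \<le> \<epsilon> * h * W \<omega>"
      using W2 \<epsilon> h by (simp add: power_mult_distrib mult.assoc mult_left_mono)
    moreover have "C * ((sqrt h * n) ^ 3 * (1 + sqrt h * n) ^ m) \<le> C * (h * sqrt h) * W \<omega>"
    proof -
      have "C * ((sqrt h * n) ^ 3 * (1 + sqrt h * n) ^ m) = C * (h * sqrt h) * (n ^ 3 * (1 + sqrt h * n) ^ m)"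
        by (simp add: power_mult_distrib h3 mult_ac)
      also have "\<dots> \<le> C * (h * sqrt h) * W \<omega>" using W3 C h by (intro mult_left_mono) auto
      finally show ?thesis .
    qed
    ultimately have "\<epsilon> * h + \<epsilon> * (sqrt h * n)\<^sup>2 + C * ((sqrt h * n) ^ 3 * (1 + sqrt h * n) ^ m) \<le> d * W \<omega>"
      by (simp add: d_def algebra_simps)
    then show ?thesis using le[of \<omega>] unfolding nn by linarith
  qed
  then have "E Y \<le> E (\<lambda>\<omega>. Z \<omega> + d * W \<omega>)" by (intro mono add_in scale_in Y Z W) auto
  also have "\<dots> \<le> E Z + upper (\<lambda>\<omega>. d * W \<omega>)" by (intro E_add_le Z scale_in W)
  also have "upper (\<lambda>\<omega>. d * W \<omega>) = d * moment X (m + 3)"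
    unfolding moment_def W_def[abs_def, symmetric] by (rule upper_scale[OF d W])
  finally show ?thesis by (simp add: d_def)
qed

lemma evolution_step:
  fixes X :: "'w \<Rightarrow> real ^ 'd"
  assumes "random_vector H X" "G_star_normal H E X" "cl_Lip \<phi>" and h: "0 < h" "h < t"
  shows "evolution E X \<phi> t x = E (\<lambda>\<omega>. evolution E X \<phi> (t - h) (x + sqrt h *\<^sub>R X \<omega>))"
  using evolution_semigroup[OF assms(1-3), of h "t - h" x] h
  by (simp add: evolution_def[of E X "evolution E X \<phi> (t - h)"])

text \<open>The factor \<open>c\<close> is \<open>1\<close> at a maximum of \<open>u - \<psi>\<close> and \<open>-1\<close> at a minimum.\<close>

lemma evolution_touching_expansion:
  fixes X :: "'w \<Rightarrow> real ^ 'd"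
  assumes X: "random_vector H X" and \<phi>: "cl_Lip \<phi>" and Cb: "Cb_1_3 \<psi> q p S T" and t: "t > 0"
    and eq: "evolution E X \<phi> t x = \<psi> t x" and c: "c = 1 \<or> c = -1"
    and mx: "\<forall>\<^sub>F (s, y) in nhds (t, x). c * (evolution E X \<phi> s y - \<psi> s y) \<le> 0"
  shows "\<exists>m. \<forall>\<epsilon>>0. \<exists>C\<ge>0. \<exists>h0>0. \<forall>h z. 0 < h \<longrightarrow> h < h0 \<longrightarrow> h < t \<and> h \<le> 1 \<and>
    c * (evolution E X \<phi> (t - h) (x + z)
         - (evolution E X \<phi> t x - h * q t x + p t x \<bullet> z + (S t x *v z) \<bullet> z / 2))
      \<le> \<epsilon> * h + \<epsilon> * (norm z)\<^sup>2 + C * (norm z ^ 3 * (1 + norm z) ^ m)"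
proof -
  define u where "u = evolution E X \<phi>"
  define Q where "Q h z = \<psi> t x - h * q t x + p t x \<bullet> z + (S t x *v z) \<bullet> z / 2" for h z
  have cle: "c * (a - b) \<le> \<bar>a - b\<bar>" for a b using c by auto
  obtain m where far: "\<And>r. r > 0 \<Longrightarrow> \<exists>C\<ge>0. \<forall>h z. 0 < h \<longrightarrow> h < t \<longrightarrow> r \<le> norm z \<longrightarrow>
    \<bar>u (t - h) (x + z) - Q h z\<bar> \<le> C * (norm z ^ 3 * (1 + norm z) ^ m)"
    using evolution_far_bound[OF X \<phi> t, of x "q t x" "p t x" "S t x"] unfolding u_def Q_def eq by blast
  obtain r2 where r2: "r2 > 0" and mx2: "\<And>s y. dist (s, y) (t, x) < r2 \<Longrightarrow> c * (u s y - \<psi> s y) \<le> 0"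
    using mx unfolding eventually_nhds_metric u_def by auto
  have "\<exists>C\<ge>0. \<exists>h0>0. \<forall>h z. 0 < h \<longrightarrow> h < h0 \<longrightarrow> h < t \<and> h \<le> 1 \<and>
    c * (u (t - h) (x + z) - Q h z) \<le> \<epsilon> * h + \<epsilon> * (norm z)\<^sup>2 + C * (norm z ^ 3 * (1 + norm z) ^ m)"
    if \<epsilon>: "\<epsilon> > 0" for \<epsilon>
  proof -
    obtain r1 where r1: "r1 > 0" and ex: "\<And>h z. 0 < h \<Longrightarrow> h < r1 \<Longrightarrow> norm z < r1 \<Longrightarrow>
      \<bar>\<psi> (t - h) (x + z) - Q h z\<bar> \<le> \<epsilon> * h + \<epsilon> * (norm z)\<^sup>2"
      using Cb_1_3_backward_expansion[OF Cb t \<epsilon>, of x] unfolding Q_def by blast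
    define r where "r = min r1 (r2 / 2)"
    have r: "r > 0" using r1 r2 by (simp add: r_def)
    obtain C where C: "C \<ge> 0" and fr: "\<And>h z. 0 < h \<Longrightarrow> h < t \<Longrightarrow> r \<le> norm z \<Longrightarrow>
      \<bar>u (t - h) (x + z) - Q h z\<bar> \<le> C * (norm z ^ 3 * (1 + norm z) ^ m)"
      using far[OF r] by blast
    have "h < t \<and> h \<le> 1 \<and>
      c * (u (t - h) (x + z) - Q h z) \<le> \<epsilon> * h + \<epsilon> * (norm z)\<^sup>2 + C * (norm z ^ 3 * (1 + norm z) ^ m)"
      if h: "0 < h" "h < min r (min t 1)" for h z
    proof (intro conjI)
      show "c * (u (t - h) (x + z) - Q h z) \<le> \<epsilon> * h + \<epsilon> * (norm z)\<^sup>2 + C * (norm z ^ 3 * (1 + norm z) ^ m)"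
      proof (cases "norm z < r")
        case True
        have "dist (t - h, x + z) (t, x) \<le> h + norm z"
          using sqrt_sum_squares_le_sum_abs[of h "norm z"] h by (simp add: dist_norm norm_Pair)
        then have "c * (u (t - h) (x + z) - \<psi> (t - h) (x + z)) \<le> 0"
          using True h by (intro mx2) (auto simp: r_def)
        moreover have "c * (\<psi> (t - h) (x + z) - Q h z) \<le> \<epsilon> * h + \<epsilon> * (norm z)\<^sup>2"
          using True h by (intro order_trans[OF cle ex]) (auto simp: r_def)
        moreover have "0 \<le> C * (norm z ^ 3 * (1 + norm z) ^ m)" using C by simp
        ultimately show ?thesis unfolding right_diff_distrib by linarith
      next
        case False
        moreover have "0 \<le> \<epsilon> * h + \<epsilon> * (norm z)\<^sup>2" using \<epsilon> h by simp
        ultimately show ?thesis using cle[of "u (t - h) (x + z)" "Q h z"] fr[of h z] h by simp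
      qed
    qed (use h in auto)
    moreover have "min r (min t 1) > 0" using r t by simp
    ultimately show ?thesis using C by blast
  qed
  then show ?thesis unfolding u_def Q_def eq by blast
qed

text \<open>By the semigroup law \<open>E Y\<close> is \<open>u t x\<close>, and the quadratic
  expansion \<open>Z\<close> has expectation u - h q + h G. Their difference is \<open>h\<close>
  times the quantity to be estimated, against an error of order h (2 \<epsilon> + C sqrt h).\<close>

lemma evolution_viscosity_inequality:
  fixes X :: "'w \<Rightarrow> real ^ 'd"
  assumes X: "random_vector H X" and normal: "G_star_normal H E X" and \<phi>: "cl_Lip \<phi>"
    and Cb: "Cb_1_3 \<psi> q p S T" and t: "t > 0" and eq: "evolution E X \<phi> t x = \<psi> t x"
    and c: "c = 1 \<or> c = -1"
    and mx: "\<forall>\<^sub>F (s, y) in nhds (t, x). c * (evolution E X \<phi> s y - \<psi> s y) \<le> 0"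
  shows "c * (q t x - G_star E X (S t x)) \<le> 0"
proof -
  define u where "u = evolution E X \<phi>"
  obtain m where m: "\<And>\<epsilon>. \<epsilon> > 0 \<Longrightarrow> \<exists>C\<ge>0. \<exists>h0>0. \<forall>h z. 0 < h \<longrightarrow> h < h0 \<longrightarrow> h < t \<and> h \<le> 1 \<and>
    c * (u (t - h) (x + z) - (u t x - h * q t x + p t x \<bullet> z + (S t x *v z) \<bullet> z / 2))
      \<le> \<epsilon> * h + \<epsilon> * (norm z)\<^sup>2 + C * (norm z ^ 3 * (1 + norm z) ^ m)"
    using evolution_touching_expansion[OF X \<phi> Cb t eq c mx] unfolding u_def by blast
  show ?thesis
  proof (rule vanishing_remainder[where M = "moment X (m + 3)"])
    fix \<epsilon> :: real assume \<epsilon>: "\<epsilon> > 0"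
    obtain C h0 where C: "C \<ge> 0" and h0: "h0 > 0"
      and ex: "\<And>h z. 0 < h \<Longrightarrow> h < h0 \<Longrightarrow> h < t \<and> h \<le> 1 \<and>
        c * (u (t - h) (x + z) - (u t x - h * q t x + p t x \<bullet> z + (S t x *v z) \<bullet> z / 2))
          \<le> \<epsilon> * h + \<epsilon> * (norm z)\<^sup>2 + C * (norm z ^ 3 * (1 + norm z) ^ m)"
      using m[OF \<epsilon>] by blast
    have "c * (q t x - G_star E X (S t x)) \<le> 0 + (2 * \<epsilon> + C * sqrt h) * moment X (m + 3)"
      if h: "0 < h" "h < h0" for h
    proof -
      define Y where "Y \<omega> = u (t - h) (x + sqrt h *\<^sub>R X \<omega>)" for \<omega>
      define Z where "Z \<omega> = (u t x - h * q t x) + (p t x \<bullet> (sqrt h *\<^sub>R X \<omega>)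
        + (S t x *v (sqrt h *\<^sub>R X \<omega>)) \<bullet> (sqrt h *\<^sub>R X \<omega>) / 2)" for \<omega>
      define R where "R = h * (2 * \<epsilon> + C * sqrt h) * moment X (m + 3)"
      have ht: "h < t" "h \<le> 1" using ex[OF h] by auto
      have "cl_Lip (u (t - h))" unfolding u_def using ht by (intro cl_Lip_evolution X \<phi>) simp
      then have Y: "Y \<in> H" unfolding Y_def[abs_def] by (rule affine_in[OF X])
      have "cl_Lip (\<lambda>z. p t x \<bullet> (sqrt h *\<^sub>R z))" "cl_Lip (\<lambda>z. (S t x *v (sqrt h *\<^sub>R z)) \<bullet> (sqrt h *\<^sub>R z))"
        using cl_Lip_affine[OF cl_Lip_inner, of "p t x" 0 "sqrt h"] cl_Lip_affine[OF cl_Lip_quadratic, of "S t x" 0 "sqrt h"] by auto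
      note in_H = this[THEN cl_Lip_in[OF X]]
      have Z: "Z \<in> H"
        unfolding Z_def[abs_def] using scale_in[OF in_H(2), of "1/2"] by (intro add_in const_in in_H(1)) simp
      have EY: "E Y = u t x"
        using evolution_step[OF X normal \<phi> h(1) ht(1), of x] by (simp add: Y_def[abs_def] u_def)
      have EZ: "E Z = (u t x - h * q t x) + h * G_star E X (S t x)"
        unfolding Z_def[abs_def] using h by (intro E_linear_quadratic X mean_zero[OF X normal]) auto
      define W where "W \<omega> = \<epsilon> * h + \<epsilon> * (norm (sqrt h *\<^sub>R X \<omega>))\<^sup>2
        + C * (norm (sqrt h *\<^sub>R X \<omega>) ^ 3 * (1 + norm (sqrt h *\<^sub>R X \<omega>)) ^ m)" for \<omega>
      have pt: "c * (Y \<omega> - Z \<omega>) \<le> W \<omega>" for \<omega>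
        using ex[OF h, of "sqrt h *\<^sub>R X \<omega>", THEN conjunct2, THEN conjunct2]
        unfolding Y_def Z_def W_def add.assoc .
      note bound = remainder_expectation_bound[OF X _ _ h(1) ht(2) less_imp_le[OF \<epsilon>] C, of _ _ m,
        folded W_def R_def]
      \<comment> \<open>\<open>E\<close> is not linear, so the sign \<open>c\<close> cannot be moved
        inside; for \<open>c = -1\<close> the bound is used with \<open>Y\<close> and
        \<open>Z\<close> exchanged.\<close>
      have "c * (E Y - E Z) \<le> R"
        using c
      proof
        assume c1: "c = 1"
        then have "E Y \<le> E Z + R" using pt by (intro bound[OF Y Z]) (simp add: algebra_simps)
        then show ?thesis by (simp add: c1)
      next
        assume c1: "c = -1"
        then have "E Z \<le> E Y + R" using pt by (intro bound[OF Z Y]) (simp add: algebra_simps)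
        then show ?thesis by (simp add: c1)
      qed
      then have "h * (c * (q t x - G_star E X (S t x))) \<le> h * (0 + (2 * \<epsilon> + C * sqrt h) * moment X (m + 3))"
        unfolding EY EZ R_def by (simp add: algebra_simps)
      then show ?thesis using h by simp
    qed
    then show "\<exists>C\<ge>0. \<exists>h0>0. \<forall>h. 0 < h \<longrightarrow> h < h0 \<longrightarrow>
      c * (q t x - G_star E X (S t x)) \<le> 0 + (2 * \<epsilon> + C * sqrt h) * moment X (m + 3)" using C h0 by blast
  qed (rule moment_nonneg[OF X])
qed

lemma normal_imp_viscosity_solution:
  fixes X :: "'w \<Rightarrow> real ^ 'd"
  assumes X: "random_vector H X" and normal: "G_star_normal H E X" and \<phi>: "cl_Lip \<phi>"
  shows "viscosity_solution (\<lambda>t x r p A. G_star E X A) \<phi> (evolution E X \<phi>)"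
  unfolding viscosity_solution_def
proof (intro conjI allI impI)
  show "continuous_on ({0..} \<times> UNIV) (\<lambda>(t, x). evolution E X \<phi> t x)"
    by (rule continuous_on_evolution[OF X \<phi>])
  show "evolution E X \<phi> 0 x = \<phi> x" for x by (simp add: evolution_def const)
  fix \<psi> q p S T t x
  assume a: "Cb_1_3 \<psi> q p S T" "(0 :: real) < t" "evolution E X \<phi> t x = \<psi> t x"
  show "q t x - G_star E X (S t x) \<le> 0"
    if "\<forall>\<^sub>F (s, y) in nhds (t, x). evolution E X \<phi> s y - \<psi> s y \<le> evolution E X \<phi> t x - \<psi> t x"
    using evolution_viscosity_inequality[OF X normal \<phi> a, of 1] that a(3) by simp
  show "0 \<le> q t x - G_star E X (S t x)"
    if "\<forall>\<^sub>F (s, y) in nhds (t, x). evolution E X \<phi> t x - \<psi> t x \<le> evolution E X \<phi> s y - \<psi> s y"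
    using evolution_viscosity_inequality[OF X normal \<phi> a, of "-1"] that a(3) by simp
qed

end

section \<open>The equation implies normality\<close>

lemma trace_mult_outer: "trace (B ** outer a) = (B *v a) \<bullet> a" for B :: "real ^ 'd ^ 'd"
  by (simp add: trace_def matrix_matrix_mult_def outer_def matrix_vector_mult_def inner_vec_def
      sum_distrib_left sum_distrib_right mult_ac)

lemma gram_quadratic: "((\<gamma> ** transpose \<gamma>) *v a) \<bullet> a = (norm (transpose \<gamma> *v a))\<^sup>2" for \<gamma> :: "real ^ 'd ^ 'd"
proof -
  have "((\<gamma> ** transpose \<gamma>) *v a) \<bullet> a = a \<bullet> (\<gamma> *v (transpose \<gamma> *v a))"
    by (simp only: matrix_vector_mul_assoc inner_commute)
  also have "\<dots> = (a v* \<gamma>) \<bullet> (transpose \<gamma> *v a)" by (rule dot_lmul_matrix[symmetric])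
  also have "a v* \<gamma> = transpose \<gamma> *v a" by (rule transpose_matrix_vector[symmetric])
  finally show ?thesis by (simp add: power2_norm_eq_inner)
qed

lemma norm_transpose_mult_le:
  fixes \<gamma> :: "real ^ 'd ^ 'd"
  assumes "norm \<gamma> \<le> B"
  shows "norm (transpose \<gamma> *v a) \<le> (real CARD('d))\<^sup>2 * B * norm a"
proof -
  have entry: "\<bar>\<gamma> $ j $ i\<bar> \<le> B" for i j
    using component_le_norm_cart[of "\<gamma> $ j" i] Finite_Cartesian_Product.norm_nth_le[of \<gamma> j] assms by simp
  have "\<bar>(transpose \<gamma> *v a) $ i\<bar> \<le> real CARD('d) * (B * norm a)" for i
  proof -
    have "\<bar>(transpose \<gamma> *v a) $ i\<bar> \<le> (\<Sum>j\<in>UNIV. \<bar>\<gamma> $ j $ i * a $ j\<bar>)"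
      by (simp add: matrix_vector_mult_def transpose_def sum_abs)
    also have "\<dots> \<le> (\<Sum>j\<in>(UNIV :: 'd set). B * norm a)"
      unfolding abs_mult using entry component_le_norm_cart[of a]
      by (intro sum_mono mult_mono) (auto intro: order_trans[OF norm_ge_zero assms])
    finally show ?thesis by simp
  qed
  then have "(\<Sum>i\<in>UNIV. \<bar>(transpose \<gamma> *v a) $ i\<bar>) \<le> (\<Sum>i\<in>(UNIV :: 'd set). real CARD('d) * (B * norm a))"
    by (intro sum_mono)
  then show ?thesis
    using norm_le_l1_cart[of "transpose \<gamma> *v a"] by (simp add: power2_eq_square mult_ac)
qed

lemma linear_trace_mult: "linear (\<lambda>S. c * trace (B ** S))" for B :: "real ^ 'd ^ 'd"
  by (rule linearI)
     (simp_all add: trace_def matrix_matrix_mult_def sum_distrib_left sum.distrib algebra_simps)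

lemma trace_mult_symmetric_part:
  fixes B S :: "real ^ 'd ^ 'd"
  assumes "transpose B = B"
  shows "trace (B ** ((1/2) *\<^sub>R (S + transpose S))) = trace (B ** S)"
proof -
  interpret t: linear "\<lambda>S. 1 * trace (B ** S)" by (rule linear_trace_mult)
  have "trace (B ** transpose S) = trace (transpose (B ** transpose S))"
    by (simp add: trace_def transpose_def)
  also have "\<dots> = trace (S ** B)" by (simp add: matrix_transpose_mul assms)
  also have "\<dots> = trace (B ** S)" by (rule trace_mul_sym)
  finally have "trace (B ** transpose S) = trace (B ** S)" .
  then show ?thesis using t.scale[of "1/2" "S + transpose S"] t.add[of S "transpose S"] by simp
qed

lemma symmetric_part_quadratic:
  "(((1/2) *\<^sub>R (S + transpose S)) *v z) \<bullet> z = (S *v z) \<bullet> z" for S :: "real ^ 'd ^ 'd"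
proof -
  have "(transpose S *v z) \<bullet> z = (S *v z) \<bullet> z"
    unfolding transpose_matrix_vector dot_lmul_matrix by (rule inner_commute)
  then show ?thesis
    by (simp add: scaleR_matrix_vector_assoc[symmetric] matrix_vector_mult_add_rdistrib inner_add_left)
qed

lemma G_star_quadratic_form:
  "(\<And>z. (A *v z) \<bullet> z = (B *v z) \<bullet> z) \<Longrightarrow> G_star E X A = G_star E X B"
  by (simp add: G_star_def)

lemma (in superlinear_expectation_space) G_star_add_mat:
  fixes X :: "'w \<Rightarrow> real ^ 'd"
  assumes X: "random_vector H X" and \<beta>: "\<beta> \<ge> 0"
  shows "G_star E X (S + \<beta> *\<^sub>R mat 1) \<le> G_star E X S + (1/2 * upper (\<lambda>\<omega>. (mat 1 *v X \<omega>) \<bullet> X \<omega>)) * \<beta>"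
proof -
  have q: "(\<lambda>\<omega>. (A *v X \<omega>) \<bullet> X \<omega>) \<in> H" for A by (rule cl_Lip_in[OF X cl_Lip_quadratic])
  have "((S + \<beta> *\<^sub>R mat 1) *v z) \<bullet> z = (S *v z) \<bullet> z + \<beta> * ((mat 1 *v z) \<bullet> z)" for z
    by (simp add: matrix_vector_mult_add_rdistrib inner_add_left scaleR_matrix_vector_assoc[symmetric])
  then have "E (\<lambda>\<omega>. ((S + \<beta> *\<^sub>R mat 1) *v X \<omega>) \<bullet> X \<omega>) \<le> E (\<lambda>\<omega>. (S *v X \<omega>) \<bullet> X \<omega>) + \<beta> * upper (\<lambda>\<omega>. (mat 1 *v X \<omega>) \<bullet> X \<omega>)"
    using E_add_le[OF q scale_in[OF q], of S \<beta> "mat 1"] upper_scale[OF \<beta> q, of "mat 1"] by simp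
  then show ?thesis by (simp add: G_star_def field_simps)
qed

text \<open>Continuity on the compact set \<open>\<Gamma>\<close>. An infimum of reals lies below
  the members once the set is bounded from below.\<close>

lemma bdd_below_trace_gram:
  fixes \<Gamma> :: "(real ^ 'd ^ 'd) set"
  assumes "bounded \<Gamma>" and "closed \<Gamma>"
  shows "bdd_below ((\<lambda>\<gamma>. trace (\<gamma> ** transpose \<gamma> ** A)) ` \<Gamma>)"
proof -
  have "continuous_on \<Gamma> (\<lambda>\<gamma>. trace (\<gamma> ** transpose \<gamma> ** A))"
    unfolding trace_def matrix_matrix_mult_def transpose_def by (simp, intro continuous_intros)
  then have "compact ((\<lambda>\<gamma>. trace (\<gamma> ** transpose \<gamma> ** A)) ` \<Gamma>)"
    using assms by (intro compact_continuous_image) (simp_all add: compact_eq_bounded_closed)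
  then show ?thesis by (intro bounded_imp_bdd_below compact_imp_bounded)
qed

text \<open>Both sides see only the symmetric part of \<open>S\<close>: the left one through the
  quadratic form, the right one because \<open>\<gamma> ** transpose \<gamma>\<close> is symmetric.
  Jets carry arbitrary matrices, hence the extension.\<close>

lemma G_star_trace_formula:
  fixes X :: "'w \<Rightarrow> real ^ 'd" and \<Gamma> :: "(real ^ 'd ^ 'd) set"
  assumes "\<And>A. transpose A = A \<Longrightarrow> G_star E X A = 1 / 2 * (INF \<gamma>\<in>\<Gamma>. trace (\<gamma> ** transpose \<gamma> ** A))"
  shows "G_star E X S = 1 / 2 * (INF \<gamma>\<in>\<Gamma>. trace (\<gamma> ** transpose \<gamma> ** S))"
proof -
  define S' where "S' = (1/2) *\<^sub>R (S + transpose S)"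
  have "transpose S' = S'" by (simp add: S'_def transpose_def vec_eq_iff add.commute)
  moreover have "G_star E X S = G_star E X S'"
    unfolding S'_def by (rule G_star_quadratic_form[symmetric]) (rule symmetric_part_quadratic)
  moreover have "trace (\<gamma> ** transpose \<gamma> ** S') = trace (\<gamma> ** transpose \<gamma> ** S)" for \<gamma> :: "real ^ 'd ^ 'd"
    unfolding S'_def by (rule trace_mult_symmetric_part) (simp add: matrix_transpose_mul)
  ultimately show ?thesis using assms[of S'] by simp
qed

lemma jet_sub_shift:
  assumes "jet_sub F u" and "0 \<le> s"
  shows "jet_sub F (\<lambda>t. u (t + s))"
  unfolding jet_sub_def
proof (intro allI impI)
  fix t :: real and x q p S
  assume t: "t > 0" and J: "upper_jet (\<lambda>t. u (t + s)) t x q p S"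
  have "upper_jet u (t + s) x q p S"
    unfolding upper_jet_def
  proof (intro allI impI)
    fix \<delta> :: real assume "\<delta> > 0"
    then obtain K r where r: "r > 0" and K: "\<And>s' y. \<bar>s' - t\<bar> < r \<Longrightarrow> norm (y - x) < r \<Longrightarrow>
       u (s' + s) y \<le> u (t + s) x + q * (s' - t) + p \<bullet> (y - x) + (S *v (y - x)) \<bullet> (y - x) / 2
             + \<delta> * (norm (y - x))\<^sup>2 + K * (s' - t)\<^sup>2"
      using J unfolding upper_jet_def by meson
    show "\<exists>K. \<exists>r>0. \<forall>s' y. \<bar>s' - (t + s)\<bar> < r \<longrightarrow> norm (y - x) < r \<longrightarrow>
       u s' y \<le> u (t + s) x + q * (s' - (t + s)) + p \<bullet> (y - x) + (S *v (y - x)) \<bullet> (y - x) / 2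
             + \<delta> * (norm (y - x))\<^sup>2 + K * (s' - (t + s))\<^sup>2"
    proof (rule exI[of _ K], rule exI[of _ r], intro conjI allI impI r)
      fix s' y assume "\<bar>s' - (t + s)\<bar> < r" "norm (y - x) < r"
      then show "u s' y \<le> u (t + s) x + q * (s' - (t + s)) + p \<bullet> (y - x) + (S *v (y - x)) \<bullet> (y - x) / 2
             + \<delta> * (norm (y - x))\<^sup>2 + K * (s' - (t + s))\<^sup>2"
        using K[of "s' - s" y] by (simp add: diff_diff_eq add.commute)
    qed
  qed
  then show "q \<le> F S" using assms t unfolding jet_sub_def by (meson add_pos_nonneg)
qed

section \<open>Evolutions of periodic data\<close>

lemma torus_Lip_Lipschitz:
  fixes g :: "real ^ 'd \<Rightarrow> real"
  assumes "torus_Lip K g" and K: "K \<ge> 0"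
  shows "\<bar>g x - g y\<bar> \<le> K * real CARD('d) * norm (x - y)"
proof -
  have "\<bar>g x - g y\<bar> \<le> K * (\<Sum>i\<in>UNIV. \<bar>sin ((x $ i - y $ i) / 2)\<bar>)"
    using assms(1) by (simp add: torus_Lip_def)
  also have "\<dots> \<le> K * (\<Sum>i\<in>(UNIV :: 'd set). norm (x - y))"
  proof (intro mult_left_mono sum_mono K)
    fix i
    have "\<bar>sin ((x $ i - y $ i) / 2)\<bar> \<le> \<bar>(x $ i - y $ i) / 2\<bar>" by (rule abs_sin_x_le_abs_x)
    also have "\<dots> \<le> \<bar>(x - y) $ i\<bar>" by simp
    also have "\<dots> \<le> norm (x - y)" by (rule component_le_norm_cart)
    finally show "\<bar>sin ((x $ i - y $ i) / 2)\<bar> \<le> norm (x - y)" .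
  qed
  finally show ?thesis by (simp add: mult.assoc)
qed

lemma torus_Lip_bounded:
  fixes g :: "real ^ 'd \<Rightarrow> real"
  assumes "torus_Lip K g" and K: "K \<ge> 0"
  shows "\<bar>g y\<bar> \<le> \<bar>g 0\<bar> + K * real CARD('d)"
proof -
  have "\<bar>g y - g 0\<bar> \<le> K * (\<Sum>i\<in>(UNIV :: 'd set). \<bar>sin ((y $ i - 0 $ i) / 2)\<bar>)"
    using assms(1) unfolding torus_Lip_def by blast
  also have "\<dots> \<le> K * (\<Sum>i\<in>(UNIV :: 'd set). 1)"
    by (intro mult_left_mono sum_mono K) auto
  finally show ?thesis by simp
qed

lemma torus_Lip_cl_Lip: "torus_Lip K g \<Longrightarrow> K \<ge> 0 \<Longrightarrow> cl_Lip g"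
  by (rule cl_Lip_Lipschitz, rule torus_Lip_Lipschitz)

context superlinear_expectation_space
begin

lemma torus_Lip_evolution:
  fixes X :: "'w \<Rightarrow> real ^ 'd"
  assumes X: "random_vector H X" and g: "torus_Lip K g" and K: "K \<ge> 0"
  shows "torus_Lip K (evolution E X g t)"
  unfolding torus_Lip_def evolution_def
proof (intro allI abs_E_diff_le_const affine_in[OF X torus_Lip_cl_Lip[OF g K]])
  fix x y \<omega>
  show "\<bar>g (x + sqrt t *\<^sub>R X \<omega>) - g (y + sqrt t *\<^sub>R X \<omega>)\<bar> \<le> K * (\<Sum>i\<in>UNIV. \<bar>sin ((x $ i - y $ i) / 2)\<bar>)"
    using g unfolding torus_Lip_def by (metis (no_types, lifting) add_diff_cancel_right sum.cong vector_add_component)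
qed

lemma evolution_bounded:
  fixes X :: "'w \<Rightarrow> real ^ 'd"
  assumes X: "random_vector H X" and g: "cl_Lip g" and B: "\<And>y. \<bar>g y\<bar> \<le> B"
  shows "\<bar>evolution E X g t x\<bar> \<le> B"
  using abs_E_diff_le_const[OF affine_in[OF X g] zero_in, of x "sqrt t" B] B
  by (simp add: evolution_def const)

text \<open>The constants involve \<open>g\<close> only through \<open>B\<close> and
  \<open>K\<close>, which evolution preserves, so two evolutions with different data can share them.
  The modulus in time rests on |sqrt a - sqrt b| \<le> sqrt |a - b|.\<close>

lemma regular_evolution:
  fixes X :: "'w \<Rightarrow> real ^ 'd"
  assumes X: "random_vector H X" and g: "torus_Lip K g" and K: "K \<ge> 0" and B: "\<And>y. \<bar>g y\<bar> \<le> B" and s: "s \<ge> 0"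
  shows "regular (\<lambda>t. evolution E X g (t + s)) B K (K * real CARD('d) * moment X 1)"
  unfolding regular_def
proof (intro conjI allI impI)
  note gl = torus_Lip_cl_Lip[OF g K]
  show "\<bar>evolution E X g (t + s) y\<bar> \<le> B" for t y by (rule evolution_bounded[OF X gl B])
  show "torus_Lip K (evolution E X g (t + s))" for t by (rule torus_Lip_evolution[OF X g K])
  have "continuous_on ({0..} \<times> UNIV) (\<lambda>z. (\<lambda>(t, x). evolution E X g t x) (fst z + s, snd z))"
    by (rule continuous_on_compose2[OF continuous_on_evolution[OF X gl]]) (use s in \<open>auto intro!: continuous_intros\<close>)
  then show "continuous_on ({0..} \<times> UNIV) (\<lambda>(t, y). evolution E X g (t + s) y)"
    by (simp add: case_prod_unfold)
  fix t r :: real and y assume tr: "0 \<le> t" "0 \<le> r"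
  define a where "a = sqrt (t + s)"
  define b where "b = sqrt (r + s)"
  have "\<bar>a - b\<bar> \<le> sqrt \<bar>t - r\<bar>"
  proof -
    have ab: "a \<ge> 0" "b \<ge> 0" "a\<^sup>2 = t + s" "b\<^sup>2 = r + s" using tr s by (auto simp: a_def b_def)
    have "\<bar>a - b\<bar> * \<bar>a - b\<bar> \<le> \<bar>a - b\<bar> * (a + b)" using ab by (intro mult_left_mono) auto
    also have "\<dots> = \<bar>(a - b) * (a + b)\<bar>" using ab by (simp add: abs_mult)
    also have "(a - b) * (a + b) = t - r" using ab by (simp add: power2_eq_square algebra_simps)
    finally have "\<bar>a - b\<bar>\<^sup>2 \<le> \<bar>t - r\<bar>" by (simp add: power2_eq_square)
    then show ?thesis by (intro real_le_rsqrt)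
  qed
  moreover have "\<bar>evolution E X g (t + s) y - evolution E X g (r + s) y\<bar> \<le> (K * real CARD('d) * \<bar>a - b\<bar>) * moment X 1"
    unfolding evolution_def a_def[symmetric] b_def[symmetric]
  proof (rule abs_E_diff_le_moment[OF X affine_in[OF X gl] affine_in[OF X gl]])
    show "0 \<le> K * real CARD('d) * \<bar>a - b\<bar>" using K by simp
    fix \<omega>
    have "\<bar>g (y + a *\<^sub>R X \<omega>) - g (y + b *\<^sub>R X \<omega>)\<bar> \<le> K * real CARD('d) * norm ((y + a *\<^sub>R X \<omega>) - (y + b *\<^sub>R X \<omega>))"
      by (rule torus_Lip_Lipschitz[OF g K])
    also have "(y + a *\<^sub>R X \<omega>) - (y + b *\<^sub>R X \<omega>) = (a - b) *\<^sub>R X \<omega>" by (simp add: algebra_simps)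
    also have "K * real CARD('d) * norm ((a - b) *\<^sub>R X \<omega>) \<le> K * real CARD('d) * \<bar>a - b\<bar> * (1 + norm (X \<omega>)) ^ 1"
      unfolding norm_scaleR power_one_right mult.assoc using K by (intro mult_left_mono) auto
    finally show "\<bar>g (y + a *\<^sub>R X \<omega>) - g (y + b *\<^sub>R X \<omega>)\<bar> \<le> K * real CARD('d) * \<bar>a - b\<bar> * (1 + norm (X \<omega>)) ^ 1" .
  qed
  moreover have "(K * real CARD('d) * \<bar>a - b\<bar>) * moment X 1 \<le> (K * real CARD('d) * sqrt \<bar>t - r\<bar>) * moment X 1"
    if "\<bar>a - b\<bar> \<le> sqrt \<bar>t - r\<bar>"
    using that K moment_nonneg[OF X, of 1] by (intro mult_right_mono mult_left_mono) auto
  ultimately show "\<bar>evolution E X g (t + s) y - evolution E X g (r + s) y\<bar> \<le> K * real CARD('d) * moment X 1 * sqrt \<bar>t - r\<bar>"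
    by (simp add: mult_ac)
qed

text \<open>On rank-one matrices the trace of \<gamma> \<gamma>^T a a^T is |\<gamma>^T a|^2, which
  gives positivity and, as \<open>\<Gamma>\<close> is bounded, the upper bound.\<close>

lemma concave_operator_G_star:
  fixes X :: "'w \<Rightarrow> real ^ 'd" and \<Gamma> :: "(real ^ 'd ^ 'd) set"
  assumes X: "random_vector H X" and \<Gamma>: "bounded \<Gamma>" "\<Gamma> \<noteq> {}"
    and formula: "\<And>A. G_star E X A = 1 / 2 * (INF \<gamma>\<in>\<Gamma>. trace (\<gamma> ** transpose \<gamma> ** A))"
  shows "\<exists>M. concave_operator (G_star E X) ((\<lambda>\<gamma> A. 1 / 2 * trace (\<gamma> ** transpose \<gamma> ** A)) ` \<Gamma>) M
           (1/2 * upper (\<lambda>\<omega>. (mat 1 *v X \<omega>) \<bullet> X \<omega>))"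
proof -
  obtain B where B: "\<And>\<gamma>. \<gamma> \<in> \<Gamma> \<Longrightarrow> norm \<gamma> \<le> B" using \<Gamma>(1) unfolding bounded_iff by blast
  define M where "M = 1 / 2 * ((real CARD('d))\<^sup>2 * B)\<^sup>2"
  have out: "1 / 2 * trace (\<gamma> ** transpose \<gamma> ** outer a) = 1 / 2 * (norm (transpose \<gamma> *v a))\<^sup>2" for \<gamma> :: "real ^ 'd ^ 'd" and a
    by (simp only: trace_mult_outer gram_quadratic)
  have "concave_operator (G_star E X) ((\<lambda>\<gamma> A. 1 / 2 * trace (\<gamma> ** transpose \<gamma> ** A)) ` \<Gamma>) M
           (1/2 * upper (\<lambda>\<omega>. (mat 1 *v X \<omega>) \<bullet> X \<omega>))"
  proof (rule concave_operator.intro)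
    fix \<l> a assume "\<l> \<in> (\<lambda>\<gamma> A. 1 / 2 * trace (\<gamma> ** transpose \<gamma> ** A)) ` \<Gamma>"
    then obtain \<gamma> where \<gamma>: "\<gamma> \<in> \<Gamma>" and \<l>: "\<l> = (\<lambda>A. 1 / 2 * trace (\<gamma> ** transpose \<gamma> ** A))" by blast
    show "linear \<l>" unfolding \<l> by (rule linear_trace_mult)
    show "0 \<le> \<l> (outer a)" unfolding \<l> out by simp
    have "(norm (transpose \<gamma> *v a))\<^sup>2 \<le> ((real CARD('d))\<^sup>2 * B * norm a)\<^sup>2"
      by (intro power_mono norm_transpose_mult_le B \<gamma>) simp
    then show "\<l> (outer a) \<le> M * (norm a)\<^sup>2" unfolding \<l> out by (simp add: M_def power_mult_distrib)
  next
    fix c S assume c: "\<And>\<l>. \<l> \<in> (\<lambda>\<gamma> A. 1 / 2 * trace (\<gamma> ** transpose \<gamma> ** A)) ` \<Gamma> \<Longrightarrow> c \<le> \<l> S"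
    have "2 * c \<le> (INF \<gamma>\<in>\<Gamma>. trace (\<gamma> ** transpose \<gamma> ** S))"
    proof (rule cINF_greatest[OF \<Gamma>(2)])
      fix \<gamma> assume "\<gamma> \<in> \<Gamma>"
      then show "2 * c \<le> trace (\<gamma> ** transpose \<gamma> ** S)" using c[OF imageI] by fastforce
    qed
    then show "c \<le> G_star E X S" unfolding formula by simp
  next
    show "0 \<le> M" by (simp add: M_def)
  qed (rule G_star_add_mat[OF X])
  then show ?thesis ..
qed

text \<open>Both sides solve the equation in \<open>t\<close> with initial value
  \<open>evolution E X g s\<close>, and comparison in both directions identifies them. Lying below
  every \<open>\<l>\<close>, \<open>G_star E X\<close> passes its subsolutions on to each of these
  operators.\<close>

lemma viscosity_imp_semigroup:
  fixes X :: "'w \<Rightarrow> real ^ 'd" and \<Gamma> :: "(real ^ 'd ^ 'd) set"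
  assumes X: "random_vector H X" and \<Gamma>: "bounded \<Gamma>" "closed \<Gamma>" "\<Gamma> \<noteq> {}"
    and formula: "\<And>A. G_star E X A = 1 / 2 * (INF \<gamma>\<in>\<Gamma>. trace (\<gamma> ** transpose \<gamma> ** A))"
    and visc: "\<And>\<phi>. cl_Lip \<phi> \<Longrightarrow> viscosity_solution (\<lambda>t x r p A. G_star E X A) \<phi> (evolution E X \<phi>)"
    and g: "torus_Lip K g" and K: "K \<ge> 0" and s: "0 \<le> s" and t: "0 \<le> t"
  shows "evolution E X g (t + s) x = evolution E X (evolution E X g s) t x"
proof -
  define L where "L = (\<lambda>\<gamma> A. 1 / 2 * trace (\<gamma> ** transpose \<gamma> ** A)) ` \<Gamma>"
  obtain M where "concave_operator (G_star E X) L M (1/2 * upper (\<lambda>\<omega>. (mat 1 *v X \<omega>) \<bullet> X \<omega>))"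
    using concave_operator_G_star[OF X \<Gamma>(1,3) formula] unfolding L_def by blast
  then interpret G: concave_operator "G_star E X" L M "1/2 * upper (\<lambda>\<omega>. (mat 1 *v X \<omega>) \<bullet> X \<omega>)" .
  define g' where "g' = evolution E X g s"
  define w1 where "w1 t = evolution E X g (t + s)" for t
  \<comment> \<open>The shift by \<open>0\<close> gives \<open>w1\<close> and \<open>w2\<close> the
    same shape, so that the lemmas on shifted evolutions apply to both.\<close>
  define w2 where "w2 t = evolution E X g' (t + 0)" for t
  define B where "B = \<bar>g 0\<bar> + K * real CARD('d)"
  define C where "C = K * real CARD('d) * moment X 1"
  have C: "C \<ge> 0" using K moment_nonneg[OF X, of 1] by (simp add: C_def)
  have gl: "cl_Lip g" by (rule torus_Lip_cl_Lip[OF g K])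
  have g': "torus_Lip K g'" unfolding g'_def by (rule torus_Lip_evolution[OF X g K])
  have gl': "cl_Lip g'" by (rule torus_Lip_cl_Lip[OF g' K])
  have gB: "\<bar>g y\<bar> \<le> B" for y unfolding B_def by (rule torus_Lip_bounded[OF g K])
  have gB': "\<bar>g' y\<bar> \<le> B" for y unfolding g'_def by (rule evolution_bounded[OF X gl gB])
  have lower: "G_star E X S \<le> \<l> S" if "\<l> \<in> L" for \<l> S
    using that unfolding L_def
  proof (rule imageE)
    fix \<gamma> assume \<l>: "\<l> = (\<lambda>A. 1 / 2 * trace (\<gamma> ** transpose \<gamma> ** A))" and \<gamma>: "\<gamma> \<in> \<Gamma>"
    have "(INF \<gamma>\<in>\<Gamma>. trace (\<gamma> ** transpose \<gamma> ** S)) \<le> trace (\<gamma> ** transpose \<gamma> ** S)"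
      by (rule cINF_lower[OF bdd_below_trace_gram[OF \<Gamma>(1,2)] \<gamma>])
    then show ?thesis unfolding formula \<l> by simp
  qed
  have sub: "jet_sub \<l> (\<lambda>t. evolution E X \<phi> (t + r))" if "cl_Lip \<phi>" "\<l> \<in> L" "0 \<le> r" for \<phi> \<l> r
  proof -
    have "jet_sub (G_star E X) (\<lambda>t. evolution E X \<phi> (t + r))"
      by (rule jet_sub_shift[OF viscosity_solution_jet_sub[OF visc[OF that(1)] G_star_add_mat[OF X] G_star_quadratic_form] that(3)])
    then show ?thesis using lower[OF that(2)] unfolding jet_sub_def by (meson order_trans)
  qed
  have super: "jet_sub (\<lambda>A. - G_star E X (- A)) (\<lambda>t y. - evolution E X \<phi> (t + r) y)" if "cl_Lip \<phi>" "0 \<le> r" for \<phi> r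
    by (rule jet_sub_shift[OF viscosity_solution_jet_super[OF visc[OF that(1)] G_star_add_mat[OF X] G_star_quadratic_form] that(2)])
  have reg1: "regular w1 B K C" unfolding w1_def[abs_def] C_def by (rule regular_evolution[OF X g K gB s])
  have reg2: "regular w2 B K C" unfolding w2_def[abs_def] C_def by (rule regular_evolution[OF X g' K gB' order_refl])
  have init: "w1 0 y = w2 0 y" for y by (simp add: w1_def w2_def g'_def evolution_def[of E X _ 0] const)
  have "w1 t x \<le> w2 t x"
    by (rule G.viscosity_comparison[OF _ reg1 _ reg2 K C _ t])
       (use init sub[OF gl _ s] super[OF gl' order_refl] in \<open>auto simp: w1_def[abs_def] w2_def[abs_def]\<close>)
  moreover have "w2 t x \<le> w1 t x"
    by (rule G.viscosity_comparison[OF _ reg2 _ reg1 K C _ t])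
       (use init sub[OF gl' _ order_refl] super[OF gl s] in \<open>auto simp: w1_def[abs_def] w2_def[abs_def]\<close>)
  ultimately show ?thesis by (simp add: w1_def w2_def g'_def)
qed

end

text \<open>Since \<open>N sin (x\<^sub>i / N) \<rightarrow> x\<^sub>i\<close>, the value \<open>periodize N \<phi> (x / N)\<close> tends to \<open>\<phi> x\<close>, with an error of
  polynomial growth in \<open>x\<close>, which superlinear expectations control by moments.\<close>

definition periodize :: "real \<Rightarrow> (real ^ 'd \<Rightarrow> real) \<Rightarrow> real ^ 'd \<Rightarrow> real" where
  "periodize N \<phi> x = \<phi> (\<chi> i. N * sin (x $ i))"

text \<open>The polynomial weight is bounded on the bounded range of \<open>N\<close> times the
  sine, and sin a - sin b = 2 sin ((a - b)/2) cos ((a + b)/2) produces the half-angle differences of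
  \<open>torus_Lip\<close>.\<close>

lemma torus_Lip_periodize:
  fixes \<phi> :: "real ^ 'd \<Rightarrow> real"
  assumes "cl_Lip \<phi>" and N: "N \<ge> 0"
  shows "\<exists>K\<ge>0. torus_Lip K (periodize N \<phi>)"
proof -
  obtain C k where C: "C \<ge> 0" and b: "\<And>x y. \<bar>\<phi> x - \<phi> y\<bar> \<le> C * (1 + norm x + norm y) ^ k * norm (x - y)"
    by (rule cl_LipE[OF assms(1)]) (rule that)
  define v :: "real ^ 'd \<Rightarrow> real ^ 'd" where "v x = (\<chi> i. N * sin (x $ i))" for x
  define R where "R = real CARD('d) * N"
  have R: "R \<ge> 0" using N by (simp add: R_def)
  have nv: "norm (v x) \<le> R" for x
  proof -
    have "norm (v x) \<le> (\<Sum>i\<in>UNIV. \<bar>v x $ i\<bar>)" by (rule norm_le_l1_cart)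
    also have "\<dots> \<le> (\<Sum>i\<in>(UNIV :: 'd set). N * 1)"
    proof (rule sum_mono)
      fix i
      have "\<bar>v x $ i\<bar> = N * \<bar>sin (x $ i)\<bar>" using N by (simp add: v_def abs_mult)
      also have "\<dots> \<le> N * 1" using N by (intro mult_left_mono) auto
      finally show "\<bar>v x $ i\<bar> \<le> N * 1" .
    qed
    finally show ?thesis by (simp add: R_def)
  qed
  have dv: "norm (v x - v y) \<le> 2 * N * (\<Sum>i\<in>UNIV. \<bar>sin ((x $ i - y $ i) / 2)\<bar>)" for x y
  proof -
    have "norm (v x - v y) \<le> (\<Sum>i\<in>UNIV. \<bar>(v x - v y) $ i\<bar>)" by (rule norm_le_l1_cart)
    also have "\<dots> \<le> (\<Sum>i\<in>UNIV. 2 * N * \<bar>sin ((x $ i - y $ i) / 2)\<bar>)"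
    proof (rule sum_mono)
      fix i
      have "(v x - v y) $ i = N * (sin (x $ i) - sin (y $ i))" by (simp add: v_def algebra_simps)
      also have "\<dots> = 2 * N * sin ((x $ i - y $ i) / 2) * cos ((x $ i + y $ i) / 2)"
        by (simp add: sin_diff_sin)
      finally have "\<bar>(v x - v y) $ i\<bar> = 2 * N * \<bar>sin ((x $ i - y $ i) / 2)\<bar> * \<bar>cos ((x $ i + y $ i) / 2)\<bar>"
        using N by (simp add: abs_mult)
      also have "\<dots> \<le> 2 * N * \<bar>sin ((x $ i - y $ i) / 2)\<bar> * 1" using N by (intro mult_left_mono) auto
      finally show "\<bar>(v x - v y) $ i\<bar> \<le> 2 * N * \<bar>sin ((x $ i - y $ i) / 2)\<bar>" by simp
    qed
    finally show ?thesis by (simp add: sum_distrib_left)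
  qed
  define K where "K = C * (1 + R + R) ^ k * (2 * N)"
  have "\<bar>periodize N \<phi> x - periodize N \<phi> y\<bar> \<le> K * (\<Sum>i\<in>UNIV. \<bar>sin ((x $ i - y $ i) / 2)\<bar>)" for x y
  proof -
    have "\<bar>periodize N \<phi> x - periodize N \<phi> y\<bar> \<le> C * (1 + norm (v x) + norm (v y)) ^ k * norm (v x - v y)"
      unfolding periodize_def v_def[symmetric] by (rule b)
    also have "\<dots> \<le> C * (1 + norm (v x) + norm (v y)) ^ k * (2 * N * (\<Sum>i\<in>UNIV. \<bar>sin ((x $ i - y $ i) / 2)\<bar>))"
      using C by (intro mult_left_mono dv) auto
    also have "\<dots> \<le> C * (1 + R + R) ^ k * (2 * N * (\<Sum>i\<in>UNIV. \<bar>sin ((x $ i - y $ i) / 2)\<bar>))"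
      using C N nv by (intro mult_right_mono mult_left_mono power_mono add_mono) (auto intro!: mult_nonneg_nonneg sum_nonneg)
    finally show ?thesis by (simp add: K_def mult.assoc)
  qed
  moreover have "K \<ge> 0" using C N R by (simp add: K_def)
  ultimately show ?thesis unfolding torus_Lip_def by blast
qed

text \<open>From |w - sin w| \<le> |w|^3 at w = y_i/N it follows that |N sin (y_i/N) - y_i| \<le>
  |y|^3/N^2; this cube raises the growth exponent by 3.\<close>

lemma periodize_approx:
  fixes \<phi> :: "real ^ 'd \<Rightarrow> real"
  assumes "cl_Lip \<phi>"
  obtains C k where "C \<ge> 0"
    and "\<And>N y. N > 0 \<Longrightarrow> \<bar>periodize N \<phi> (y /\<^sub>R N) - \<phi> y\<bar> \<le> C / N\<^sup>2 * (1 + norm y) ^ k"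
proof -
  obtain C k where C: "C \<ge> 0" and b: "\<And>x y. \<bar>\<phi> x - \<phi> y\<bar> \<le> C * (1 + norm x + norm y) ^ k * norm (x - y)"
    by (rule cl_LipE[OF assms]) (rule that)
  have "\<bar>periodize N \<phi> (y /\<^sub>R N) - \<phi> y\<bar> \<le> (C * 2 ^ k * real CARD('d)) / N\<^sup>2 * (1 + norm y) ^ (k + 3)" if N: "N > 0" for N y
  proof -
    define v :: "real ^ 'd" where "v = (\<chi> i. N * sin ((y /\<^sub>R N) $ i))"
    have vi: "v $ i = N * sin (y $ i / N)" for i by (simp add: v_def divide_inverse mult.commute)
    have nv: "norm v \<le> norm y"
    proof (rule norm_le_componentwise_cart)
      fix i
      have "N * \<bar>sin (y $ i / N)\<bar> \<le> N * \<bar>y $ i / N\<bar>" using N by (intro mult_left_mono abs_sin_x_le_abs_x) auto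
      then show "norm (v $ i) \<le> norm (y $ i)" using N by (simp add: vi abs_mult)
    qed
    have dv: "norm (v - y) \<le> real CARD('d) * (norm y ^ 3 / N\<^sup>2)"
    proof -
      have "\<bar>(v - y) $ i\<bar> \<le> norm y ^ 3 / N\<^sup>2" for i
      proof -
        define w where "w = y $ i / N"
        have "\<bar>w - sin w\<bar> \<le> \<bar>w\<bar> ^ 3" using cos_second_order[of "pi/2" w] by (simp add: cos_add)
        then have "N * \<bar>sin w - w\<bar> \<le> N * \<bar>w\<bar> ^ 3" using N by (intro mult_left_mono) (auto simp: abs_minus_commute)
        moreover have "(v - y) $ i = N * (sin w - w)" using N by (simp add: vi w_def algebra_simps)
        moreover have "N * \<bar>w\<bar> ^ 3 = \<bar>y $ i\<bar> ^ 3 / N\<^sup>2"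
          using N by (simp add: w_def power_divide power2_eq_square power3_eq_cube)
        moreover have "\<bar>y $ i\<bar> ^ 3 / N\<^sup>2 \<le> norm y ^ 3 / N\<^sup>2"
          by (intro divide_right_mono power_mono component_le_norm_cart) auto
        ultimately show ?thesis using N by (simp add: abs_mult)
      qed
      then have "(\<Sum>i\<in>UNIV. \<bar>(v - y) $ i\<bar>) \<le> (\<Sum>i\<in>(UNIV :: 'd set). norm y ^ 3 / N\<^sup>2)" by (intro sum_mono)
      then show ?thesis using norm_le_l1_cart[of "v - y"] by simp
    qed
    have "\<bar>periodize N \<phi> (y /\<^sub>R N) - \<phi> y\<bar> \<le> C * (1 + norm v + norm y) ^ k * norm (v - y)"
      unfolding periodize_def v_def[symmetric] by (rule b)
    also have "\<dots> \<le> C * (1 + norm v + norm y) ^ k * (real CARD('d) * (norm y ^ 3 / N\<^sup>2))"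
      using C by (intro mult_left_mono dv) auto
    also have "\<dots> \<le> C * (2 * (1 + norm y)) ^ k * (real CARD('d) * ((1 + norm y) ^ 3 / N\<^sup>2))"
      using C nv by (intro mult_mono mult_left_mono power_mono divide_right_mono) auto
    also have "\<dots> = (C * 2 ^ k * real CARD('d)) / N\<^sup>2 * (1 + norm y) ^ (k + 3)"
      by (simp only: power_mult_distrib power_add times_divide_eq_right times_divide_eq_left mult_ac)
    finally show ?thesis .
  qed
  moreover have "C * 2 ^ k * real CARD('d) \<ge> 0" using C by simp
  ultimately show ?thesis by (rule that[rotated])
qed

text \<open>On the product extension the expectation of a function of a X + b X' is a composition of
  two evolutions at the origin. The semigroup law for periodized functions identifies it with that
  of sqrt (a^2 + b^2) X up to O(1/N^2), and \<open>N\<close> tends to infinity.\<close>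

lemma (in superlinear_expectation_space) viscosity_imp_normal:
  fixes X :: "'w \<Rightarrow> real ^ 'd" and \<Gamma> :: "(real ^ 'd ^ 'd) set"
  assumes X: "random_vector H X" and \<Gamma>: "bounded \<Gamma>" "closed \<Gamma>" "\<Gamma> \<noteq> {}"
    and formula: "\<And>A. G_star E X A = 1 / 2 * (INF \<gamma>\<in>\<Gamma>. trace (\<gamma> ** transpose \<gamma> ** A))"
    and visc: "\<And>\<phi>. cl_Lip \<phi> \<Longrightarrow> viscosity_solution (\<lambda>t x r p A. G_star E X A) \<phi> (evolution E X \<phi>)"
  shows "G_star_normal H E X"
proof -
  interpret P: superlinear_expectation_space prod_H prod_E by (rule prod_space)
  have "eq_dist prod_E (\<lambda>\<omega>. a *\<^sub>R X (fst \<omega>) + b *\<^sub>R X (snd \<omega>)) (\<lambda>\<omega>. sqrt (a\<^sup>2 + b\<^sup>2) *\<^sub>R X (fst \<omega>))"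
    if a: "0 \<le> a" and b: "0 \<le> b" for a b
    unfolding eq_dist_def
  proof (intro allI impI)
    fix \<phi> :: "real ^ 'd \<Rightarrow> real" assume \<phi>: "cl_Lip \<phi>"
    define c where "c = sqrt (a\<^sup>2 + b\<^sup>2)"
    define Y where "Y \<omega> = a *\<^sub>R X (fst \<omega>) + b *\<^sub>R X (snd \<omega>)" for \<omega>
    define Z where "Z \<omega> = c *\<^sub>R X (fst \<omega>)" for \<omega> :: "'w \<times> 'w"
    have X1: "(\<lambda>\<omega>. X (fst \<omega>) $ i) \<in> prod_H" for i
      using X by (intro prod_base_in, unfold prod_base_def random_vector_def) (intro UnI1 CollectI exI[of _ "\<lambda>\<omega>. X \<omega> $ i"], simp)
    have X2: "(\<lambda>\<omega>. X (snd \<omega>) $ i) \<in> prod_H" for i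
      using prod_random_vector[OF X] by (simp add: random_vector_def)
    have Y: "random_vector prod_H Y" and Z: "random_vector prod_H Z"
      using P.add_in[OF P.scale_in[OF X1] P.scale_in[OF X2]] P.scale_in[OF X1]
      by (auto simp: random_vector_def Y_def Z_def)
    obtain C k where C: "C \<ge> 0"
      and ap: "\<And>N y. N > 0 \<Longrightarrow> \<bar>periodize N \<phi> (y /\<^sub>R N) - \<phi> y\<bar> \<le> C / N\<^sup>2 * (1 + norm y) ^ k"
      by (rule periodize_approx[OF \<phi>]) (rule that)
    have close: "\<bar>prod_E (\<lambda>\<omega>. periodize N \<phi> (W \<omega> /\<^sub>R N)) - prod_E (\<lambda>\<omega>. \<phi> (W \<omega>))\<bar> \<le> C / N\<^sup>2 * P.moment W k"
      if W: "random_vector prod_H W" and N: "N > 0" for W N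
    proof (rule P.abs_E_diff_le_moment[OF W])
      obtain K where "K \<ge> 0" "torus_Lip K (periodize N \<phi>)" using torus_Lip_periodize[OF \<phi> less_imp_le[OF N]] by blast
      then have "cl_Lip (periodize N \<phi>)" by (intro torus_Lip_cl_Lip)
      from P.affine_in[OF W this, of 0 "inverse N"] show "(\<lambda>\<omega>. periodize N \<phi> (W \<omega> /\<^sub>R N)) \<in> prod_H" by simp
      show "(\<lambda>\<omega>. \<phi> (W \<omega>)) \<in> prod_H" by (rule P.cl_Lip_in[OF W \<phi>])
      show "0 \<le> C / N\<^sup>2" using C by simp
      show "\<bar>periodize N \<phi> (W \<omega> /\<^sub>R N) - \<phi> (W \<omega>)\<bar> \<le> C / N\<^sup>2 * (1 + norm (W \<omega>)) ^ k" for \<omega>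
        by (rule ap[OF N])
    qed
    have same: "prod_E (\<lambda>\<omega>. periodize N \<phi> (Y \<omega> /\<^sub>R N)) = prod_E (\<lambda>\<omega>. periodize N \<phi> (Z \<omega> /\<^sub>R N))" if N: "N > 0" for N
    proof -
      obtain K where K: "K \<ge> 0" and g: "torus_Lip K (periodize N \<phi>)" using torus_Lip_periodize[OF \<phi> less_imp_le[OF N]] by blast
      \<comment> \<open>The factor 1/N in the argument is moved into the times, whose square roots
        are \<open>a / N\<close> and \<open>b / N\<close>.\<close>
      define s where "s = (a / N)\<^sup>2"
      define t where "t = (b / N)\<^sup>2"
      have "sqrt s = a / N" "sqrt t = b / N" using a b N by (auto simp: s_def t_def)
      moreover have "sqrt (s + t) = c / N"
      proof -
        have "s + t = (a\<^sup>2 + b\<^sup>2) / N\<^sup>2" by (simp add: s_def t_def power_divide add_divide_distrib)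
        then show ?thesis using N by (simp add: c_def real_sqrt_divide)
      qed
      moreover have "evolution E X (periodize N \<phi>) (s + t) 0 = evolution E X (evolution E X (periodize N \<phi>) t) s 0"
        by (rule viscosity_imp_semigroup[OF X \<Gamma> formula visc g K]) (auto simp: s_def t_def)
      ultimately show ?thesis
        by (simp add: prod_E_def Y_def Z_def evolution_def const scaleR_add_right divide_inverse mult.commute)
    qed
    define D where "D = C * (P.moment Y k + P.moment Z k)"
    have bound: "\<bar>prod_E (\<lambda>\<omega>. \<phi> (Y \<omega>)) - prod_E (\<lambda>\<omega>. \<phi> (Z \<omega>))\<bar> \<le> D / N\<^sup>2" if N: "N > 0" for N :: real
      using close[OF Y N] close[OF Z N] same[OF N] unfolding D_def
      by (simp add: distrib_left add_divide_distrib)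
    have "((\<lambda>N. D / N\<^sup>2) \<longlongrightarrow> 0) at_top"
      by (intro tendsto_divide_0[OF tendsto_const] filterlim_at_top_imp_at_infinity filterlim_pow_at_top filterlim_ident) simp
    moreover have "\<forall>\<^sub>F N in at_top. \<bar>prod_E (\<lambda>\<omega>. \<phi> (Y \<omega>)) - prod_E (\<lambda>\<omega>. \<phi> (Z \<omega>))\<bar> \<le> D / N\<^sup>2"
      using eventually_gt_at_top[of 0] by eventually_elim (rule bound)
    ultimately have "\<bar>prod_E (\<lambda>\<omega>. \<phi> (Y \<omega>)) - prod_E (\<lambda>\<omega>. \<phi> (Z \<omega>))\<bar> \<le> 0"
      by (intro tendsto_lowerbound) auto
    then show "prod_E (\<lambda>\<omega>. \<phi> (a *\<^sub>R X (fst \<omega>) + b *\<^sub>R X (snd \<omega>))) = prod_E (\<lambda>\<omega>. \<phi> (sqrt (a\<^sup>2 + b\<^sup>2) *\<^sub>R X (fst \<omega>)))"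
      by (simp add: Y_def Z_def c_def)
  qed
  then show ?thesis
    unfolding G_star_normal_def
    using prod_extends prod_random_vector[OF X] prod_independent_copy[of X] by blast
qed

theorem proposition2p2:
  fixes H :: "('w \<Rightarrow> real) set"
    and E :: "('w \<Rightarrow> real) \<Rightarrow> real"
    and X :: "'w \<Rightarrow> real ^ 'd"
    and \<Gamma> :: "(real ^ 'd ^ 'd) set"
  assumes "superlinear_expectation_space H E"
    and "random_vector H X"
    and "bounded \<Gamma>" and "closed \<Gamma>" and "\<Gamma> \<noteq> {}"
    and "\<And>A. transpose A = A \<Longrightarrow>
           G_star E X A = 1 / 2 * (INF \<gamma>\<in>\<Gamma>. trace (\<gamma> ** transpose \<gamma> ** A))"
  shows "G_star_normal H E X \<longleftrightarrow>
    (\<forall>\<phi>. cl_Lip \<phi> \<longrightarrow>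
       viscosity_solution (\<lambda>t x r p A. G_star E X A) \<phi>
         (\<lambda>t x. E (\<lambda>\<omega>. \<phi> (x + sqrt t *\<^sub>R X \<omega>))))"
proof -
  interpret superlinear_expectation_space H E by fact
  have ev: "(\<lambda>t x. E (\<lambda>\<omega>. \<phi> (x + sqrt t *\<^sub>R X \<omega>))) = evolution E X \<phi>" for \<phi>
    by (simp add: evolution_def fun_eq_iff)
  have formula: "G_star E X A = 1 / 2 * (INF \<gamma>\<in>\<Gamma>. trace (\<gamma> ** transpose \<gamma> ** A))" for A
    by (rule G_star_trace_formula[OF assms(6)])
  show ?thesis
    unfolding ev
    using normal_imp_viscosity_solution[OF assms(2)]
      viscosity_imp_normal[OF assms(2) assms(3-5) formula] by blast
qed

end
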